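(* Let $n\ge2$, $1\le p<n$ and $\frac1p-\frac1{p^*}=\frac1n$. There is a constant $c$ depending only on $n$ and $p$ such that for every weight $w\in A_1$ on $\mathbb{R}^n$, every Lipschitz function $f$ and every cube $Q$ $$\left(\frac{1}{w(Q)}\int_Q|f-f_{Q,w}|^{p^*}\,w\,dx\right)^{1/p^*}\le c\,[w]_{A_1}\,\ell(Q)\left(\frac{1}{w(Q)}\int_Q|\nabla f|^p\,w\,dx\right)^{1/p}.$$ Furthermore, the result is sharp in the case $p=1$ (for which $p^*=\frac{n}{n-1}$) in the following sense: if $\psi:[1,\infty)\to(0,\infty)$ satisfies $\psi(t)=o(t)$ as $t\to\infty$, then there is no constant $c$ for which the inequality $$\left(\frac{1}{w(Q)}\int_Q|f-f_{Q,w}|^{\frac{n}{n-1}}\,w\,dx\right)^{\frac{n-1}{n}}\le c\,\psi([w]_{A_1})\,\ell(Q)\,\frac{1}{w(Q)}\int_Q|\nabla f|\,w\,dx$$ holds for all $w\in A_1$, all Lipschitz $f$ and all cubes $Q$.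
   Context: Cubes are cubes in $\mathbb{R}^n$ with sides parallel to the coordinate axes, with side length $\ell(Q)$. A weight is a locally integrable non-negative function; $w(Q)=\int_Q w\,dx$; $f_{Q,w}=\frac{1}{w(Q)}\int_Q f\,w\,dx$. A weight $w$ is in $A_1$ if $$[w]_{A_1}:=\sup_Q\left(\frac{1}{|Q|}\int_Q w\,dx\right)\operatorname*{ess\,sup}_Q(w^{-1})<\infty.$$ *)

theory Defs
  imports "HOL-Analysis.Analysis" "HOL-Probability.Essential_Supremum" "HOL-Library.Landau_Symbols"
begin

text \<open>Closed cubes with sides parallel to the axes, given by their lower corner and their
  (positive) side length. Faces are null sets, so nothing depends on taking closed cubes.\<close>

definition cube :: "real ^ 'n \<Rightarrow> real \<Rightarrow> (real ^ 'n) set" where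
  "cube a l = cbox a (\<chi> i. a $ i + l)"

definition weight :: "(real ^ 'n \<Rightarrow> real) \<Rightarrow> bool" where
  "weight w \<longleftrightarrow> (\<forall>x. 0 \<le> w x) \<and> (\<forall>K. compact K \<longrightarrow> set_integrable lebesgue K w)"

definition wmass :: "(real ^ 'n \<Rightarrow> real) \<Rightarrow> (real ^ 'n) set \<Rightarrow> real" where
  "wmass w Q = (LINT x:Q|lebesgue. w x)"

definition wavg :: "(real ^ 'n \<Rightarrow> real) \<Rightarrow> (real ^ 'n) set \<Rightarrow> (real ^ 'n \<Rightarrow> real) \<Rightarrow> real" where
  "wavg w Q f = 1 / wmass w Q * (LINT x:Q|lebesgue. f x * w x)"

text \<open>The reciprocal is taken in \<^typ>\<open>ennreal\<close>, where \<open>inverse 0 = \<infinity>\<close>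
  (in \<^typ>\<open>real\<close> it would be \<open>0\<close>).\<close>

definition A1_const :: "(real ^ 'n \<Rightarrow> real) \<Rightarrow> ennreal" where
  "A1_const w = (SUP (a, l) \<in> UNIV \<times> {0<..}.
     ennreal (1 / measure lebesgue (cube a l) * wmass w (cube a l)) *
     esssup (lebesgue_on (cube a l)) (\<lambda>x. inverse (ennreal (w x))))"

text \<open>The weight that vanishes almost everywhere is excluded explicitly: in \<^typ>\<open>ennreal\<close>
  one has \<open>0 * \<infinity> = 0\<close>, so its constant would be \<open>0\<close>, while averages with respect to
  it are meaningless. For all other weights a finite constant forces \<open>w > 0\<close> almost
  everywhere.\<close>

definition A1 :: "(real ^ 'n \<Rightarrow> real) set" where
  "A1 = {w. weight w \<and> \<not> (AE x in lebesgue. w x = 0) \<and> A1_const w < \<infinity>}"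

text \<open>A Lipschitz function is differentiable almost everywhere, so the default value \<open>0\<close>
  is only used on a null set.\<close>

definition gradient :: "(real ^ 'n \<Rightarrow> real) \<Rightarrow> real ^ 'n \<Rightarrow> real ^ 'n" where
  "gradient f x = (if \<exists>D. GDERIV f x :> D then THE D. GDERIV f x :> D else 0)"

end

theory Submission
  imports Defs
begin

text \<open>A Lipschitz function is differentiable almost everywhere, and integrating along segments bounds
  \<open>|f x - f\<^sub>Q|\<close> by \<open>C l\<^sup>1\<^sup>-\<^sup>n\<close> times the integral over \<open>0 < s \<le> 1\<close> of \<open>s\<^sup>-\<^sup>n\<close> times the integral of
  \<open>|\<nabla>f|\<close> over the part of \<open>Q\<close> within distance \<open>s l\<close> of \<open>x\<close>. Testing this against \<open>w\<close> on a set \<open>E \<subseteq> Q\<close>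
  where \<open>|f - f\<^sub>Q| \<ge> t\<close>, and splitting the integral at \<open>s = (w(E)/w(Q))\<^sup>1\<^sup>/\<^sup>n\<close>, one obtains a weak type
  inequality with exponent \<open>n/(n-1)\<close> that is linear in the \<open>A\<^sub>1\<close> constant. Maz'ya's truncation
  method, applied to \<open>f - m\<close> and \<open>m - f\<close> for a weighted median \<open>m\<close>, turns it into the strong inequality
  for all \<open>1 \<le> p < n\<close>. For the sharpness take a weight equal to \<open>\<epsilon>\<close> on a slab that halves the
  cube and to \<open>1\<close> elsewhere: its \<open>A\<^sub>1\<close> constant is comparable to \<open>1/\<epsilon>\<close>.\<close>

section \<open>Lipschitz functions on the real line\<close>

text \<open>Linearity in the \<open>A1\<close> constant comes from using the condition only as a
  pointwise bound \<open>K * r ^ n * w z\<close> for the mass of \<open>w\<close> near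
  \<open>z\<close>. The same single factor \<open>K\<close> appears on both sides of the split, at
  scale \<open>s * l\<close> for small \<open>s\<close> and at scale \<open>l\<close> for large
  \<open>s\<close>, and the factor \<open>w z\<close> is what makes the integral of the gradient a
  weighted one. The split point is where the two bounds agree; the integral over \<open>s\<close> is
  then a multiple of \<open>(w(E)/w(Q))\<close> to the power \<open>1/n\<close>, which is the gain
  in the exponent. Truncation requires the weak estimate for clamped functions, whose means are
  unrelated to that of \<open>f\<close>. The median ensures that the clamped function is constant on
  at least half of the mass; it is exchanged for the weighted mean only at the very end. Since
  \<open>gradient\<close> is a pointwise derivative with a default value, everything rests on
  Rademacher's theorem and on the fundamental theorem of calculus along segments. In the slab
  example the oscillation stays bounded below while the weighted average of the gradient is of order
  \<epsilon>, so the factor in front has to grow like 1/\<epsilon>.\<close>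

text \<open>With \<open>F x = g x + (L + 1) x\<close>, which is increasing and bi-Lipschitz, the set function
  \<open>A \<longmapsto> |F(A)|\<close> is a measure that vanishes on null sets; its Radon-Nikodym density minus \<open>L + 1\<close>
  is the integrand.\<close>

lemma lipschitz_real_indefinite_integral:
  fixes g :: "real \<Rightarrow> real"
  assumes g: "L-lipschitz_on UNIV g"
  obtains h where "h \<in> borel_measurable borel"
    and "\<And>a b. set_integrable lborel {a..b} h"
    and "\<And>a b. a \<le> b \<Longrightarrow> g b - g a = (LINT x:{a..b}|lborel. h x)"
proof -
  \<comment> \<open>Slope \<open>L + 1\<close> rather than \<open>L\<close>: the increments of
    \<open>F\<close> are then at least those of the identity, so \<open>F\<close> is injective and
    onto.\<close>
  define L' where "L' = L + 1"
  have L0: "L \<ge> 0" using g by (rule lipschitz_on_nonneg)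
  have gL: "\<bar>g x - g y\<bar> \<le> L * \<bar>x - y\<bar>" for x y
    using lipschitz_onD[OF g, of x y] by (simp add: dist_real_def)
  define F where "F x = g x + L' * x" for x
  have F_low: "F y - F x \<ge> y - x" if "x \<le> y" for x y
  proof -
    have "F y - F x = (g y - g x) + L' * (y - x)" by (simp add: F_def algebra_simps)
    moreover have "g y - g x \<ge> - (L * (y - x))" using gL[of y x] that by auto
    ultimately show ?thesis by (simp add: L'_def algebra_simps)
  qed
  have F_up: "\<bar>F y - F x\<bar> \<le> (2 * L + 1) * \<bar>y - x\<bar>" for x y
  proof -
    have "F y - F x = (g y - g x) + L' * (y - x)" by (simp add: F_def algebra_simps)
    then have "\<bar>F y - F x\<bar> \<le> \<bar>g y - g x\<bar> + \<bar>L' * (y - x)\<bar>" by (metis abs_triangle_ineq)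
    also have "\<dots> \<le> L * \<bar>y - x\<bar> + L' * \<bar>y - x\<bar>"
      using gL[of y x] L0 by (simp add: abs_mult L'_def)
    finally show ?thesis by (simp add: L'_def algebra_simps)
  qed
  have Fmono: "strict_mono F"
  proof (rule strict_monoI)
    fix x y :: real assume "x < y" then show "F x < F y" using F_low[of x y] by auto
  qed
  then have Finj: "inj F" by (rule strict_mono_imp_inj_on)
  have Flip: "(2 * L + 1)-lipschitz_on UNIV F"
    using F_up L0 by (intro lipschitz_onI) (auto simp: dist_real_def)
  then have Fcont: "continuous_on UNIV F" by (rule lipschitz_on_continuous_on)
  have Fsurj: "\<exists>x. F x = y" for y
  proof -
    define b where "b = \<bar>y - F 0\<bar>"
    have "F (- b) \<le> y" using F_low[of "-b" 0] by (auto simp: b_def)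
    moreover have "y \<le> F b" using F_low[of 0 b] by (auto simp: b_def)
    moreover have "-b \<le> b" by (simp add: b_def)
    ultimately show ?thesis
      using IVT'[of F "-b" y b] continuous_on_subset[OF Fcont] by blast
  qed
  define G where "G = inv F"
  have GF: "G (F x) = x" for x using Finj by (simp add: G_def)
  have FG: "F (G y) = y" for y unfolding G_def by (rule f_inv_into_f) (use Fsurj in \<open>metis rangeI\<close>)
  have "mono G"
  proof (rule monoI)
    fix x y :: real assume "x \<le> y"
    then show "G x \<le> G y" using Fmono FG by (metis strict_mono_less_eq)
  qed
  then have G[measurable]: "G \<in> borel_measurable borel" by (rule borel_measurable_mono)
  define N where "N = distr lborel borel G"
  have vimage: "G -` A = F ` A" for A 
  proof (intro set_eqI iffI)
    fix x assume "x \<in> G -` A" then show "x \<in> F ` A" using FG[of x] by (metis image_eqI vimageE)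
  next
    fix x assume "x \<in> F ` A" then show "x \<in> G -` A" using GF by auto
  qed
  have "absolutely_continuous lborel N"
    unfolding absolutely_continuous_def
  proof
    fix A assume A: "A \<in> null_sets (lborel :: real measure)"
    then have [measurable]: "A \<in> sets borel" by auto
    have "negligible A" using A by (simp add: negligible_iff_null_sets null_sets_completionI)
    then have "negligible (F ` A)"
      by (rule negligible_locally_Lipschitz_image[rotated])
         (use F_up in \<open>auto intro!: exI[of _ UNIV]\<close>)
    moreover have "F ` A \<in> sets borel"
      unfolding vimage[symmetric] using measurable_sets[OF G, of A] by simp
    ultimately have "emeasure lborel (G -` A) = 0"
      unfolding vimage using null_sets_completion_iff[of "F ` A" lborel]
      by (simp add: negligible_iff_null_sets null_setsD1)
    then show "A \<in> null_sets N"
      by (auto simp: null_sets_def N_def emeasure_distr)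
  qed
  then obtain d where d[measurable]: "d \<in> borel_measurable borel" and Nd: "density lborel d = N"
    using sigma_finite_measure.Radon_Nikodym[OF sigma_finite_lborel, of N] by (auto simp: N_def)
  have dint: "(\<integral>\<^sup>+x. d x * indicator {a..b} x \<partial>lborel) = ennreal (F b - F a)" if "a \<le> b" for a b
  proof -
    have "(\<integral>\<^sup>+x. d x * indicator {a..b} x \<partial>lborel) = emeasure N {a..b}"
      by (simp add: Nd[symmetric] emeasure_density)
    also have "\<dots> = emeasure lborel (G -` {a..b})" by (simp add: N_def emeasure_distr)
    also have "G -` {a..b} = {F a..F b}"
      using Fmono FG by (auto simp: vimage_def) (metis strict_mono_less_eq)+
    also have "emeasure lborel {F a..F b} = ennreal (F b - F a)"
      using strict_mono_less_eq[OF Fmono] that by simp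
    finally show ?thesis .
  qed
  define e where "e x = enn2real (d x)" for x
  have [measurable]: "e \<in> borel_measurable borel" by (simp add: e_def[abs_def])
  have dfin: "AE x in lborel. d x \<noteq> \<infinity>"
  proof -
    have "AE x in lborel. d x * indicator {-real k..real k} x \<noteq> \<infinity>" for k :: nat
      by (rule nn_integral_PInf_AE) (simp_all add: dint)
    then have "AE x in lborel. \<forall>k::nat. d x * indicator {-real k..real k} x \<noteq> \<infinity>"
      by (simp add: AE_all_countable)
    then show ?thesis
    proof eventually_elim
      case (elim x)
      obtain k :: nat where "\<bar>x\<bar> \<le> real k" using real_arch_simple by blast
      then have "x \<in> {-real k..real k}" by auto
      then show ?case using elim[rule_format, of k] by (simp add: indicator_def)
    qed
  qed
  have eint: "(\<integral>\<^sup>+x. ennreal (indicator {a..b} x * e x) \<partial>lborel) = ennreal (F b - F a)" if "a \<le> b" for a b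
  proof -
    have "(\<integral>\<^sup>+x. ennreal (indicator {a..b} x * e x) \<partial>lborel) = (\<integral>\<^sup>+x. d x * indicator {a..b} x \<partial>lborel)"
      using dfin by (intro nn_integral_cong_AE) (auto simp: e_def indicator_def top.not_eq_extremum)
    then show ?thesis using dint[OF that] by simp
  qed
  have eI: "has_bochner_integral lborel (\<lambda>x. indicator {a..b} x * e x) (F b - F a)" if "a \<le> b" for a b
    using that F_low[OF that] eint
    by (intro has_bochner_integral_nn_integral) (auto simp: e_def)
  have eS: "set_integrable lborel {a..b} e" for a b
  proof (cases "a \<le> b")
    case True then show ?thesis using eI by (auto simp: set_integrable_def has_bochner_integral_iff)
  qed (simp add: set_integrable_def)
  have cS: "set_integrable lborel {a..b} (\<lambda>x. L')" for a b :: real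
    by (intro borel_integrable_atLeastAtMost' continuous_intros)
  show ?thesis
  proof
    show "(\<lambda>x. e x - L') \<in> borel_measurable borel" by measurable
    show "set_integrable lborel {a..b} (\<lambda>x. e x - L')" for a b
      using eS cS by (rule set_integral_diff)
    show "g b - g a = (LINT x:{a..b}|lborel. e x - L')" if "a \<le> b" for a b
    proof -
      have "(LINT x:{a..b}|lborel. e x - L') = (LINT x:{a..b}|lborel. e x) - (LINT x:{a..b}|lborel. L')"
        using eS cS by (rule set_integral_diff)
      also have "(LINT x:{a..b}|lborel. e x) = F b - F a"
        using eI[OF that] by (simp add: set_lebesgue_integral_def has_bochner_integral_iff)
      also have "(LINT x:{a..b}|lborel. L') = L' * (b - a)"
        using that by (simp add: set_lebesgue_integral_def)
      finally show ?thesis by (simp add: F_def algebra_simps)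
    qed
  qed
qed

text \<open>Lebesgue differentiation is available for averages over intervals
  \<open>[x, x + t]\<close> with \<open>t > 0\<close>, which controls right difference quotients
  only. Applying it also to the reflected density \<open>h (- x)\<close> gives the left ones, and
  the two exceptional sets are joined.\<close>

lemma lipschitz_real_AE_derivative:
  fixes g :: "real \<Rightarrow> real"
  assumes g: "L-lipschitz_on UNIV g"
  obtains h where "h \<in> borel_measurable borel"
    and "\<And>a b. set_integrable lborel {a..b} h"
    and "\<And>a b. a \<le> b \<Longrightarrow> g b - g a = (LINT x:{a..b}|lborel. h x)"
    and "AE x in lborel. (g has_real_derivative h x) (at x)"
proof -
  obtain h where h[measurable]: "h \<in> borel_measurable borel"
    and hS: "\<And>a b. set_integrable lborel {a..b} h"
    and hI: "\<And>a b. a \<le> b \<Longrightarrow> g b - g a = (LINT x:{a..b}|lborel. h x)"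
    using lipschitz_real_indefinite_integral[OF g] by metis
  have HI: "(h has_integral (g b - g a)) {a..b}" if "a \<le> b" for a b
    using has_integral_set_lebesgue[of "{a..b}" h] hS[of a b] hI[OF that]
    by (simp add: set_integrable_def set_lebesgue_integral_def integrable_completion integral_completion)
  have HR: "((\<lambda>x. h (- x)) has_integral (g (-a) - g (-b))) {a..b}" if "a \<le> b" for a b
    using HI[of "-b" "-a"] that has_integral_reflect_real[of h "g (-a) - g (-b)" "-a" "-b"] by simp
  have HI': "h integrable_on cbox a b" for a b
    by (cases "a \<le> b") (use HI in \<open>auto simp: integrable_on_def\<close>)
  have HR': "(\<lambda>x. h (- x)) integrable_on cbox a b" for a b
    by (cases "a \<le> b") (use HR in \<open>auto simp: integrable_on_def\<close>)
  obtain N1 where N1: "negligible N1" "\<And>x e. x \<notin> N1 \<Longrightarrow> 0 < e \<Longrightarrow>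
      \<exists>d>0. \<forall>t. 0 < t \<and> t < d \<longrightarrow> norm (integral (cbox x (x + t *\<^sub>R One)) h /\<^sub>R t ^ DIM(real) - h x) < e"
    using integrable_ccontinuous_explicit[OF HI'] by metis
  obtain N2 where N2: "negligible N2" "\<And>x e. x \<notin> N2 \<Longrightarrow> 0 < e \<Longrightarrow>
      \<exists>d>0. \<forall>t. 0 < t \<and> t < d \<longrightarrow>
        norm (integral (cbox x (x + t *\<^sub>R One)) (\<lambda>x. h (- x)) /\<^sub>R t ^ DIM(real) - h (- x)) < e"
    using integrable_ccontinuous_explicit[OF HR'] by metis
  have "(g has_real_derivative h x) (at x)" if x: "x \<notin> N1" "x \<notin> uminus ` N2" for x
    unfolding DERIV_def LIM_eq
  proof (intro allI impI)
    fix e :: real assume e: "0 < e"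
    have x2: "- x \<notin> N2" using x(2) by (metis add.inverse_inverse image_eqI)
    obtain d1 where d1: "d1 > 0" "\<And>t. 0 < t \<Longrightarrow> t < d1 \<Longrightarrow> \<bar>(g (x + t) - g x) / t - h x\<bar> < e"
    proof -
      obtain d1 where d: "d1 > 0" "\<And>t. 0 < t \<Longrightarrow> t < d1 \<Longrightarrow>
          norm (integral (cbox x (x + t *\<^sub>R One)) h /\<^sub>R t ^ DIM(real) - h x) < e"
        using N1(2)[OF x(1) e] by metis
      have "\<bar>(g (x + t) - g x) / t - h x\<bar> < e" if "0 < t" "t < d1" for t
        using d(2)[OF that] integral_unique[OF HI[of x "x + t"]] that
        by (simp add: divide_inverse mult.commute)
      then show ?thesis using d(1) that by blast
    qed
    obtain d2 where d2: "d2 > 0" "\<And>t. 0 < t \<Longrightarrow> t < d2 \<Longrightarrow> \<bar>(g x - g (x - t)) / t - h x\<bar> < e"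
    proof -
      obtain d2 where d: "d2 > 0" "\<And>t. 0 < t \<Longrightarrow> t < d2 \<Longrightarrow>
          norm (integral (cbox (- x) (- x + t *\<^sub>R One)) (\<lambda>x. h (- x)) /\<^sub>R t ^ DIM(real) - h (- (- x))) < e"
        using N2(2)[OF x2 e] by metis
      have "\<bar>(g x - g (x - t)) / t - h x\<bar> < e" if "0 < t" "t < d2" for t
        using d(2)[OF that] integral_unique[OF HR[of "-x" "-x + t"]] that
        by (simp add: divide_inverse mult.commute)
      then show ?thesis using d(1) that by blast
    qed
    show "\<exists>s>0. \<forall>t. t \<noteq> 0 \<and> norm (t - 0) < s \<longrightarrow> norm ((g (x + t) - g x) / t - h x) < e"
    proof (intro exI[of _ "min d1 d2"] conjI allI impI)
      show "0 < min d1 d2" using d1 d2 by simp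
      fix t :: real assume t: "t \<noteq> 0 \<and> norm (t - 0) < min d1 d2"
      show "norm ((g (x + t) - g x) / t - h x) < e"
      proof (cases "0 < t")
        case True then show ?thesis using d1(2)[of t] t by simp
      next
        case False
        then have "0 < - t" "- t < d2" using t by auto
        from d2(2)[OF this] have "\<bar>(g x - g (x + t)) / (- t) - h x\<bar> < e" by simp
        also have "(g x - g (x + t)) / (- t) = (g (x + t) - g x) / t"
          by (simp add: minus_divide_left[symmetric] minus_divide_right[symmetric] diff_divide_distrib)
        finally show ?thesis by simp
      qed
    qed
  qed
  moreover have "negligible (uminus ` N2)"
    by (rule negligible_locally_Lipschitz_image[OF _ N2(1)])
      (simp, rule exI[of _ UNIV], rule exI[of _ "1::real"], auto)
  then have "negligible (N1 \<union> uminus ` N2)"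
    using N1(1) by (rule negligible_Un[rotated])
  ultimately have "AE x in lebesgue. (g has_real_derivative h x) (at x)"
    by (intro AE_I'[of "N1 \<union> uminus ` N2"]) (auto simp: negligible_iff_null_sets)
  then have "AE x in lborel. (g has_real_derivative h x) (at x)"
    by (simp add: AE_completion_iff)
  then show ?thesis using that h hS hI by blast
qed

text \<open>The fundamental theorem in the form used on segments: a majorant \<open>k\<close> of the
  derivative also dominates the density \<open>h\<close> almost everywhere, because derivatives are
  unique.\<close>

lemma lipschitz_real_increment_bound:
  fixes g :: "real \<Rightarrow> real" and k :: "real \<Rightarrow> ennreal"
  assumes g: "L-lipschitz_on UNIV g"
    and k: "AE s in lborel. s \<in> {0..1} \<longrightarrow> (\<exists>d. (g has_real_derivative d) (at s) \<and> ennreal \<bar>d\<bar> \<le> k s)"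
  shows "ennreal \<bar>g 1 - g 0\<bar> \<le> (\<integral>\<^sup>+s\<in>{0..1}. k s \<partial>lborel)"
proof -
  obtain h where h[measurable]: "h \<in> borel_measurable borel"
    and hS: "\<And>a b. set_integrable lborel {a..b} h"
    and hI: "\<And>a b. a \<le> b \<Longrightarrow> g b - g a = (LINT x:{a..b}|lborel. h x)"
    and hD: "AE x in lborel. (g has_real_derivative h x) (at x)"
    using lipschitz_real_AE_derivative[OF g] by metis
  have "ennreal \<bar>g 1 - g 0\<bar> = ennreal (norm (LINT x|lborel. indicator {0..1} x *\<^sub>R h x))"
    using hI[of 0 1] by (simp add: set_lebesgue_integral_def)
  also have "\<dots> \<le> (\<integral>\<^sup>+x. ennreal (norm (indicator {0..1} x *\<^sub>R h x)) \<partial>lborel)"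
    using hS[of 0 1] by (intro integral_norm_bound_ennreal) (simp add: set_integrable_def)
  also have "\<dots> \<le> (\<integral>\<^sup>+s\<in>{0..1}. k s \<partial>lborel)"
  proof (rule nn_integral_mono_AE)
    show "AE x in lborel. ennreal (norm (indicator {0..1} x *\<^sub>R h x)) \<le> k x * indicator {0..1} x"
      using hD k
    proof eventually_elim
      case (elim x)
      then show ?case by (auto simp: indicator_def dest: DERIV_unique)
    qed
  qed
  finally show ?thesis .
qed

section \<open>Differentiability almost everywhere\<close>

text \<open>Fubini with translates in place of coordinates: every translate of \<open>N\<close> by a
  multiple of \<open>v\<close> has the measure of \<open>N\<close>, so averaging over
  \<open>t\<close> in \<open>[0, 1]\<close> leaves that measure unchanged, while for fixed
  \<open>x\<close> the integral over \<open>t\<close> vanishes.\<close>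

lemma null_set_if_null_on_parallel_lines:
  fixes N :: "'a::euclidean_space set"
  assumes N[measurable]: "N \<in> sets borel"
    and lines: "\<And>x. AE t in lborel. x + t *\<^sub>R v \<notin> N"
  shows "N \<in> null_sets lborel"
proof -
  have shift: "(\<integral>\<^sup>+x. indicator N (x + t *\<^sub>R v) \<partial>lborel) = emeasure lborel N" for t
  proof -
    have "emeasure lborel N = (\<integral>\<^sup>+x. indicator N x \<partial>lborel)" by simp
    also have "\<dots> = (\<integral>\<^sup>+x. indicator N x \<partial>distr lborel borel (\<lambda>x. t *\<^sub>R v + x))"
      by (simp add: lborel_distr_plus)
    also have "\<dots> = (\<integral>\<^sup>+x. indicator N (t *\<^sub>R v + x) \<partial>lborel)"
      by (subst nn_integral_distr) auto
    finally show ?thesis by (simp add: add.commute)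
  qed
  have meas: "(\<lambda>(x, t). indicator N (x + t *\<^sub>R v) * indicator {0..1} t :: ennreal)
      \<in> borel_measurable (lborel \<Otimes>\<^sub>M (lborel :: real measure))"
    by measurable
  have "0 = (\<integral>\<^sup>+x. (\<integral>\<^sup>+t. indicator N (x + t *\<^sub>R v) * indicator {0..1} t \<partial>lborel) \<partial>(lborel :: 'a measure))"
  proof -
    have "(\<integral>\<^sup>+t. indicator N (x + t *\<^sub>R v) * indicator {0..1::real} t \<partial>lborel) = 0" for x
      using lines[of x] by (subst nn_integral_0_iff_AE) (auto elim: eventually_mono)
    then show ?thesis by simp
  qed
  also have "\<dots> = (\<integral>\<^sup>+t. (\<integral>\<^sup>+x. indicator N (x + t *\<^sub>R v) * indicator {0..1} t \<partial>lborel) \<partial>(lborel :: real measure))"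
    using lborel_pair.Fubini[OF meas] by simp
  also have "\<dots> = (\<integral>\<^sup>+t. emeasure lborel N * indicator {0..1::real} t \<partial>lborel)"
    by (simp add: nn_integral_multc shift)
  also have "\<dots> = emeasure lborel N" by (simp add: nn_integral_cmult)
  finally show ?thesis using N by (auto simp: null_sets_def)
qed

text \<open>Only countable quantifiers and closed conditions remain on the right, which makes sets
  of differentiability points Borel. The rational slopes and uniform scales are reused to cut space
  into countably many pieces. For the converse, slopes valid up to \<open>1 / Suc k\<close> form a
  Cauchy sequence whose limit is the derivative.\<close>

lemma differentiable_at_0_iff_rational_slopes:
  fixes g :: "real \<Rightarrow> real"
  shows "(\<exists>d. (g has_real_derivative d) (at 0)) \<longleftrightarrow>
    (\<forall>k::nat. \<exists>q\<in>\<rat>. \<exists>m::nat. \<forall>t. \<bar>t\<bar> \<le> 1 / Suc m \<longrightarrow> \<bar>g t - g 0 - t * q\<bar> \<le> \<bar>t\<bar> / Suc k)"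
    (is "?L = ?R")
proof
  assume ?L
  then obtain d where d: "(g has_real_derivative d) (at 0)" by blast
  show ?R
  proof
    fix k :: nat
    define e where "e = 1 / (2 * real (Suc k))"
    have e: "e > 0" by (simp add: e_def)
    obtain q where q: "q \<in> \<rat>" "d < q" "q < d + e"
      using Rats_dense_in_real[of d "d + e"] e by auto
    obtain s where s: "s > 0" "\<And>t. t \<noteq> 0 \<Longrightarrow> \<bar>t\<bar> < s \<Longrightarrow> \<bar>(g t - g 0) / t - d\<bar> < e"
      using d e unfolding DERIV_def LIM_eq by (auto simp: )
    obtain m where m: "1 / Suc m < s" using nat_approx_posE[OF s(1)] by auto
    have "\<bar>g t - g 0 - t * q\<bar> \<le> \<bar>t\<bar> / Suc k" if "\<bar>t\<bar> \<le> 1 / Suc m" for t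
    proof (cases "t = 0")
      case False
      have "\<bar>(g t - g 0) / t - q\<bar> \<le> e + e"
        using s(2)[OF False] that m q by (auto simp: abs_le_iff abs_less_iff)
      also have "e + e = 1 / Suc k" by (simp add: e_def field_simps)
      finally have "\<bar>t\<bar> * \<bar>(g t - g 0) / t - q\<bar> \<le> \<bar>t\<bar> * (1 / Suc k)"
        by (intro mult_left_mono) auto
      moreover have "t * ((g t - g 0) / t - q) = g t - g 0 - t * q"
        using False by (simp add: right_diff_distrib diff_divide_distrib)
      ultimately show ?thesis by (simp flip: abs_mult)
    qed simp
    then show "\<exists>q\<in>\<rat>. \<exists>m::nat. \<forall>t. \<bar>t\<bar> \<le> 1 / Suc m \<longrightarrow> \<bar>g t - g 0 - t * q\<bar> \<le> \<bar>t\<bar> / Suc k"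
      using q(1) by blast
  qed
next
  assume ?R
  then obtain q m where qm: "\<And>k t. \<bar>t\<bar> \<le> 1 / Suc (m k) \<Longrightarrow> \<bar>g t - g 0 - t * q k\<bar> \<le> \<bar>t\<bar> / Suc k"
    by metis
  have qq: "\<bar>q i - q j\<bar> \<le> 1 / Suc i + 1 / Suc j" for i j
  proof -
    define t where "t = min (1 / Suc (m i)) (1 / Suc (m j))"
    have t: "t > 0" "\<bar>t\<bar> \<le> 1 / Suc (m i)" "\<bar>t\<bar> \<le> 1 / Suc (m j)" by (auto simp: t_def)
    have "\<bar>t * (q i - q j)\<bar> \<le> \<bar>t\<bar> / Suc i + \<bar>t\<bar> / Suc j"
      using qm[OF t(2)] qm[OF t(3)] by (simp add: algebra_simps abs_le_iff)
    also have "\<dots> = t * (1 / Suc i + 1 / Suc j)" using t(1) by (simp add: algebra_simps)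
    finally show ?thesis using t(1) by (simp add: abs_mult)
  qed
  have "Cauchy q"
  proof (rule CauchyI')
    fix e :: real assume "0 < e"
    then obtain M where M: "1 / Suc M < e / 2" using nat_approx_posE[of "e/2"] by auto
    have "dist (q i) (q j) < e" if "M \<le> i" "i < j" for i j
    proof -
      have "1 / Suc i \<le> 1 / Suc M" "1 / Suc j \<le> 1 / Suc M" using that by (auto intro!: divide_left_mono)
      then show ?thesis using qq[of i j] M by (simp add: dist_real_def)
    qed
    then show "\<exists>M. \<forall>i\<ge>M. \<forall>j>i. dist (q i) (q j) < e" by blast
  qed
  then obtain d where d: "q \<longlonglongrightarrow> d" using convergent_eq_Cauchy[of q] by (auto simp: convergent_def)
  have qd: "\<bar>q i - d\<bar> \<le> 1 / Suc i" for i
  proof (rule tendsto_le[of sequentially])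
    show "(\<lambda>j. 1 / Suc i + 1 / Suc j) \<longlonglongrightarrow> 1 / Suc i"
      using tendsto_add[OF tendsto_const[of "1 / Suc i"] LIMSEQ_inverse_real_of_nat] by (simp add: inverse_eq_divide)
    show "(\<lambda>j. \<bar>q i - q j\<bar>) \<longlonglongrightarrow> \<bar>q i - d\<bar>" by (intro tendsto_intros d)
  qed (use qq in auto)
  have "(g has_real_derivative d) (at 0)"
    unfolding DERIV_def LIM_eq
  proof (intro allI impI)
    fix e :: real assume "0 < e"
    then obtain k where k: "1 / Suc k < e / 2" using nat_approx_posE[of "e/2"] by auto
    show "\<exists>s>0. \<forall>t. t \<noteq> 0 \<and> norm (t - 0) < s \<longrightarrow> norm ((g (0 + t) - g 0) / t - d) < e"
    proof (intro exI[of _ "1 / Suc (m k)"] conjI allI impI)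
      fix t :: real assume t: "t \<noteq> 0 \<and> norm (t - 0) < 1 / Suc (m k)"
      then have "\<bar>g t - g 0 - t * q k\<bar> \<le> \<bar>t\<bar> / Suc k" by (intro qm) simp
      moreover have "g t - g 0 - t * q k = t * ((g t - g 0) / t - q k)" using t by (simp add: right_diff_distrib diff_divide_distrib)
      ultimately have "\<bar>t\<bar> * \<bar>(g t - g 0) / t - q k\<bar> \<le> \<bar>t\<bar> * (1 / Suc k)" by (simp add: abs_mult)
      then have "\<bar>(g t - g 0) / t - q k\<bar> \<le> 1 / Suc k" by (rule mult_left_le_imp_le) (use t in simp)
      then show "norm ((g (0 + t) - g 0) / t - d) < e" using qd[of k] k by simp
    qed simp
  qed
  then show ?L by blast
qed

text \<open>Along each line parallel to \<open>v\<close> the function is Lipschitz in one variable,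
  so its bad points on that line are null. As the bad set is Borel, Fubini shows that it is
  null.\<close>

lemma lipschitz_AE_directional_derivative:
  fixes f :: "'a::euclidean_space \<Rightarrow> real"
  assumes f: "L-lipschitz_on UNIV f"
  shows "AE x in lborel. \<exists>d. ((\<lambda>t. f (x + t *\<^sub>R v)) has_real_derivative d) (at 0)"
proof -
  define A where "A k q m = (\<Inter>t\<in>{t. \<bar>t\<bar> \<le> 1 / Suc m}. {x. \<bar>f (x + t *\<^sub>R v) - f x - t * q\<bar> \<le> \<bar>t\<bar> / Suc k})"
    for k m :: nat and q
  have cf: "continuous_on UNIV f" using f by (rule lipschitz_on_continuous_on)
  have "closed (A k q m)" for k m q
  proof -
    have "continuous_on UNIV (\<lambda>x. \<bar>f (x + t *\<^sub>R v) - f x - t * q\<bar>)" for t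
      by (intro continuous_intros continuous_on_compose2[OF cf]) auto
    then show ?thesis unfolding A_def by (intro closed_INT ballI closed_Collect_le) auto
  qed
  then have [measurable]: "A k q m \<in> sets borel" for k m q by (rule borel_closed)
  define D where "D = (\<Inter>k. \<Union>q\<in>\<rat>. \<Union>m. A k q m)"
  have "(\<Union>q\<in>\<rat>. \<Union>m. A k q m) \<in> sets borel" for k
    by (rule sets.countable_UN'[OF countable_rat]) auto
  then have D[measurable]: "D \<in> sets borel" unfolding D_def by measurable
  have D_iff: "x \<in> D \<longleftrightarrow> (\<exists>d. ((\<lambda>t. f (x + t *\<^sub>R v)) has_real_derivative d) (at 0))" for x
    unfolding differentiable_at_0_iff_rational_slopes by (simp add: D_def A_def)
  have "- D \<in> null_sets lborel"
  proof (rule null_set_if_null_on_parallel_lines[of _ v])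
    fix x
    have "(L * norm v)-lipschitz_on UNIV (\<lambda>t. f (x + t *\<^sub>R v))"
    proof (rule lipschitz_onI)
      fix s t :: real
      have "dist (f (x + s *\<^sub>R v)) (f (x + t *\<^sub>R v)) \<le> L * dist (x + s *\<^sub>R v) (x + t *\<^sub>R v)"
        by (rule lipschitz_onD[OF f UNIV_I UNIV_I])
      also have "dist (x + s *\<^sub>R v) (x + t *\<^sub>R v) = norm v * dist s t"
        by (simp add: dist_norm flip: scaleR_diff_left)
      finally show "dist (f (x + s *\<^sub>R v)) (f (x + t *\<^sub>R v)) \<le> L * norm v * dist s t" by (simp add: mult.assoc)
    qed (use lipschitz_on_nonneg[OF f] in auto)
    then obtain h where "AE t in lborel. ((\<lambda>t. f (x + t *\<^sub>R v)) has_real_derivative h t) (at t)"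
      using lipschitz_real_AE_derivative by metis
    then show "AE t in lborel. x + t *\<^sub>R v \<notin> - D"
    proof eventually_elim
      case (elim t)
      have "((\<lambda>s. f (x + (s + t) *\<^sub>R v)) has_real_derivative h t) (at 0)"
        using elim by (subst DERIV_shift[symmetric]) simp
      then show ?case by (auto simp: D_iff algebra_simps)
    qed
  qed (use D in auto)
  then show ?thesis
    by (rule AE_I') (use D_iff in auto)
qed

text \<open>A substitute for the Lebesgue density theorem: \<open>infdist _ S\<close> is Lipschitz and minimal on \<open>S\<close>, so
  wherever its derivative along a direction exists at a point of \<open>S\<close>, that derivative is \<open>0\<close>.\<close>

lemma AE_infdist_is_o:
  fixes S :: "'a::euclidean_space set"
  assumes S: "S \<noteq> {}"
  shows "AE x in lborel. x \<in> S \<longrightarrow>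
    (\<forall>\<eta>>0. \<exists>\<delta>>0. \<forall>h. norm h < \<delta> \<longrightarrow> infdist (x + h) S \<le> \<eta> * norm h)"
proof -
  have lip: "1-lipschitz_on UNIV (\<lambda>x. infdist x S)"
    by (rule lipschitz_onI) (use infdist_triangle_abs[of _ S] in \<open>auto simp: dist_real_def\<close>)
  \<comment> \<open>Countably many directions cost only one null set. The other directions are
    reached through a finite cover of the unit sphere by small balls around directions in
    \<open>D\<close>, because \<open>infdist\<close> is 1-Lipschitz; finiteness also makes \<delta>
    uniform.\<close>
  obtain D :: "'a set" where D: "countable D" "\<And>X. open X \<Longrightarrow> X \<noteq> {} \<Longrightarrow> \<exists>d\<in>D. d \<in> X"
    by (rule countable_dense_setE) blast
  have "AE x in lborel. \<forall>v\<in>D. \<exists>d. ((\<lambda>t. infdist (x + t *\<^sub>R v) S) has_real_derivative d) (at 0)"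
    using lipschitz_AE_directional_derivative[OF lip] D(1) by (simp add: AE_ball_countable)
  then show ?thesis
  proof (rule eventually_mono, intro impI allI)
    fix x and \<eta> :: real
    assume diff: "\<forall>v\<in>D. \<exists>d. ((\<lambda>t. infdist (x + t *\<^sub>R v) S) has_real_derivative d) (at 0)"
      and x: "x \<in> S" and \<eta>: "0 < \<eta>"
    have zero: "((\<lambda>t. infdist (x + t *\<^sub>R v) S) has_real_derivative 0) (at 0)" if v: "v \<in> D" for v
    proof -
      obtain d where d: "((\<lambda>t. infdist (x + t *\<^sub>R v) S) has_real_derivative d) (at 0)"
        using bspec[OF diff v] by (rule exE)
      have "d = 0"
        by (rule DERIV_local_min[OF d zero_less_one]) (use x in \<open>auto simp: infdist_nonneg\<close>)
      then show ?thesis using d by simp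
    qed
    have "compact (sphere (0::'a) 1)" by simp
    moreover have "sphere (0::'a) 1 \<subseteq> (\<Union>v\<in>D. ball v (\<eta> / 2))"
    proof
      fix u :: 'a
      obtain v where "v \<in> D" "v \<in> ball u (\<eta> / 2)" using D(2)[of "ball u (\<eta> / 2)"] \<eta> by auto
      then show "u \<in> (\<Union>v\<in>D. ball v (\<eta> / 2))" by (auto simp: dist_commute)
    qed
    ultimately obtain V where V: "V \<subseteq> D" "finite V" "sphere (0::'a) 1 \<subseteq> (\<Union>v\<in>V. ball v (\<eta> / 2))"
      using compactE_image[of "sphere 0 1" D "\<lambda>v. ball v (\<eta> / 2)"] open_ball by metis
    have "\<forall>v\<in>V. \<exists>\<delta>>0. \<forall>t. \<bar>t\<bar> < \<delta> \<longrightarrow> infdist (x + t *\<^sub>R v) S \<le> \<eta> / 2 * \<bar>t\<bar>"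
    proof
      fix v assume "v \<in> V"
      then have "v \<in> D" using V(1) by blast
      then have "((\<lambda>t. infdist (x + t *\<^sub>R v) S / t) \<longlongrightarrow> 0) (at 0)"
        using zero[of v] x by (simp add: DERIV_def)
      from LIM_D[OF this, of "\<eta> / 2"]
      obtain \<delta> where \<delta>: "\<delta> > 0" "\<And>t. t \<noteq> 0 \<Longrightarrow> \<bar>t\<bar> < \<delta> \<Longrightarrow> \<bar>infdist (x + t *\<^sub>R v) S / t\<bar> < \<eta> / 2"
        using \<eta> by (auto simp del: abs_divide)
      have "infdist (x + t *\<^sub>R v) S \<le> \<eta> / 2 * \<bar>t\<bar>" if "\<bar>t\<bar> < \<delta>" for t
      proof (cases "t = 0")
        case False
        then show ?thesis using \<delta>(2)[OF False that]
          by (simp add: abs_divide infdist_nonneg pos_divide_less_eq)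
      qed (use x in simp)
      then show "\<exists>\<delta>>0. \<forall>t. \<bar>t\<bar> < \<delta> \<longrightarrow> infdist (x + t *\<^sub>R v) S \<le> \<eta> / 2 * \<bar>t\<bar>" using \<delta>(1) by blast
    qed
    then obtain \<delta> where \<delta>: "\<And>v. v \<in> V \<Longrightarrow> \<delta> v > 0"
        "\<And>v t. v \<in> V \<Longrightarrow> \<bar>t\<bar> < \<delta> v \<Longrightarrow> infdist (x + t *\<^sub>R v) S \<le> \<eta> / 2 * \<bar>t\<bar>"
      by metis
    show "\<exists>\<delta>>0. \<forall>h. norm h < \<delta> \<longrightarrow> infdist (x + h) S \<le> \<eta> * norm h"
    proof (intro exI[of _ "Min (insert 1 (\<delta> ` V))"] conjI allI impI)
      show "0 < Min (insert 1 (\<delta> ` V))" using V(2) \<delta>(1) by auto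
      fix h :: 'a assume h: "norm h < Min (insert 1 (\<delta> ` V))"
      show "infdist (x + h) S \<le> \<eta> * norm h"
      proof (cases "h = 0")
        case False
        define u where "u = h /\<^sub>R norm h"
        have hu: "h = norm h *\<^sub>R u" using False by (simp add: u_def)
        have "u \<in> sphere 0 1" using False by (simp add: u_def)
        then obtain v where v: "v \<in> V" "dist v u < \<eta> / 2" using V(3) by auto
        have "norm h < \<delta> v" using h V(2) v(1) by auto
        then have "infdist (x + norm h *\<^sub>R v) S \<le> \<eta> / 2 * norm h" using \<delta>(2)[OF v(1), of "norm h"] by simp
        moreover have "infdist (x + h) S \<le> infdist (x + norm h *\<^sub>R v) S + dist (x + h) (x + norm h *\<^sub>R v)"
          by (rule infdist_triangle)
        moreover have "dist (x + h) (x + norm h *\<^sub>R v) \<le> \<eta> / 2 * norm h"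
        proof -
          have "dist (x + h) (x + norm h *\<^sub>R v) = norm (norm h *\<^sub>R (u - v))"
            by (subst hu) (simp add: dist_norm scaleR_diff_right)
          then show ?thesis
            using mult_right_mono[of "norm (u - v)" "\<eta> / 2" "norm h"] v(2)
            by (simp add: dist_norm norm_minus_commute mult.commute)
        qed
        ultimately show ?thesis by simp
      qed (use x in simp)
    qed
  qed
qed

text \<open>Almost every point lies in a set \<open>E k m Q\<close> on which all partial difference quotients are
  uniformly close to one vector \<open>Q\<close>, and that set has points within \<open>o(|h|)\<close> of every \<open>x + h\<close>.
  Hence \<open>f (x + h) - f x\<close> can be estimated by changing one coordinate at a time, each time from a
  nearby point of \<open>E k m Q\<close>.\<close>

lemma lipschitz_AE_GDERIV:
  fixes f :: "'a::euclidean_space \<Rightarrow> real"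
  assumes f: "L-lipschitz_on UNIV f"
  shows "AE x in lborel. \<exists>D. GDERIV f x :> D"
proof -
  have Lf: "\<bar>f x - f y\<bar> \<le> L * norm (x - y)" for x y
    using lipschitz_onD[OF f UNIV_I UNIV_I, of x y] by (simp add: dist_norm)
  have L0: "0 \<le> L" using f by (rule lipschitz_on_nonneg)
  define E where "E k m Q = {x. \<forall>i\<in>Basis. \<forall>t. \<bar>t\<bar> \<le> 1 / Suc m \<longrightarrow>
      \<bar>f (x + t *\<^sub>R i) - f x - t * Q i\<bar> \<le> \<bar>t\<bar> / Suc k}" for k m :: nat and Q :: "'a \<Rightarrow> real"
  \<comment> \<open>Rational vectors, encoded as extensional functions on the basis. Their
    countability lets the density statement hold for all sets \<open>E k m Q\<close> simultaneously
    off one null set.\<close>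
  define QQ where "QQ = PiE Basis (\<lambda>_::'a. \<rat> :: real set)"
  have cQQ: "countable QQ" unfolding QQ_def by (intro countable_PiE finite_Basis countable_rat)
  have "AE x in lborel. \<forall>k m. \<forall>Q\<in>QQ. x \<in> E k m Q \<longrightarrow>
      (\<forall>\<eta>>0. \<exists>\<delta>>0. \<forall>h. norm h < \<delta> \<longrightarrow> infdist (x + h) (E k m Q) \<le> \<eta> * norm h)"
  proof -
    have "AE x in lborel. x \<in> E k m Q \<longrightarrow>
      (\<forall>\<eta>>0. \<exists>\<delta>>0. \<forall>h. norm h < \<delta> \<longrightarrow> infdist (x + h) (E k m Q) \<le> \<eta> * norm h)" for k m Q
      by (cases "E k m Q = {}") (simp_all add: AE_infdist_is_o)
    then show ?thesis by (simp add: AE_all_countable AE_ball_countable cQQ)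
  qed
  moreover have "AE x in lborel. \<forall>i\<in>Basis. \<exists>d. ((\<lambda>t. f (x + t *\<^sub>R i)) has_real_derivative d) (at 0)"
    using lipschitz_AE_directional_derivative[OF f] by (simp add: AE_ball_countable countable_finite)
  ultimately show ?thesis
  proof eventually_elim
    fix x
    assume dens: "\<forall>k m. \<forall>Q\<in>QQ. x \<in> E k m Q \<longrightarrow>
        (\<forall>\<eta>>0. \<exists>\<delta>>0. \<forall>h. norm h < \<delta> \<longrightarrow> infdist (x + h) (E k m Q) \<le> \<eta> * norm h)"
      and part: "\<forall>i\<in>Basis. \<exists>d. ((\<lambda>t. f (x + t *\<^sub>R i)) has_real_derivative d) (at 0)"
    obtain p where p: "\<And>i. i \<in> Basis \<Longrightarrow> ((\<lambda>t. f (x + t *\<^sub>R i)) has_real_derivative p i) (at 0)"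
      using part by metis
    define D where "D = (\<Sum>i\<in>Basis. p i *\<^sub>R i)"
    have D: "h \<bullet> D = (\<Sum>i\<in>Basis. (h \<bullet> i) * p i)" for h
      by (simp add: D_def inner_sum_right mult.commute)
    define C where "C = real DIM('a) * (2 + 2 * L)"
    have C0: "C > 0" using L0 by (simp add: C_def)
    have approx: "\<exists>\<delta>>0. \<forall>h. norm h < \<delta> \<longrightarrow> \<bar>f (x + h) - f x - h \<bullet> D\<bar> \<le> C / Suc k * norm h" for k
    proof -
      define e where "e = 1 / real (Suc k)"
      have e: "e > 0" by (simp add: e_def)
      have "\<forall>i\<in>Basis. \<exists>q\<in>\<rat>. \<exists>m::nat. \<forall>t. \<bar>t\<bar> \<le> 1 / Suc m \<longrightarrow> \<bar>f (x + t *\<^sub>R i) - f x - t * q\<bar> \<le> \<bar>t\<bar> / Suc k"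
      proof
        fix i :: 'a assume "i \<in> Basis"
        then have "\<exists>d. ((\<lambda>t. f (x + t *\<^sub>R i)) has_real_derivative d) (at 0)" using p by blast
        from this[unfolded differentiable_at_0_iff_rational_slopes, rule_format, of k]
        show "\<exists>q\<in>\<rat>. \<exists>m::nat. \<forall>t. \<bar>t\<bar> \<le> 1 / Suc m \<longrightarrow> \<bar>f (x + t *\<^sub>R i) - f x - t * q\<bar> \<le> \<bar>t\<bar> / Suc k"
          by simp
      qed
      then obtain q m where qm: "\<And>i. i \<in> Basis \<Longrightarrow> q i \<in> \<rat>"
          "\<And>i t. i \<in> Basis \<Longrightarrow> \<bar>t\<bar> \<le> 1 / Suc (m i) \<Longrightarrow> \<bar>f (x + t *\<^sub>R i) - f x - t * q i\<bar> \<le> \<bar>t\<bar> / Suc k"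
        by metis
      define M where "M = Max (m ` Basis)"
      define Q where "Q = restrict q Basis"
      have Q: "Q \<in> QQ" using qm(1) by (auto simp: Q_def QQ_def)
      have xE: "x \<in> E k M Q"
        unfolding E_def
      proof (intro CollectI ballI allI impI)
        fix i :: 'a and t :: real assume i: "i \<in> Basis" and t: "\<bar>t\<bar> \<le> 1 / Suc M"
        have "m i \<le> M" using i by (simp add: M_def)
        then have "1 / real (Suc M) \<le> 1 / real (Suc (m i))" by (intro divide_left_mono) auto
        then show "\<bar>f (x + t *\<^sub>R i) - f x - t * Q i\<bar> \<le> \<bar>t\<bar> / Suc k"
          using qm(2)[OF i, of t] t i by (simp add: Q_def)
      qed
      have qp: "\<bar>q i - p i\<bar> \<le> e" if i: "i \<in> Basis" for i
      proof (rule tendsto_le[of "at (0::real)"])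
        have "((\<lambda>t. (f (x + t *\<^sub>R i) - f x) / t) \<longlongrightarrow> p i) (at 0)"
          using p[OF i] by (simp add: DERIV_def)
        then show "((\<lambda>t. \<bar>q i - (f (x + t *\<^sub>R i) - f x) / t\<bar>) \<longlongrightarrow> \<bar>q i - p i\<bar>) (at 0)"
          by (intro tendsto_intros)
        show "\<forall>\<^sub>F t in at 0. \<bar>q i - (f (x + t *\<^sub>R i) - f x) / t\<bar> \<le> e"
          unfolding eventually_at
        proof (intro exI[of _ "1 / Suc (m i)"] conjI ballI impI)
          fix t :: real assume t: "t \<noteq> 0 \<and> dist t 0 < 1 / Suc (m i)"
          then have "\<bar>f (x + t *\<^sub>R i) - f x - t * q i\<bar> \<le> \<bar>t\<bar> * e"
            using qm(2)[OF i, of t] by (simp add: e_def)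
          moreover have "\<bar>t\<bar> * \<bar>q i - (f (x + t *\<^sub>R i) - f x) / t\<bar> = \<bar>f (x + t *\<^sub>R i) - f x - t * q i\<bar>"
          proof -
            have "t * (q i - a / t) = t * q i - a" for a
              using t by (simp add: right_diff_distrib)
            from this[of "f (x + t *\<^sub>R i) - f x"] show ?thesis by (simp add: abs_minus_commute flip: abs_mult)
          qed
          ultimately have "\<bar>t\<bar> * \<bar>q i - (f (x + t *\<^sub>R i) - f x) / t\<bar> \<le> \<bar>t\<bar> * e" by simp
          then show "\<bar>q i - (f (x + t *\<^sub>R i) - f x) / t\<bar> \<le> e"
            by (rule mult_left_le_imp_le) (use t in simp)
        qed simp
      qed auto
      obtain \<delta> where \<delta>: "\<delta> > 0" "\<And>h. norm h < \<delta> \<Longrightarrow> infdist (x + h) (E k M Q) \<le> e / 2 * norm h"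
        using dens[rule_format, OF Q xE, of "e / 2"] e by auto
      \<comment> \<open>The second bound keeps every coordinate of \<open>h\<close> within the scale
        on which the difference quotients in \<open>E k M Q\<close> are controlled.\<close>
      define \<delta>' where "\<delta>' = min \<delta> (1 / Suc M)"
      have step: "\<bar>f (x + (\<Sum>i\<in>S. (h \<bullet> i) *\<^sub>R i)) - f x - (\<Sum>i\<in>S. (h \<bullet> i) * q i)\<bar>
          \<le> real (card S) * ((1 + 2 * L) * e) * norm h"
        if h: "norm h < \<delta>'" and S: "S \<subseteq> Basis" for h S
      proof -
        have "finite S" using S finite_Basis by (rule finite_subset)
        then show ?thesis using S
        proof (induction S rule: finite_induct)
          case (insert j S)
          define z where "z = x + (\<Sum>i\<in>S. (h \<bullet> i) *\<^sub>R i)"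
          have j: "j \<in> Basis" using insert by auto
          have "norm (\<Sum>i\<in>S. (h \<bullet> i) *\<^sub>R i) \<le> norm h"
          proof -
            have fin: "finite S" "pairwise (\<lambda>i j. orthogonal ((h \<bullet> i) *\<^sub>R i) ((h \<bullet> j) *\<^sub>R j)) S" 
              using insert by (auto simp: pairwise_def orthogonal_def subset_iff inner_not_same_Basis)
            have "(norm (\<Sum>i\<in>S. (h \<bullet> i) *\<^sub>R i))\<^sup>2 = (\<Sum>i\<in>S. (norm ((h \<bullet> i) *\<^sub>R i))\<^sup>2)"
              using norm_sum_Pythagorean[OF fin] by simp
            also have "\<dots> = (\<Sum>i\<in>S. (h \<bullet> i)\<^sup>2)"
              using insert.prems by (intro sum.cong) auto
            also have "\<dots> \<le> (\<Sum>i\<in>Basis. (h \<bullet> i)\<^sup>2)"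
              using insert.prems by (intro sum_mono2) auto
            also have "\<dots> = (norm h)\<^sup>2"
              unfolding power2_norm_eq_inner euclidean_inner[of h h] by (simp add: power2_eq_square)
            finally show ?thesis by simp
          qed
          then have "infdist z (E k M Q) \<le> e / 2 * norm h"
            using \<delta>(2)[of "\<Sum>i\<in>S. (h \<bullet> i) *\<^sub>R i"] h e
            by (fastforce simp: z_def \<delta>'_def intro: order_trans mult_left_mono)
          \<comment> \<open>A point is extracted from the infimum through the strict inequality
            \<open>e / 2 * norm h < e * norm h\<close>. It fails for \<open>h = 0\<close>, where
            \<open>z = x\<close> itself lies in the set.\<close>
          then obtain y where y: "y \<in> E k M Q" "norm (z - y) \<le> e * norm h"
          proof (cases "h = 0")
            case True
            then have "z = x" by (simp add: z_def)
            then show ?thesis using that[of x] xE True by simp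
          next
            case False
            assume "infdist z (E k M Q) \<le> e / 2 * norm h"
            also have "\<dots> < e * norm h" using False e by simp
            finally have "Inf (dist z ` E k M Q) < e * norm h" using xE by (auto simp: infdist_def split: if_splits)
            then obtain y where "y \<in> E k M Q" "dist z y < e * norm h"
              using xE cInf_lessD[of "dist z ` E k M Q" "e * norm h"] by blast
            then show ?thesis using that[of y] by (simp add: dist_norm)
          qed
          have hj: "\<bar>h \<bullet> j\<bar> \<le> norm h" using j by (rule Basis_le_norm)
          have "\<bar>f (y + (h \<bullet> j) *\<^sub>R j) - f y - (h \<bullet> j) * q j\<bar> \<le> \<bar>h \<bullet> j\<bar> / Suc k"
            using y(1) j hj h by (auto simp: E_def Q_def \<delta>'_def)
          also have "\<dots> \<le> e * norm h" using hj by (simp add: e_def divide_right_mono)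
          finally have 1: "\<bar>f (y + (h \<bullet> j) *\<^sub>R j) - f y - (h \<bullet> j) * q j\<bar> \<le> e * norm h" .
          have "L * norm (z - y) \<le> L * (e * norm h)" using y(2) L0 by (rule mult_left_mono)
          then have 2: "\<bar>f z - f y\<bar> \<le> L * (e * norm h)"
            "\<bar>f (z + (h \<bullet> j) *\<^sub>R j) - f (y + (h \<bullet> j) *\<^sub>R j)\<bar> \<le> L * (e * norm h)"
            using Lf[of z y] Lf[of "z + (h \<bullet> j) *\<^sub>R j" "y + (h \<bullet> j) *\<^sub>R j"] by auto
          have 3: "\<bar>f z - f x - (\<Sum>i\<in>S. (h \<bullet> i) * q i)\<bar> \<le> real (card S) * ((1 + 2 * L) * e) * norm h"
            using insert by (simp add: z_def)
          have "\<bar>f (z + (h \<bullet> j) *\<^sub>R j) - f x - ((h \<bullet> j) * q j + (\<Sum>i\<in>S. (h \<bullet> i) * q i))\<bar>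
              \<le> real (card S) * ((1 + 2 * L) * e) * norm h + (e * norm h + 2 * (L * (e * norm h)))"
            using 1 2 3 by linarith
          also have "\<dots> = real (card (insert j S)) * ((1 + 2 * L) * e) * norm h"
            using insert by (simp add: algebra_simps)
          finally show ?case using insert by (simp add: z_def add_ac)
        qed simp
      qed
      show ?thesis
      proof (intro exI[of _ \<delta>'] conjI allI impI)
        show "0 < \<delta>'" using \<delta>(1) by (simp add: \<delta>'_def)
        fix h :: 'a assume h: "norm h < \<delta>'"
        have "\<bar>(\<Sum>i\<in>Basis. (h \<bullet> i) * q i) - h \<bullet> D\<bar> \<le> (\<Sum>i\<in>Basis. \<bar>(h \<bullet> i) * (q i - p i)\<bar>)"
          unfolding D right_diff_distrib sum_subtractf[symmetric] by (rule sum_abs)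
        also have "\<dots> \<le> (\<Sum>i\<in>(Basis::'a set). norm h * e)"
          unfolding abs_mult using qp by (intro sum_mono mult_mono Basis_le_norm) auto
        finally have "\<bar>(\<Sum>i\<in>Basis. (h \<bullet> i) * q i) - h \<bullet> D\<bar> \<le> real DIM('a) * (norm h * e)" by simp
        moreover have "\<bar>f (x + h) - f x - (\<Sum>i\<in>Basis. (h \<bullet> i) * q i)\<bar>
            \<le> real DIM('a) * ((1 + 2 * L) * e) * norm h"
          using step[OF h order_refl] by (simp add: euclidean_representation)
        ultimately have "\<bar>f (x + h) - f x - h \<bullet> D\<bar>
            \<le> real DIM('a) * ((1 + 2 * L) * e) * norm h + real DIM('a) * (norm h * e)"
          by linarith
        also have "\<dots> = C * e * norm h" by (simp add: C_def algebra_simps)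
        finally show "\<bar>f (x + h) - f x - h \<bullet> D\<bar> \<le> C / Suc k * norm h" by (simp add: e_def)
      qed
    qed
    have "GDERIV f x :> D"
      unfolding gderiv_def has_derivative_at_alt
    proof (intro conjI allI impI)
      show "bounded_linear (\<lambda>h. h \<bullet> D)" by (rule bounded_linear_inner_left)
      fix \<epsilon> :: real assume \<epsilon>: "0 < \<epsilon>"
      obtain k where k: "1 / Suc k < \<epsilon> / C" using nat_approx_posE[of "\<epsilon> / C"] \<epsilon> C0 by auto
      then have k': "C / Suc k \<le> \<epsilon>" using C0 by (simp add: field_simps)
      obtain \<delta> where \<delta>: "\<delta> > 0" "\<And>h. norm h < \<delta> \<Longrightarrow> \<bar>f (x + h) - f x - h \<bullet> D\<bar> \<le> C / Suc k * norm h"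
        using approx[of k] by blast
      show "\<exists>d>0. \<forall>y. norm (y - x) < d \<longrightarrow> norm (f y - f x - (y - x) \<bullet> D) \<le> \<epsilon> * norm (y - x)"
      proof (intro exI[of _ \<delta>] conjI allI impI)
        fix y assume "norm (y - x) < \<delta>"
        from \<delta>(2)[OF this] have "norm (f y - f x - (y - x) \<bullet> D) \<le> C / Suc k * norm (y - x)" by simp
        also have "\<dots> \<le> \<epsilon> * norm (y - x)" using k' by (rule mult_right_mono) simp
        finally show "norm (f y - f x - (y - x) \<bullet> D) \<le> \<epsilon> * norm (y - x)" .
      qed (rule \<delta>(1))
    qed
    then show "\<exists>D. GDERIV f x :> D" by blast
  qed
qed

section \<open>Weak type estimate on a cube\<close>

lemma borel_measurable_infnorm [measurable]: "infnorm \<in> borel_measurable borel"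
  by (intro borel_measurable_continuous_onI continuous_on_infnorm continuous_on_id)

lemma infnorm_diff_le_cbox:
  fixes x y :: "'a::euclidean_space"
  assumes "x \<in> cbox a (a + l *\<^sub>R One)" "y \<in> cbox a (a + l *\<^sub>R One)"
  shows "infnorm (x - y) \<le> l"
  unfolding infnorm_Max
proof (intro Max.boundedI)
  fix r assume "r \<in> (\<lambda>i. \<bar>(x - y) \<bullet> i\<bar>) ` Basis"
  then obtain i where i: "i \<in> Basis" "r = \<bar>(x - y) \<bullet> i\<bar>" by blast
  have "a \<bullet> i \<le> x \<bullet> i" "x \<bullet> i \<le> a \<bullet> i + l" "a \<bullet> i \<le> y \<bullet> i" "y \<bullet> i \<le> a \<bullet> i + l"
    using assms i(1) by (auto simp: mem_box inner_add_left inner_sum_left_Basis)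
  then show "r \<le> l" by (auto simp: i(2) inner_diff_left)
qed auto

lemma nn_integral_lborel_affine:
  fixes h :: "'a::euclidean_space \<Rightarrow> ennreal"
  assumes [measurable]: "h \<in> borel_measurable borel" and c: "c \<noteq> 0"
  shows "(\<integral>\<^sup>+x. h x \<partial>lborel) = ennreal (\<bar>c\<bar> ^ DIM('a)) * (\<integral>\<^sup>+x. h (t + c *\<^sub>R x) \<partial>lborel)"
  by (subst lborel_affine[OF c, of t]) (simp add: nn_integral_density nn_integral_distr nn_integral_cmult)

text \<open>For fixed \<open>s > 0\<close> the map \<open>y \<mapsto> x + s (y - x)\<close> is a
  dilation up to translation, so preimages of null sets are null; Fubini then exchanges
  \<open>s\<close> and \<open>y\<close>. The value \<open>s = 0\<close> is left out because every
  segment starts at \<open>x\<close>, which may be a bad point.\<close>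

lemma AE_AE_segment:
  fixes x :: "'a::euclidean_space"
  assumes P: "AE z in lborel. P z"
  shows "AE y in lborel. AE s in lborel. s \<in> {0<..1} \<longrightarrow> P (x + s *\<^sub>R (y - x))"
proof -
  obtain N where N: "N \<in> null_sets lborel" "{z. \<not> P z} \<subseteq> N"
    using P by (auto elim!: AE_E simp: null_sets_def)
  then have [measurable]: "N \<in> sets borel" by auto
  define J where "J y s = (indicator N (x + s *\<^sub>R (y - x)) * indicator {0<..1::real} s :: ennreal)" for y s
  have [measurable]: "case_prod J \<in> borel_measurable (lborel \<Otimes>\<^sub>M lborel)"
    unfolding J_def by measurable
  have zero: "(\<integral>\<^sup>+y. J y s \<partial>lborel) = 0" for s
  proof (cases "s \<in> {0<..1}")
    case True
    have "0 = (\<integral>\<^sup>+z. indicator N z \<partial>lborel)" using N by (auto simp: null_sets_def)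
    also have "\<dots> = ennreal (\<bar>s\<bar> ^ DIM('a)) * (\<integral>\<^sup>+y. indicator N ((x - s *\<^sub>R x) + s *\<^sub>R y) \<partial>lborel)"
      using True by (intro nn_integral_lborel_affine) auto
    also have "(\<lambda>y. indicator N ((x - s *\<^sub>R x) + s *\<^sub>R y) :: ennreal) = (\<lambda>y. J y s)"
      using True by (auto simp: J_def algebra_simps)
    finally show ?thesis using True by auto
  qed (simp add: J_def)
  have "(\<integral>\<^sup>+y. (\<integral>\<^sup>+s. J y s \<partial>lborel) \<partial>lborel) = (\<integral>\<^sup>+s. (\<integral>\<^sup>+y. J y s \<partial>lborel) \<partial>lborel)"
    using lborel_pair.Fubini'[of J] by simp
  then have "(\<integral>\<^sup>+y. (\<integral>\<^sup>+s. J y s \<partial>lborel) \<partial>lborel) = 0" by (simp add: zero)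
  then have "AE y in lborel. (\<integral>\<^sup>+s. J y s \<partial>lborel) = 0"
    by (subst (asm) nn_integral_0_iff_AE) auto
  then show ?thesis
  proof eventually_elim
    case (elim y)
    then have "AE s in lborel. J y s = 0"
      by (subst (asm) nn_integral_0_iff_AE) (auto simp: J_def)
    then show ?case
      by eventually_elim (use N(2) in \<open>auto simp: J_def indicator_def split: if_splits\<close>)
  qed
qed

text \<open>The double integral over \<open>y\<close> and the segment from \<open>x\<close> to \<open>y\<close> is rewritten with
  \<open>z = x + s (y - x)\<close>; keeping \<open>s\<close> as an outer variable replaces the Riesz kernel.\<close>

lemma lipschitz_oscillation_bound:
  fixes f :: "'a::euclidean_space \<Rightarrow> real" and G :: "'a \<Rightarrow> ennreal"
  assumes f: "L-lipschitz_on UNIV f"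
    and G[measurable]: "G \<in> borel_measurable borel"
    and fG: "AE z in lborel. \<exists>D. GDERIV f z :> D \<and> ennreal (norm D) \<le> G z"
    and Q: "Q = cbox a (a + l *\<^sub>R One)" and l: "0 < l" and x: "x \<in> Q"
  shows "(\<integral>\<^sup>+y\<in>Q. ennreal \<bar>f x - f y\<bar> \<partial>lborel) \<le> ennreal (sqrt DIM('a) * l) *
    (\<integral>\<^sup>+s\<in>{0<..1}. ennreal (1 / s ^ DIM('a)) *
      (\<integral>\<^sup>+z\<in>Q. G z * of_bool (infnorm (z - x) \<le> s * l) \<partial>lborel) \<partial>lborel)"
proof -
  have [measurable]: "Q \<in> sets borel" by (simp add: Q)
  have cf: "continuous_on UNIV f" using f by (rule lipschitz_on_continuous_on)
  have [measurable]: "f \<in> borel_measurable borel" using cf by (rule borel_measurable_continuous_onI)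
  \<comment> \<open>The Euclidean diameter of the cube, which bounds the length of every segment
    inside it.\<close>
  define c where "c = sqrt DIM('a) * l"
  have c: "0 \<le> c" using l by (simp add: c_def)
  have ncQ: "norm (y - x) \<le> c" if "y \<in> Q" for y
  proof -
    have "norm (y - x) \<le> sqrt DIM('a) * infnorm (y - x)" by (rule norm_le_infnorm)
    also have "\<dots> \<le> c" using infnorm_diff_le_cbox[of y a l x] that x unfolding c_def Q
      by (intro mult_left_mono) auto
    finally show ?thesis .
  qed
  have seg: "AE y in lborel. y \<in> Q \<longrightarrow> ennreal \<bar>f x - f y\<bar> \<le>
      (\<integral>\<^sup>+s. ennreal c * G (x + s *\<^sub>R (y - x)) * indicator {0<..1} s \<partial>lborel)"
    using AE_AE_segment[OF fG, of x]
  proof (eventually_elim, intro impI)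
    fix y assume ae: "AE s in lborel. s \<in> {0<..1} \<longrightarrow>
        (\<exists>D. GDERIV f (x + s *\<^sub>R (y - x)) :> D \<and> ennreal (norm D) \<le> G (x + s *\<^sub>R (y - x)))"
      and y: "y \<in> Q"
    define g where "g s = f (x + s *\<^sub>R (y - x))" for s
    have "(L * norm (y - x))-lipschitz_on UNIV g"
    proof (rule lipschitz_onI)
      fix s t :: real
      have "dist (g s) (g t) \<le> L * dist (x + s *\<^sub>R (y - x)) (x + t *\<^sub>R (y - x))"
        unfolding g_def by (rule lipschitz_onD[OF f UNIV_I UNIV_I])
      also have "dist (x + s *\<^sub>R (y - x)) (x + t *\<^sub>R (y - x)) = norm (y - x) * dist s t"
        by (simp add: dist_norm flip: scaleR_diff_left)
      finally show "dist (g s) (g t) \<le> L * norm (y - x) * dist s t" by (simp add: mult.assoc)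
    qed (use lipschitz_on_nonneg[OF f] in auto)
    moreover have "AE s in lborel. s \<in> {0..1} \<longrightarrow> (\<exists>d. (g has_real_derivative d) (at s) \<and>
        ennreal \<bar>d\<bar> \<le> ennreal c * G (x + s *\<^sub>R (y - x)))"
      using ae AE_lborel_singleton[of "0::real"]
    proof (eventually_elim, intro impI)
      fix s :: real assume *: "s \<in> {0<..1} \<longrightarrow>
        (\<exists>D. GDERIV f (x + s *\<^sub>R (y - x)) :> D \<and> ennreal (norm D) \<le> G (x + s *\<^sub>R (y - x)))"
        and s: "s \<noteq> 0" "s \<in> {0..1}"
      then obtain D where D: "GDERIV f (x + s *\<^sub>R (y - x)) :> D" "ennreal (norm D) \<le> G (x + s *\<^sub>R (y - x))"
        by auto
      have "(g has_derivative (\<lambda>h. (h *\<^sub>R (y - x)) \<bullet> D)) (at s)"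
        unfolding g_def
        by (rule has_derivative_compose[of "\<lambda>s. x + s *\<^sub>R (y - x)" _ s UNIV, OF _ D(1)[unfolded gderiv_def]])
           (auto intro!: derivative_eq_intros)
      then have "(g has_real_derivative ((y - x) \<bullet> D)) (at s)"
        by (simp add: has_field_derivative_def mult_commute_abs)
      moreover have "ennreal \<bar>(y - x) \<bullet> D\<bar> \<le> ennreal c * G (x + s *\<^sub>R (y - x))"
      proof -
        have "\<bar>(y - x) \<bullet> D\<bar> \<le> norm (y - x) * norm D" by (rule Cauchy_Schwarz_ineq2)
        also have "\<dots> \<le> c * norm D" using ncQ[OF y] by (rule mult_right_mono) simp
        finally have "ennreal \<bar>(y - x) \<bullet> D\<bar> \<le> ennreal c * ennreal (norm D)"
          using c by (simp add: ennreal_leI flip: ennreal_mult)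
        also have "\<dots> \<le> ennreal c * G (x + s *\<^sub>R (y - x))" using D(2) by (rule mult_left_mono) simp
        finally show ?thesis .
      qed
      ultimately show "\<exists>d. (g has_real_derivative d) (at s) \<and> ennreal \<bar>d\<bar> \<le> ennreal c * G (x + s *\<^sub>R (y - x))"
        by blast
    qed
    ultimately have "ennreal \<bar>g 1 - g 0\<bar> \<le> (\<integral>\<^sup>+s\<in>{0..1}. ennreal c * G (x + s *\<^sub>R (y - x)) \<partial>lborel)"
      by (rule lipschitz_real_increment_bound)
    also have "\<dots> = (\<integral>\<^sup>+s. ennreal c * G (x + s *\<^sub>R (y - x)) * indicator {0<..1} s \<partial>lborel)"
      using AE_lborel_singleton[of "0::real"]
      by (intro nn_integral_cong_AE, eventually_elim) (auto simp: indicator_def)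
    finally show "ennreal \<bar>f x - f y\<bar> \<le> (\<integral>\<^sup>+s. ennreal c * G (x + s *\<^sub>R (y - x)) * indicator {0<..1} s \<partial>lborel)"
      by (simp add: g_def abs_minus_commute)
  qed
  have "(\<integral>\<^sup>+y\<in>Q. ennreal \<bar>f x - f y\<bar> \<partial>lborel) \<le>
      (\<integral>\<^sup>+y. (\<integral>\<^sup>+s. ennreal c * G (x + s *\<^sub>R (y - x)) * indicator {0<..1} s * indicator Q y \<partial>lborel) \<partial>lborel)"
    by (intro nn_integral_mono_AE, use seg in eventually_elim) (auto simp: indicator_def)
  also have "\<dots> = (\<integral>\<^sup>+s. (\<integral>\<^sup>+y. ennreal c * G (x + s *\<^sub>R (y - x)) * indicator {0<..1} s * indicator Q y \<partial>lborel) \<partial>lborel)"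
    by (rule lborel_pair.Fubini') measurable
  also have "\<dots> \<le> (\<integral>\<^sup>+s. ennreal c * (ennreal (1 / s ^ DIM('a)) *
      (\<integral>\<^sup>+z\<in>Q. G z * of_bool (infnorm (z - x) \<le> s * l) \<partial>lborel) * indicator {0<..1} s) \<partial>lborel)"
  proof (rule nn_integral_mono)
    fix s :: real
    show "(\<integral>\<^sup>+y. ennreal c * G (x + s *\<^sub>R (y - x)) * indicator {0<..1} s * indicator Q y \<partial>lborel) \<le>
      ennreal c * (ennreal (1 / s ^ DIM('a)) *
      (\<integral>\<^sup>+z\<in>Q. G z * of_bool (infnorm (z - x) \<le> s * l) \<partial>lborel) * indicator {0<..1} s)"
    proof (cases "s \<in> {0<..1}")
      case True
      then have s: "0 < s" "s \<le> 1" by auto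
      define h where "h z = G z * of_bool (infnorm (z - x) \<le> s * l) * indicator Q z" for z
      have [measurable]: "h \<in> borel_measurable borel" unfolding h_def by measurable
      \<comment> \<open>The substituted point \<open>z\<close> stays in \<open>Q\<close> by
        convexity and within sup-norm distance \<open>s * l\<close> of \<open>x\<close>. Recording
        both restrictions in \<open>h\<close> allows the substituted integral to be extended over
        the whole space.\<close>
      have "G (x + s *\<^sub>R (y - x)) \<le> h ((x - s *\<^sub>R x) + s *\<^sub>R y)" if "y \<in> Q" for y
      proof -
        have eq: "(x - s *\<^sub>R x) + s *\<^sub>R y = x + s *\<^sub>R (y - x)" by (simp add: algebra_simps)
        have "(1 - s) *\<^sub>R x + s *\<^sub>R y \<in> Q"
          using x that s convex_box(1)[of a "a + l *\<^sub>R One"] unfolding Q by (intro convexD) auto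
        then have "x + s *\<^sub>R (y - x) \<in> Q" by (simp add: algebra_simps)
        moreover have "infnorm (s *\<^sub>R (y - x)) \<le> s * l"
          using infnorm_diff_le_cbox[of y a l x] that x s unfolding Q by (simp add: infnorm_mul)
        ultimately show ?thesis by (simp add: eq h_def)
      qed
      then have "(\<integral>\<^sup>+y. G (x + s *\<^sub>R (y - x)) * indicator Q y \<partial>lborel) \<le> (\<integral>\<^sup>+y. h ((x - s *\<^sub>R x) + s *\<^sub>R y) \<partial>lborel)"
        by (intro nn_integral_mono) (auto simp: indicator_def)
      also have "\<dots> = ennreal (1 / s ^ DIM('a)) * (ennreal (\<bar>s\<bar> ^ DIM('a)) * (\<integral>\<^sup>+y. h ((x - s *\<^sub>R x) + s *\<^sub>R y) \<partial>lborel))"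
      proof -
        have "ennreal (1 / s ^ DIM('a)) * ennreal (\<bar>s\<bar> ^ DIM('a)) = 1"
          using s by (simp flip: ennreal_mult)
        then show ?thesis by (simp flip: mult.assoc)
      qed
      also have "\<dots> = ennreal (1 / s ^ DIM('a)) * (\<integral>\<^sup>+z. h z \<partial>lborel)"
        using s by (subst nn_integral_lborel_affine[of h s "x - s *\<^sub>R x"]) auto
      finally have "ennreal c * (\<integral>\<^sup>+y. G (x + s *\<^sub>R (y - x)) * indicator Q y \<partial>lborel) \<le>
          ennreal c * (ennreal (1 / s ^ DIM('a)) * (\<integral>\<^sup>+z. h z \<partial>lborel))"
        by (rule mult_left_mono) simp
      then show ?thesis using True by (simp add: h_def mult.assoc nn_integral_cmult)
    qed simp
  qed
  also have "\<dots> = ennreal c * (\<integral>\<^sup>+s\<in>{0<..1}. ennreal (1 / s ^ DIM('a)) *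
      (\<integral>\<^sup>+z\<in>Q. G z * of_bool (infnorm (z - x) \<le> s * l) \<partial>lborel) \<partial>lborel)"
    by (intro nn_integral_cmult) measurable
  finally show ?thesis unfolding c_def .
qed

text \<open>The part below \<rho> contributes \<rho>, and the tail contributes at most
  \<open>\<rho> ^ n\<close> times the integral of \<open>s\<close> to the power \<open>-n\<close>,
  again at most \<rho>. The restriction \<open>2 \<le> n\<close> enters here: for
  \<open>n = 1\<close> the tail would be logarithmic.\<close>

lemma nn_integral_truncated_power:
  fixes \<rho> :: real
  assumes \<rho>: "0 < \<rho>" "\<rho> \<le> 1" and n: "2 \<le> n"
  shows "(\<integral>\<^sup>+s\<in>{0<..1}. ennreal (min 1 ((\<rho> / s) ^ n)) \<partial>lborel) \<le> ennreal (2 * \<rho>)"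
proof -
  define m where "m = n - 2"
  have m: "n = Suc (Suc m)" using n by (simp add: m_def)
  have "(\<integral>\<^sup>+s\<in>{0<..1}. ennreal (min 1 ((\<rho> / s) ^ n)) \<partial>lborel) \<le>
      (\<integral>\<^sup>+s. indicator {0..\<rho>} s + ennreal (\<rho> ^ n) * (ennreal (1 / s ^ n) * indicator {\<rho>..1} s) \<partial>lborel)"
  proof (rule nn_integral_mono)
    fix s :: real
    have "ennreal (min 1 ((\<rho> / s) ^ n)) \<le> ennreal (\<rho> ^ n) * ennreal (1 / s ^ n)" if "\<rho> \<le> s"
    proof -
      have "min 1 ((\<rho> / s) ^ n) \<le> \<rho> ^ n * (1 / s ^ n)" by (simp add: power_divide)
      then show ?thesis using \<rho> that by (simp add: ennreal_leI flip: ennreal_mult)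
    qed
    then show "ennreal (min 1 ((\<rho> / s) ^ n)) * indicator {0<..1} s \<le>
        indicator {0..\<rho>} s + ennreal (\<rho> ^ n) * (ennreal (1 / s ^ n) * indicator {\<rho>..1} s)"
    proof (cases "s \<le> \<rho>")
      case True
      have "ennreal (min 1 ((\<rho> / s) ^ n)) \<le> 1" by (simp add: ennreal_le_1)
      then have "ennreal (min 1 ((\<rho> / s) ^ n)) * indicator {0<..1} s \<le> indicator {0..\<rho>} s"
        using True by (simp add: indicator_def)
      then show ?thesis by (rule add_increasing2[rotated]) simp
    qed (simp add: indicator_def)
  qed
  also have "\<dots> = ennreal \<rho> + ennreal (\<rho> ^ n) * (\<integral>\<^sup>+s. ennreal (1 / s ^ n) * indicator {\<rho>..1} s \<partial>lborel)"
    using \<rho> by (simp add: nn_integral_add nn_integral_cmult)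
  also have "(\<integral>\<^sup>+s. ennreal (1 / s ^ n) * indicator {\<rho>..1} s \<partial>lborel)
      = ennreal (- (1 / (real (Suc m) * 1 ^ Suc m)) - (- (1 / (real (Suc m) * \<rho> ^ Suc m))))"
  proof (rule nn_integral_FTC_Icc)
    fix s assume s: "s \<in> {\<rho>..1}"
    then have s0: "s \<noteq> 0" using \<rho> by auto
    then have "((\<lambda>s. - inverse (real (Suc m)) * inverse (s ^ Suc m)) has_real_derivative
        (- inverse (real (Suc m)) * - (inverse (s ^ Suc m) * (real (Suc m) * s ^ m) * inverse (s ^ Suc m)))) (at s)"
      using DERIV_pow[of "Suc m" s UNIV] by (intro DERIV_cmult DERIV_inverse') auto
    also have "(\<lambda>s. - inverse (real (Suc m)) * inverse (s ^ Suc m)) = (\<lambda>s. - (1 / (real (Suc m) * s ^ Suc m)))"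
      by (auto simp: divide_inverse)
    also have "- inverse (real (Suc m)) * - (inverse (s ^ Suc m) * (real (Suc m) * s ^ m) * inverse (s ^ Suc m)) = 1 / s ^ n"
      using s0 by (simp add: m field_simps del: of_nat_Suc)
    finally show "((\<lambda>s. - (1 / (real (Suc m) * s ^ Suc m))) has_real_derivative 1 / s ^ n) (at s)" .
  qed (use \<rho> in auto)
  also have "\<dots> \<le> ennreal (1 / \<rho> ^ Suc m)"
  proof (rule ennreal_leI)
    have "1 / (real (Suc m) * \<rho> ^ Suc m) \<le> 1 / (1 * \<rho> ^ Suc m)"
      using \<rho> by (intro divide_left_mono mult_right_mono) auto
    moreover have "0 \<le> 1 / (real (Suc m) * 1 ^ Suc m)" by simp
    ultimately show "- (1 / (real (Suc m) * 1 ^ Suc m)) - (- (1 / (real (Suc m) * \<rho> ^ Suc m))) \<le> 1 / \<rho> ^ Suc m"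
      by linarith
  qed
  also have "ennreal \<rho> + ennreal (\<rho> ^ n) * ennreal (1 / \<rho> ^ Suc m) = ennreal (\<rho> + \<rho> ^ n * (1 / \<rho> ^ Suc m))"
    using \<rho> by (simp flip: ennreal_mult ennreal_plus)
  also have "\<rho> + \<rho> ^ n * (1 / \<rho> ^ Suc m) = 2 * \<rho>" using \<rho> by (simp add: m)
  finally show ?thesis by (auto simp: mult_left_mono add_left_mono)
qed

text \<open>The oscillation bound is integrated against \<open>w\<close> over \<open>E\<close>. After exchanging integrals the
  mass of \<open>E\<close> in the cube of radius \<open>s l\<close> around \<open>z\<close> is bounded by \<open>K (s l)\<^sup>n w z\<close> for \<open>s \<le> \<rho>\<close>, and by
  \<open>w(E) = \<rho>\<^sup>n w(Q) \<le> \<rho>\<^sup>n K l\<^sup>n w z\<close> for \<open>s > \<rho>\<close>.\<close>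

lemma weighted_weak_type_bound:
  fixes f :: "'a::euclidean_space \<Rightarrow> real" and G w :: "'a \<Rightarrow> ennreal"
  assumes f: "L-lipschitz_on UNIV f"
    and G[measurable]: "G \<in> borel_measurable borel"
    and fG: "AE z in lborel. \<exists>D. GDERIV f z :> D \<and> ennreal (norm D) \<le> G z"
    and Q: "Q = cbox a (a + l *\<^sub>R One)" and l: "0 < l" and n: "2 \<le> DIM('a)"
    and w[measurable]: "w \<in> borel_measurable borel"
    and K: "0 \<le> K" "AE z in lborel. z \<in> Q \<longrightarrow> (\<forall>r\<in>{0<..l}.
        (\<integral>\<^sup>+x\<in>Q. w x * of_bool (infnorm (z - x) \<le> r) \<partial>lborel) \<le> ennreal (K * r ^ DIM('a)) * w z)"
    and q: "(\<integral>\<^sup>+x\<in>Q. w x \<partial>lborel) = ennreal q" "0 < q"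
    and E[measurable]: "E \<in> sets borel" and EQ: "E \<subseteq> Q"
    and e: "(\<integral>\<^sup>+x\<in>E. w x \<partial>lborel) = ennreal e" "0 < e"
    and t: "0 \<le> t" "\<And>x. x \<in> E \<Longrightarrow> t \<le> \<bar>f x - (LINT y:Q|lborel. f y) / l ^ DIM('a)\<bar>"
  shows "ennreal (t * e) \<le> ennreal (2 * sqrt DIM('a) * l * K * root DIM('a) (e / q)) *
      (\<integral>\<^sup>+x\<in>Q. G x * w x \<partial>lborel)"
proof -
  define n where "n = DIM('a)"
  have n0: "n > 0" "2 \<le> n" using n by (auto simp: n_def)
  have [measurable]: "Q \<in> sets borel" by (simp add: Q)
  have cf: "continuous_on UNIV f" using f by (rule lipschitz_on_continuous_on)
  have [measurable]: "f \<in> borel_measurable borel" using cf by (rule borel_measurable_continuous_onI)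
  \<comment> \<open>Chosen so that the local bound and the bound by the total mass of
    \<open>E\<close> agree exactly at \<open>s = \<rho>\<close>.\<close>
  define \<rho> where "\<rho> = root n (e / q)"
  have eq: "e \<le> q"
  proof -
    have "ennreal e \<le> ennreal q" unfolding e(1)[symmetric] q(1)[symmetric]
      using EQ by (intro nn_integral_mono) (auto simp: indicator_def)
    then show ?thesis using q(2) by simp
  qed
  have \<rho>: "0 < \<rho>" "\<rho> \<le> 1" "\<rho> ^ n = e / q"
    using e(2) q(2) eq n0 by (auto simp: \<rho>_def real_root_pow_pos2)
  define c where "c = sqrt DIM('a) * l"
  have c: "0 \<le> c" using l by (simp add: c_def)
  have emQ: "emeasure lborel Q = ennreal (l ^ n)"
    using l unfolding Q n_def by (simp add: emeasure_lborel_cbox_eq inner_add_left inner_sum_left_Basis)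
  have fQ: "set_integrable lborel Q f"
    unfolding Q set_integrable_def by (intro borel_integrable_compact continuous_on_subset[OF cf]) auto
  have osc: "ennreal (l ^ n * t) \<le> (\<integral>\<^sup>+y\<in>Q. ennreal \<bar>f x - f y\<bar> \<partial>lborel)" if "x \<in> E" for x
  proof -
    have cQ: "set_integrable lborel Q (\<lambda>y. f x)"
      by (simp add: set_integrable_def emQ)
    have "(LINT y:Q|lborel. f x - f y) = (LINT y:Q|lborel. f x) - (LINT y:Q|lborel. f y)"
      using cQ fQ by (rule set_integral_diff)
    also have "(LINT y:Q|lborel. f x) = l ^ n * f x"
      using l by (simp add: set_lebesgue_integral_def measure_def emQ)
    also have "l ^ n * f x - (LINT y:Q|lborel. f y) = l ^ n * (f x - (LINT y:Q|lborel. f y) / l ^ n)"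
      using l by (simp add: right_diff_distrib)
    finally have "l ^ n * t \<le> \<bar>LINT y:Q|lborel. f x - f y\<bar>"
      using t(2)[OF that] l by (simp add: abs_mult n_def)
    then have "ennreal (l ^ n * t) \<le> ennreal (norm (LINT y|lborel. indicator Q y *\<^sub>R (f x - f y)))"
      by (simp add: ennreal_leI set_lebesgue_integral_def)
    also have "\<dots> \<le> (\<integral>\<^sup>+y. ennreal (norm (indicator Q y *\<^sub>R (f x - f y))) \<partial>lborel)"
      using set_integral_diff(1)[OF cQ fQ] unfolding set_integrable_def by (rule integral_norm_bound_ennreal)
    also have "\<dots> = (\<integral>\<^sup>+y\<in>Q. ennreal \<bar>f x - f y\<bar> \<partial>lborel)"
      by (intro nn_integral_cong) (auto simp: indicator_def)
    finally show ?thesis .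
  qed
  have K': "AE z in lborel. z \<in> Q \<longrightarrow> (\<forall>s\<in>{0<..1}. ennreal (1 / s ^ n) *
      (\<integral>\<^sup>+x\<in>E. w x * of_bool (infnorm (z - x) \<le> s * l) \<partial>lborel)
        \<le> ennreal (min 1 ((\<rho> / s) ^ n)) * (ennreal (K * l ^ n) * w z))"
    using K(2)
  proof (eventually_elim, intro impI ballI)
    fix z s assume *: "z \<in> Q \<longrightarrow> (\<forall>r\<in>{0<..l}.
        (\<integral>\<^sup>+x\<in>Q. w x * of_bool (infnorm (z - x) \<le> r) \<partial>lborel) \<le> ennreal (K * r ^ DIM('a)) * w z)"
      and z: "z \<in> Q" and s: "s \<in> {0<..(1::real)}"
    have sl: "s * l \<in> {0<..l}" "l \<in> {0<..l}" using s l by auto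
    have "ennreal (1 / s ^ n) * (\<integral>\<^sup>+x\<in>E. w x * of_bool (infnorm (z - x) \<le> s * l) \<partial>lborel)
       \<le> ennreal (1 / s ^ n) * (\<integral>\<^sup>+x\<in>Q. w x * of_bool (infnorm (z - x) \<le> s * l) \<partial>lborel)"
      using EQ by (intro mult_left_mono nn_integral_mono) (auto simp: indicator_def)
    also have "\<dots> \<le> ennreal (1 / s ^ n) * (ennreal (K * (s * l) ^ n) * w z)"
      using * z sl by (intro mult_left_mono) (auto simp: n_def)
    also have "\<dots> = ennreal (K * l ^ n) * w z"
    proof -
      have "1 / s ^ n * (K * (s * l) ^ n) = K * l ^ n" using s by (simp add: power_mult_distrib)
      then show ?thesis using s K(1) l by (simp flip: mult.assoc ennreal_mult)
    qed
    finally have 1: "ennreal (1 / s ^ n) * (\<integral>\<^sup>+x\<in>E. w x * of_bool (infnorm (z - x) \<le> s * l) \<partial>lborel)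
        \<le> 1 * (ennreal (K * l ^ n) * w z)" by simp
    have "ennreal (1 / s ^ n) * (\<integral>\<^sup>+x\<in>E. w x * of_bool (infnorm (z - x) \<le> s * l) \<partial>lborel)
       \<le> ennreal (1 / s ^ n) * (\<integral>\<^sup>+x\<in>E. w x \<partial>lborel)"
      by (intro mult_left_mono nn_integral_mono) (auto simp: indicator_def)
    also have "\<dots> = ennreal ((\<rho> / s) ^ n) * ennreal q"
    proof -
      have "1 / s ^ n * e = (\<rho> / s) ^ n * q" using q(2) by (simp add: power_divide \<rho>(3))
      then show ?thesis using s e(2) q(2) \<rho> by (simp add: e(1) flip: ennreal_mult)
    qed
    \<comment> \<open>This is hypothesis \<open>K\<close> at \<open>r = l\<close>, since the
      sup-norm ball of radius \<open>l\<close> around a point of \<open>Q\<close> contains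
      \<open>Q\<close>.\<close>
    also have "ennreal q \<le> ennreal (K * l ^ n) * w z"
    proof -
      have "ennreal q = (\<integral>\<^sup>+x\<in>Q. w x * of_bool (infnorm (z - x) \<le> l) \<partial>lborel)"
        unfolding q(1)[symmetric] using infnorm_diff_le_cbox[of z a l] z
        by (intro nn_integral_cong) (auto simp: indicator_def Q)
      also have "\<dots> \<le> ennreal (K * l ^ n) * w z" using * z sl by (auto simp: n_def)
      finally show ?thesis .
    qed
    finally have 2: "ennreal (1 / s ^ n) * (\<integral>\<^sup>+x\<in>E. w x * of_bool (infnorm (z - x) \<le> s * l) \<partial>lborel)
        \<le> ennreal ((\<rho> / s) ^ n) * (ennreal (K * l ^ n) * w z)" by (simp add: mult_left_mono)
    show "ennreal (1 / s ^ n) * (\<integral>\<^sup>+x\<in>E. w x * of_bool (infnorm (z - x) \<le> s * l) \<partial>lborel)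
        \<le> ennreal (min 1 ((\<rho> / s) ^ n)) * (ennreal (K * l ^ n) * w z)"
      using 1 2 by (cases "1 \<le> (\<rho> / s) ^ n") (auto simp: min_def)
  qed
  have "ennreal (l ^ n * t) * ennreal e = (\<integral>\<^sup>+x. ennreal (l ^ n * t) * (w x * indicator E x) \<partial>lborel)"
    by (simp add: nn_integral_cmult e(1))
  also have "\<dots> \<le> (\<integral>\<^sup>+x. ennreal c * (\<integral>\<^sup>+s\<in>{0<..1}. ennreal (1 / s ^ n) *
      (\<integral>\<^sup>+z\<in>Q. G z * of_bool (infnorm (z - x) \<le> s * l) \<partial>lborel) \<partial>lborel) * (w x * indicator E x) \<partial>lborel)"
  proof (rule nn_integral_mono)
    fix x
    show "ennreal (l ^ n * t) * (w x * indicator E x) \<le> ennreal c * (\<integral>\<^sup>+s\<in>{0<..1}. ennreal (1 / s ^ n) *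
      (\<integral>\<^sup>+z\<in>Q. G z * of_bool (infnorm (z - x) \<le> s * l) \<partial>lborel) \<partial>lborel) * (w x * indicator E x)"
    proof (cases "x \<in> E")
      case True
      then have "x \<in> Q" using EQ by auto
      from lipschitz_oscillation_bound[OF f G fG Q l this] osc[OF True]
      show ?thesis by (intro mult_right_mono) (auto simp: n_def c_def)
    qed simp
  qed
  \<comment> \<open>All factors go under the innermost integral, so that two exchanges bring the
    integral over \<open>x\<close> in \<open>E\<close> innermost, where the weight condition can be
    applied for fixed \<open>z\<close> and \<open>s\<close>.\<close>
  also have "\<dots> = (\<integral>\<^sup>+x. ennreal c * (\<integral>\<^sup>+s. (\<integral>\<^sup>+z. ennreal (1 / s ^ n) * (G z *
      of_bool (infnorm (z - x) \<le> s * l) * indicator Q z) * indicator {0<..1} s * (w x * indicator E x) \<partial>lborel) \<partial>lborel) \<partial>lborel)"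
    by (intro nn_integral_cong) (simp add: nn_integral_cmult nn_integral_multc, simp add: mult.assoc)
  also have "\<dots> = ennreal c * (\<integral>\<^sup>+x. (\<integral>\<^sup>+s. (\<integral>\<^sup>+z. ennreal (1 / s ^ n) * (G z *
      of_bool (infnorm (z - x) \<le> s * l) * indicator Q z) * indicator {0<..1} s * (w x * indicator E x) \<partial>lborel) \<partial>lborel) \<partial>lborel)"
    by (rule nn_integral_cmult) measurable
  also have "(\<integral>\<^sup>+x. (\<integral>\<^sup>+s. (\<integral>\<^sup>+z. ennreal (1 / s ^ n) * (G z *
      of_bool (infnorm (z - x) \<le> s * l) * indicator Q z) * indicator {0<..1} s * (w x * indicator E x) \<partial>lborel) \<partial>lborel) \<partial>lborel)
    = (\<integral>\<^sup>+s. (\<integral>\<^sup>+x. (\<integral>\<^sup>+z. ennreal (1 / s ^ n) * (G z *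
      of_bool (infnorm (z - x) \<le> s * l) * indicator Q z) * indicator {0<..1} s * (w x * indicator E x) \<partial>lborel) \<partial>lborel) \<partial>lborel)"
    by (rule lborel_pair.Fubini') measurable
  also have "\<dots> = (\<integral>\<^sup>+s. (\<integral>\<^sup>+z. (\<integral>\<^sup>+x. ennreal (1 / s ^ n) * (G z *
      of_bool (infnorm (z - x) \<le> s * l) * indicator Q z) * indicator {0<..1} s * (w x * indicator E x) \<partial>lborel) \<partial>lborel) \<partial>lborel)"
    by (intro nn_integral_cong lborel_pair.Fubini') measurable
  also have "\<dots> \<le> (\<integral>\<^sup>+s. (\<integral>\<^sup>+z. (ennreal (min 1 ((\<rho> / s) ^ n)) * indicator {0<..1} s) *
      (ennreal (K * l ^ n) * (G z * w z * indicator Q z)) \<partial>lborel) \<partial>lborel)"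
  proof (rule nn_integral_mono, rule nn_integral_mono_AE)
    fix s :: real
    show "AE z in lborel. (\<integral>\<^sup>+x. ennreal (1 / s ^ n) * (G z *
      of_bool (infnorm (z - x) \<le> s * l) * indicator Q z) * indicator {0<..1} s * (w x * indicator E x) \<partial>lborel)
      \<le> (ennreal (min 1 ((\<rho> / s) ^ n)) * indicator {0<..1} s) *
      (ennreal (K * l ^ n) * (G z * w z * indicator Q z))"
      using K'
    proof eventually_elim
      case (elim z)
      show ?case
      proof (cases "z \<in> Q \<and> s \<in> {0<..1}")
        case True
        have "(\<integral>\<^sup>+x. ennreal (1 / s ^ n) * (G z *
            of_bool (infnorm (z - x) \<le> s * l) * indicator Q z) * indicator {0<..1} s * (w x * indicator E x) \<partial>lborel)
          = (\<integral>\<^sup>+x. (G z * ennreal (1 / s ^ n)) * (w x * of_bool (infnorm (z - x) \<le> s * l) * indicator E x) \<partial>lborel)"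
          using True by (intro nn_integral_cong) (simp add: mult_ac)
        also have "\<dots> = G z * (ennreal (1 / s ^ n) * (\<integral>\<^sup>+x\<in>E. w x * of_bool (infnorm (z - x) \<le> s * l) \<partial>lborel))"
          by (subst nn_integral_cmult) (auto simp: mult.assoc)
        also have "\<dots> \<le> G z * (ennreal (min 1 ((\<rho> / s) ^ n)) * (ennreal (K * l ^ n) * w z))"
          using elim True by (intro mult_left_mono) auto
        finally show ?thesis using True by (simp add: mult_ac)
      qed (auto simp: indicator_def)
    qed
  qed
  also have "\<dots> = (\<integral>\<^sup>+s\<in>{0<..1}. ennreal (min 1 ((\<rho> / s) ^ n)) \<partial>lborel) *
      (ennreal (K * l ^ n) * (\<integral>\<^sup>+z\<in>Q. G z * w z \<partial>lborel))"
    by (simp add: nn_integral_cmult nn_integral_multc)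
  also have "\<dots> \<le> ennreal (2 * \<rho>) * (ennreal (K * l ^ n) * (\<integral>\<^sup>+z\<in>Q. G z * w z \<partial>lborel))"
    using \<rho> n0 by (intro mult_right_mono nn_integral_truncated_power) auto
  finally have "ennreal (l ^ n * t) * ennreal e \<le>
      ennreal c * (ennreal (2 * \<rho>) * (ennreal (K * l ^ n) * (\<integral>\<^sup>+z\<in>Q. G z * w z \<partial>lborel)))"
    by (simp add: mult_left_mono)
  then have "ennreal (1 / l ^ n) * (ennreal (l ^ n * t) * ennreal e) \<le>
      ennreal (1 / l ^ n) * (ennreal c * (ennreal (2 * \<rho>) * (ennreal (K * l ^ n) * (\<integral>\<^sup>+z\<in>Q. G z * w z \<partial>lborel))))"
    by (rule mult_left_mono) simp
  moreover have "ennreal (1 / l ^ n) * (ennreal (l ^ n * t) * ennreal e) = ennreal (t * e)"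
    using l t(1) e(2) by (simp flip: ennreal_mult)
  moreover have "ennreal (1 / l ^ n) * (ennreal c * (ennreal (2 * \<rho>) * (ennreal (K * l ^ n) * (\<integral>\<^sup>+z\<in>Q. G z * w z \<partial>lborel))))
      = ennreal (2 * c * K * \<rho>) * (\<integral>\<^sup>+z\<in>Q. G z * w z \<partial>lborel)"
  proof -
    have "1 / l ^ n * (c * (2 * \<rho> * (K * l ^ n))) = 2 * c * K * \<rho>" using l by simp
    then show ?thesis using l c K(1) \<rho>(1) by (simp flip: mult.assoc ennreal_mult) (simp add: mult_ac)
  qed
  ultimately show ?thesis by (simp add: c_def \<rho>_def n_def mult_ac)
qed

section \<open>From weak to strong type by truncation\<close>

lemma weighted_AM_GM_powr:
  fixes x y :: real
  assumes "0 \<le> x" "0 \<le> y" "0 \<le> \<alpha>" "\<alpha> \<le> 1"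
  shows "x powr \<alpha> * y powr (1 - \<alpha>) \<le> \<alpha> * x + (1 - \<alpha>) * y"
  using Youngs_inequality_0[of \<alpha> "1 - \<alpha>" x y] assms by (cases "x = 0 \<or> y = 0") auto

text \<open>After dividing the two factors by their norms, pointwise AM-GM integrates to
  \<open>1/p + (1 - 1/p) = 1\<close>. Vanishing norms are treated separately; note
  \<open>0 powr 0 = 0\<close>, so for \<open>p = 1\<close> and a null set \<open>D\<close> the
  right-hand side is 0, and so is the left.\<close>

lemma (in finite_measure) integral_le_Holder:
  fixes g :: "'a \<Rightarrow> real"
  assumes g[measurable]: "g \<in> borel_measurable M" and D[measurable]: "D \<in> sets M"
    and bnd: "\<And>x. 0 \<le> g x" "\<And>x. g x \<le> B" and p: "1 \<le> p"
  shows "(\<integral>x. g x * indicator D x \<partial>M) \<le>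
    (\<integral>x. g x powr p * indicator D x \<partial>M) powr (1 / p) * measure M D powr (1 - 1 / p)"
proof -
  define I where "I = (\<integral>x. g x powr p * indicator D x \<partial>M)"
  define a where "a = measure M D"
  have int1: "integrable M (\<lambda>x. g x * indicator D x)"
    using bnd order_trans[OF bnd] by (intro integrable_const_bound[where B=B]) (auto simp: indicator_def)
  have intp: "integrable M (\<lambda>x. g x powr p * indicator D x)"
    using bnd p order_trans[OF bnd]
    by (intro integrable_const_bound[where B="B powr p"]) (auto simp: indicator_def intro!: powr_mono2)
  have I0: "0 \<le> I" unfolding I_def by (intro integral_nonneg_AE) auto
  show ?thesis
  proof (cases "I = 0 \<or> a = 0")
    case True
    have "AE x in M. g x * indicator D x = 0"
    proof (cases "I = 0")
      case True
      then have "AE x in M. g x powr p * indicator D x = 0"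
        unfolding I_def using intp by (subst (asm) integral_nonneg_eq_0_iff_AE) auto
      then show ?thesis by eventually_elim auto
    next
      case False
      then have "D \<in> null_sets M" using \<open>I = 0 \<or> a = 0\<close> by (auto simp: a_def emeasure_eq_measure)
      then have "AE x in M. x \<notin> D" by (rule AE_not_in)
      then show ?thesis by eventually_elim auto
    qed
    then have "(\<integral>x. g x * indicator D x \<partial>M) = 0" by (subst integral_cong_AE[where g="\<lambda>_. 0"]) auto
    then show ?thesis by simp
  next
    case False
    then have pos: "0 < I" "0 < a" using I0 by (auto simp: a_def zero_less_measure_iff)
    define Z where "Z = I powr (1 / p) * a powr (1 - 1 / p)"
    have Z: "Z > 0" using pos by (simp add: Z_def)
    have pt: "g x * indicator D x \<le> Z * (1 / p * (g x powr p * indicator D x / I) + (1 - 1 / p) * (indicator D x / a))" for x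
    proof (cases "x \<in> D")
      case True
      have "(g x powr p / I) powr (1 / p) * (1 / a) powr (1 - 1 / p) \<le> 1 / p * (g x powr p / I) + (1 - 1 / p) * (1 / a)"
        using pos p bnd by (intro weighted_AM_GM_powr) auto
      moreover have "(g x powr p / I) powr (1 / p) * (1 / a) powr (1 - 1 / p) = g x / Z"
        using pos p bnd by (simp add: Z_def powr_divide powr_powr)
      ultimately have "Z * (g x / Z) \<le> Z * (1 / p * (g x powr p / I) + (1 - 1 / p) * (1 / a))"
        using Z by (intro mult_left_mono) auto
      then show ?thesis using Z True by simp
    qed simp
    have "(\<integral>x. g x * indicator D x \<partial>M) \<le>
      (\<integral>x. Z * (1 / p * (g x powr p * indicator D x / I) + (1 - 1 / p) * (indicator D x / a)) \<partial>M)"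
      using int1 intp pt by (intro integral_mono) (auto simp: integrable_indicator_iff emeasure_eq_measure)
    also have "\<dots> = Z * (1 / p * (I / I) + (1 - 1 / p) * (a / a))"
      using intp by (simp add: I_def a_def integrable_indicator_iff emeasure_eq_measure)
    also have "\<dots> = Z" using pos p by (simp add: field_simps)
    finally show ?thesis by (simp add: Z_def I_def a_def)
  qed
qed

text \<open>For \<open>b\<^sub>j \<le> S = \<Sum>\<^sub>j b\<^sub>j\<close> one has \<open>b\<^sub>j\<^sup>\<theta> \<ge> S\<^sup>\<theta>\<^sup>-\<^sup>1 b\<^sub>j\<close>; the right-hand sides are summed by
  Hoelder's inequality in the normalised form of the weighted AM-GM inequality.\<close>

lemma suminf_powr_bound:
  fixes b g :: "nat \<Rightarrow> real"
  assumes b: "summable b" "\<And>j. 0 \<le> b j" and g: "\<And>j. 0 \<le> g j" "\<And>N. (\<Sum>j<N. g j) \<le> I"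
    and p: "1 \<le> p" and \<theta>: "\<theta> \<le> 1" and B: "0 \<le> B"
    and rec: "\<And>j. b j powr \<theta> \<le> B * (g j powr (1 / p) * b (Suc j) powr (1 - 1 / p))"
  shows "(\<Sum>j. b j) powr (\<theta> - (1 - 1 / p)) \<le> B * I powr (1 / p)"
proof -
  define S where "S = (\<Sum>j. b j)"
  have I0: "0 \<le> I" using g(2)[of 0] by simp
  have S0: "0 \<le> S" unfolding S_def using b by (intro suminf_nonneg) auto
  have bS: "b j \<le> S" for j
    using sum_le_suminf[OF b(1), of "{j}"] b(2) by (simp add: S_def)
  have bN: "(\<Sum>j<N. b (Suc j)) \<le> S" for N
  proof -
    have "(\<Sum>j<N. b (Suc j)) = sum b (Suc ` {..<N})" by (simp add: sum.reindex)
    also have "\<dots> \<le> S" unfolding S_def by (rule sum_le_suminf) (use b in auto)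
    finally show ?thesis .
  qed
  show ?thesis
  proof (cases "S = 0")
    case True then show ?thesis using B I0 by (simp add: S_def)
  next
    case False
    then have S: "S > 0" using S0 by simp
    have holder: "(\<Sum>j<N. g j powr (1 / p) * b (Suc j) powr (1 - 1 / p)) \<le> I powr (1 / p) * S powr (1 - 1 / p)" for N
    proof (cases "I = 0")
      case True
      have "g j = 0" if "j < N" for j
      proof -
        have "g j \<le> (\<Sum>j<N. g j)" using that g(1) by (intro member_le_sum) auto
        then show ?thesis using g(1)[of j] g(2)[of N] True by simp
      qed
      then show ?thesis by simp
    next
      case False
      then have I: "I > 0" using I0 by simp
      define Z where "Z = I powr (1 / p) * S powr (1 - 1 / p)"
      have Z: "Z > 0" using I S by (simp add: Z_def)
      have "g j powr (1 / p) * b (Suc j) powr (1 - 1 / p) \<le> Z * (1 / p / I * g j + (1 - 1 / p) / S * b (Suc j))" for j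
      proof -
        have "(g j / I) powr (1 / p) * (b (Suc j) / S) powr (1 - 1 / p) \<le> 1 / p * (g j / I) + (1 - 1 / p) * (b (Suc j) / S)"
          using I S p g(1) b(2) by (intro weighted_AM_GM_powr) auto
        moreover have "(g j / I) powr (1 / p) * (b (Suc j) / S) powr (1 - 1 / p)
            = g j powr (1 / p) * b (Suc j) powr (1 - 1 / p) / Z"
          using I S g(1) b(2) by (simp add: Z_def powr_divide)
        ultimately show ?thesis using Z by (simp add: pos_divide_le_eq mult.commute)
      qed
      then have "(\<Sum>j<N. g j powr (1 / p) * b (Suc j) powr (1 - 1 / p)) \<le>
          (\<Sum>j<N. Z * (1 / p / I * g j + (1 - 1 / p) / S * b (Suc j)))"
        by (rule sum_mono)
      also have "\<dots> = Z * (1 / p / I * (\<Sum>j<N. g j) + (1 - 1 / p) / S * (\<Sum>j<N. b (Suc j)))"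
        by (simp only: sum_distrib_left sum.distrib[symmetric])
      also have "\<dots> \<le> Z * (1 / p / I * I + (1 - 1 / p) / S * S)"
        using Z I S p g(2) bN by (intro mult_left_mono add_mono) auto
      also have "\<dots> = Z" using I S p by (simp add: field_simps)
      finally show ?thesis by (simp add: Z_def)
    qed
    have part: "S powr (\<theta> - 1) * (\<Sum>j<N. b j) \<le> B * (I powr (1 / p) * S powr (1 - 1 / p))" for N
    proof -
      have "S powr (\<theta> - 1) * b j \<le> b j powr \<theta>" for j
      proof (cases "b j = 0")
        case False
        then have "0 < b j" using b(2)[of j] by simp
        then have "S powr (\<theta> - 1) \<le> b j powr (\<theta> - 1)" using bS \<theta> by (intro powr_mono2') auto
        then have "S powr (\<theta> - 1) * b j \<le> b j powr (\<theta> - 1) * b j" using b(2) by (rule mult_right_mono)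
        also have "\<dots> = b j powr \<theta>" using \<open>0 < b j\<close> by (simp add: powr_diff)
        finally show ?thesis .
      qed simp
      then have "S powr (\<theta> - 1) * (\<Sum>j<N. b j) \<le> (\<Sum>j<N. b j powr \<theta>)"
        unfolding sum_distrib_left by (intro sum_mono)
      also have "\<dots> \<le> (\<Sum>j<N. B * (g j powr (1 / p) * b (Suc j) powr (1 - 1 / p)))"
        using rec by (rule sum_mono)
      also have "\<dots> \<le> B * (I powr (1 / p) * S powr (1 - 1 / p))"
        unfolding sum_distrib_left[symmetric] using holder B by (rule mult_left_mono)
      finally show ?thesis .
    qed
    have "(\<lambda>N. S powr (\<theta> - 1) * (\<Sum>j<N. b j)) \<longlonglongrightarrow> S powr (\<theta> - 1) * S"
      unfolding S_def using summable_LIMSEQ[OF b(1)] by (intro tendsto_intros)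
    then have "S powr (\<theta> - 1) * S \<le> B * (I powr (1 / p) * S powr (1 - 1 / p))"
      using part by (intro LIMSEQ_le_const2) auto
    \<comment> \<open>The sum occurs on both sides, and the power \<open>1 - 1 / p\<close> of it is
      absorbed. This is legitimate because summability makes \<open>S\<close> a finite number,
      positive in this case.\<close>
    then have "S powr \<theta> \<le> (B * I powr (1 / p)) * S powr (1 - 1 / p)"
      using S by (simp add: powr_diff mult.assoc)
    then have "S powr \<theta> / S powr (1 - 1 / p) \<le> B * I powr (1 / p)"
      using S by (simp add: pos_divide_le_eq)
    then show ?thesis using S by (simp add: powr_diff S_def)
  qed
qed

text \<open>Maz'ya's truncation: the hypothesis is used at the levels \<open>\<Lambda> 2\<^sup>-\<^sup>j\<close>. Applying Hoelder's
  inequality on each layer gives the case \<open>p > 1\<close> together with the case \<open>p = 1\<close>.\<close>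

lemma (in finite_measure) truncation_strong_type:
  fixes f g :: "'a \<Rightarrow> real"
  assumes f[measurable]: "f \<in> borel_measurable M" and f_le: "AE x in M. f x \<le> \<Lambda>" "0 < \<Lambda>"
    and g[measurable]: "g \<in> borel_measurable M" and bnd: "\<And>x. 0 \<le> g x" "\<And>x. g x \<le> B"
    and p: "1 \<le> p" and ps: "0 < ps" "1 / p - 1 / ps = 1 / \<nu>" and \<nu>: "1 \<le> \<nu>" and A: "0 \<le> A"
    and weak: "\<And>\<alpha> \<beta>. 0 < \<alpha> \<Longrightarrow> \<alpha> < \<beta> \<Longrightarrow>
      (\<beta> - \<alpha>) * measure M {x\<in>space M. \<beta> \<le> f x} powr (1 - 1 / \<nu>)
        \<le> A * (\<integral>x. g x * indicator {x\<in>space M. \<alpha> < f x \<and> f x < \<beta>} x \<partial>M)"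
  shows "(\<integral>x. max (f x) 0 powr ps \<partial>M) \<le> (2 * 2 powr (ps * (1 - 1 / \<nu>)) * A *
    (\<integral>x. g x powr p \<partial>M) powr (1 / p)) powr ps"
proof -
  \<comment> \<open>Levels descend from the upper bound \<Lambda>, so a sequence indexed by
    \<open>nat\<close> exhausts all positive values of \<open>f\<close>.\<close>
  define T where "T j = \<Lambda> * (1 / 2) ^ j" for j :: nat
  have T0: "T j > 0" and TS: "T j = 2 * T (Suc j)" for j using f_le(2) by (auto simp: T_def)
  define D where "D j = {x\<in>space M. T (Suc j) < f x \<and> f x < T j}" for j
  have [measurable]: "D j \<in> sets M" for j unfolding D_def by measurable
  define a where "a j = measure M {x\<in>space M. T j \<le> f x}" for j
  define b where "b j = T j powr ps * a j" for j
  define I where "I = (\<integral>x. g x powr p \<partial>M)"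
  define gg where "gg j = (\<integral>x. g x powr p * indicator (D j) x \<partial>M)" for j
  define \<gamma> where "\<gamma> = ps * (1 - 1 / \<nu>)"
  \<comment> \<open>The relation between \<open>p\<close> and \<open>ps\<close> in the form that
    turns the surplus power of the level, times \<open>a (Suc j) powr (1 - 1 / p)\<close>, into
    exactly \<open>b (Suc j) powr (1 - 1 / p)\<close>.\<close>
  have \<gamma>1: "\<gamma> - 1 = ps * (1 - 1 / p)"
  proof -
    have "1 - 1 / \<nu> - (1 - 1 / p) = 1 / ps" using ps(2) by simp
    then have "ps * (1 - 1 / \<nu> - (1 - 1 / p)) = 1" using ps(1) by simp
    then show ?thesis by (simp add: \<gamma>_def right_diff_distrib)
  qed
  have intp: "integrable M (\<lambda>x. g x powr p)"
    using bnd p by (intro integrable_const_bound[where B="B powr p"]) (auto intro!: powr_mono2)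
  have intD: "integrable M (\<lambda>x. g x powr p * indicator (D j) x)" for j
    using intp by (intro integrable_real_mult_indicator) measurable
  have b0: "0 \<le> b j" for j by (simp add: b_def a_def)
  \<comment> \<open>A qualitative bound by the total mass and a geometric series. It leaves no trace
    in the final constant but makes the later absorption possible.\<close>
  have bsum: "summable b"
  proof (rule summable_comparison_test)
    have "b j \<le> \<Lambda> powr ps * measure M (space M) * ((1 / 2) powr ps) ^ j" for j
    proof -
      have "b j \<le> T j powr ps * measure M (space M)"
        unfolding b_def a_def by (intro mult_left_mono finite_measure_mono) auto
      also have "T j powr ps = \<Lambda> powr ps * ((1 / 2) powr ps) ^ j"
        using f_le(2) by (simp add: T_def powr_mult powr_power powr_powr flip: powr_realpow) (simp add: mult.commute)
      finally show ?thesis by (simp add: mult_ac)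
    qed
    then show "\<exists>N. \<forall>j\<ge>N. norm (b j) \<le> \<Lambda> powr ps * measure M (space M) * ((1 / 2) powr ps) ^ j"
      using b0 by auto
    have "(1 / 2) powr ps < (1::real)" using powr_less_mono2[of ps "1 / 2" 1] ps(1) by simp
    then show "summable (\<lambda>j. \<Lambda> powr ps * measure M (space M) * ((1 / 2) powr ps) ^ j)"
      by (intro summable_mult summable_geometric) simp
  qed
  have gg0: "0 \<le> gg j" for j unfolding gg_def by (intro integral_nonneg_AE) auto
  have ggI: "(\<Sum>j<N. gg j) \<le> I" for N
  proof -
    have disj: "D i \<inter> D j = {}" if "i < j" for i j
    proof -
      have "T j \<le> T (Suc i)" using that f_le(2) unfolding T_def by (intro mult_left_mono power_decreasing) auto
      then show ?thesis by (auto simp: D_def)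
    qed
    have one: "(\<Sum>j<N. indicator (D j) x) \<le> (1::real)" for x
    proof -
      have "disjoint_family_on D {..<N}"
        unfolding disjoint_family_on_def using disj by (metis Int_commute linorder_neqE_nat)
      then have "(\<Sum>j<N. indicator (D j) x) = (indicator (\<Union>j<N. D j) x :: real)"
        by (intro indicator_UN_disjoint[symmetric]) auto
      then show ?thesis by (simp add: indicator_def)
    qed
    have "(\<Sum>j<N. gg j) = (\<integral>x. (\<Sum>j<N. g x powr p * indicator (D j) x) \<partial>M)"
      unfolding gg_def by (rule Bochner_Integration.integral_sum[symmetric]) (rule intD)
    also have "\<dots> \<le> I" unfolding I_def
    proof (rule integral_mono)
      show "(\<Sum>j<N. g x powr p * indicator (D j) x) \<le> g x powr p" for x
        using mult_left_mono[OF one, of "g x powr p" x] unfolding sum_distrib_left by simp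
    qed (rule Bochner_Integration.integrable_sum, rule intD, rule intp)
    finally show ?thesis .
  qed
  have rec: "b j powr (1 - 1 / \<nu>) \<le> 2 powr \<gamma> * A * (gg j powr (1 / p) * b (Suc j) powr (1 - 1 / p))" for j
  proof -
    have "T (Suc j) * a j powr (1 - 1 / \<nu>) \<le> A * (\<integral>x. g x * indicator (D j) x \<partial>M)"
      using weak[of "T (Suc j)" "T j"] T0[of "Suc j"] TS[of j] by (simp add: D_def a_def)
    also have "(\<integral>x. g x * indicator (D j) x \<partial>M) \<le> gg j powr (1 / p) * measure M (D j) powr (1 - 1 / p)"
      unfolding gg_def using bnd p by (intro integral_le_Holder) auto
    also have "\<dots> \<le> gg j powr (1 / p) * a (Suc j) powr (1 - 1 / p)"
      using p unfolding a_def D_def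
      by (intro mult_left_mono powr_mono2 finite_measure_mono) auto
    finally have 1: "T (Suc j) * a j powr (1 - 1 / \<nu>) \<le> A * (gg j powr (1 / p) * a (Suc j) powr (1 - 1 / p))"
      using A by (simp add: mult_left_mono)
    have "b j powr (1 - 1 / \<nu>) = T j powr \<gamma> * a j powr (1 - 1 / \<nu>)"
      using T0[of j] by (simp add: b_def powr_mult powr_powr \<gamma>_def a_def)
    also have "T j powr \<gamma> = 2 powr \<gamma> * (T (Suc j) powr (\<gamma> - 1) * T (Suc j))"
      using T0[of "Suc j"] by (subst TS) (simp add: powr_mult powr_diff)
    also have "2 powr \<gamma> * (T (Suc j) powr (\<gamma> - 1) * T (Suc j)) * a j powr (1 - 1 / \<nu>)
        = 2 powr \<gamma> * T (Suc j) powr (\<gamma> - 1) * (T (Suc j) * a j powr (1 - 1 / \<nu>))" by simp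
    also have "\<dots> \<le> 2 powr \<gamma> * T (Suc j) powr (\<gamma> - 1) * (A * (gg j powr (1 / p) * a (Suc j) powr (1 - 1 / p)))"
      using 1 by (intro mult_left_mono) auto
    also have "\<dots> = 2 powr \<gamma> * A * (gg j powr (1 / p) * (T (Suc j) powr (\<gamma> - 1) * a (Suc j) powr (1 - 1 / p)))"
      by simp
    also have "T (Suc j) powr (\<gamma> - 1) * a (Suc j) powr (1 - 1 / p) = b (Suc j) powr (1 - 1 / p)"
      using T0[of "Suc j"] by (simp add: b_def powr_mult powr_powr \<gamma>1 a_def)
    finally show ?thesis .
  qed
  define S where "S = (\<Sum>j. b j)"
  have S0: "0 \<le> S" unfolding S_def using bsum b0 by (intro suminf_nonneg) auto
  have "S powr (1 - 1 / \<nu> - (1 - 1 / p)) \<le> 2 powr \<gamma> * A * I powr (1 / p)"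
    unfolding S_def
    by (rule suminf_powr_bound[OF bsum b0 gg0 ggI p _ _ rec]) (use \<nu> A in auto)
  moreover have "1 - 1 / \<nu> - (1 - 1 / p) = 1 / ps" using ps(2) by simp
  ultimately have Sp: "S powr (1 / ps) \<le> 2 powr \<gamma> * A * I powr (1 / p)" by simp
  have "(\<integral>\<^sup>+x. ennreal (max (f x) 0 powr ps) \<partial>M) \<le>
      (\<integral>\<^sup>+x. (\<Sum>j. ennreal (T j powr ps) * indicator {x\<in>space M. T (Suc j) \<le> f x} x) \<partial>M)"
  proof (rule nn_integral_mono_AE, use f_le(1) AE_space in eventually_elim)
    case (elim x)
    show ?case
    proof (cases "0 < f x")
      case True
      have "\<exists>j. T j < f x"
      proof -
        obtain j where "(1 / 2) ^ j < f x / \<Lambda>" using real_arch_pow_inv[of "f x / \<Lambda>" "1/2"] True f_le(2) by auto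
        then show ?thesis using f_le(2) by (auto simp: T_def field_simps)
      qed
      then obtain k where k: "T k < f x" "\<And>i. i < k \<Longrightarrow> \<not> T i < f x" using exists_least_iff[of "\<lambda>j. T j < f x"] by auto
      \<comment> \<open>The first level below \<open>f x\<close> is not the top level \<Lambda>, so
        it has a predecessor \<open>T j\<close>, which is at least \<open>f x\<close>. Passing from
        \<open>T j\<close> to \<open>T (Suc j)\<close> costs the factor \<open>2 powr ps\<close>
        below.\<close>
      have "k \<noteq> 0" using k(1) elim(1) by (intro notI) (simp add: T_def)
      then obtain j where j: "k = Suc j" by (cases k) auto
      have "ennreal (max (f x) 0 powr ps) \<le> ennreal (T j powr ps)"
        using k(2)[of j] True ps(1) by (intro ennreal_leI powr_mono2) (auto simp: j)
      also have "\<dots> = ennreal (T j powr ps) * indicator {x\<in>space M. T (Suc j) \<le> f x} x"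
        using k(1) elim(2) by (simp add: j)
      also have "\<dots> = (\<Sum>i\<in>{j}. ennreal (T i powr ps) * indicator {x\<in>space M. T (Suc i) \<le> f x} x)"
        by (simp only: sum.insert[OF finite.emptyI] empty_iff not_False_eq_True sum.empty add_0_right)
      also have "\<dots> \<le> (\<Sum>i. ennreal (T i powr ps) * indicator {x\<in>space M. T (Suc i) \<le> f x} x)"
        by (intro sum_le_suminf) auto
      finally show ?thesis .
    qed (simp add: max_def)
  qed
  also have "\<dots> = (\<Sum>j. ennreal (T j powr ps * a (Suc j)))"
    by (subst nn_integral_suminf) (auto simp: nn_integral_cmult a_def emeasure_eq_measure ennreal_mult)
  also have "(\<lambda>j. T j powr ps * a (Suc j)) = (\<lambda>j. 2 powr ps * b (Suc j))"
  proof
    fix j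
    show "T j powr ps * a (Suc j) = 2 powr ps * b (Suc j)"
      using T0[of "Suc j"] by (subst TS) (simp add: b_def powr_mult)
  qed
  also have "(\<Sum>j. ennreal (2 powr ps * b (Suc j))) = ennreal (\<Sum>j. 2 powr ps * b (Suc j))"
    using bsum b0 by (intro suminf_ennreal2 summable_mult) (auto simp: summable_Suc_iff)
  also have "\<dots> \<le> ennreal (2 powr ps * S)"
  proof (rule ennreal_leI)
    have "(\<Sum>j. 2 powr ps * b (Suc j)) = 2 powr ps * (\<Sum>j. b (Suc j))"
      using bsum by (intro suminf_mult) (auto simp: summable_Suc_iff)
    also have "(\<Sum>j. b (Suc j)) = S - b 0" unfolding S_def by (rule suminf_minus_initial_segment[of b 1, simplified]) (rule bsum)
    finally show "(\<Sum>j. 2 powr ps * b (Suc j)) \<le> 2 powr ps * S" using b0[of 0] by (simp add: right_diff_distrib)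
  qed
  finally have fin: "(\<integral>\<^sup>+x. ennreal (max (f x) 0 powr ps) \<partial>M) \<le> ennreal (2 powr ps * S)" .
  have "(\<integral>x. max (f x) 0 powr ps \<partial>M) = enn2real (\<integral>\<^sup>+x. ennreal (max (f x) 0 powr ps) \<partial>M)"
    by (intro integral_eq_nn_integral) auto
  also have "\<dots> \<le> 2 powr ps * S" using fin S0 by (intro enn2real_leI) auto
  also have "S = (S powr (1 / ps)) powr ps" using ps(1) S0 by (simp add: powr_powr)
  also have "\<dots> \<le> (2 powr \<gamma> * A * I powr (1 / p)) powr ps" using Sp ps(1) by (intro powr_mono2) auto
  also have "2 powr ps * (2 powr \<gamma> * A * I powr (1 / p)) powr ps = (2 * (2 powr \<gamma> * A * I powr (1 / p))) powr ps"
    using A by (simp add: powr_mult)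
  finally show ?thesis by (simp add: I_def \<gamma>_def mult.assoc)
qed

section \<open>Clamping, medians and gradients\<close>

lemma GDERIV_unique: "GDERIV f x :> D \<Longrightarrow> GDERIV f x :> D' \<Longrightarrow> D = D'"
  unfolding gderiv_def by (metis has_derivative_unique inner_commute vector_eq_rdot)

lemma gradient_eq: "GDERIV f x :> D \<Longrightarrow> gradient f x = D"
  unfolding gradient_def using GDERIV_unique by (auto intro!: the_equality)

text \<open>In the open layer the clamped function agrees with \<open>f\<close> near
  \<open>z\<close>. Everywhere else, including the level sets \<open>f = \<alpha>\<close> and
  \<open>f = \<beta>\<close>, it attains a global extremum at \<open>z\<close>, so its gradient
  vanishes. Hence the layers may be taken open, and consecutive ones are disjoint.\<close>

lemma GDERIV_clamp_norm_le:
  fixes f :: "'a::euclidean_space \<Rightarrow> real"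
  assumes D: "GDERIV f z :> D" and D': "GDERIV (\<lambda>x. max \<alpha> (min \<beta> (f x))) z :> D'"
    and \<alpha>\<beta>: "\<alpha> \<le> \<beta>" and G: "norm D \<le> G"
  shows "norm D' \<le> G * indicator {x. \<alpha> < f x \<and> f x < \<beta>} z"
proof (cases "\<alpha> < f z \<and> f z < \<beta>")
  case True
  have "continuous (at z) f" using D unfolding gderiv_def by (rule has_derivative_continuous)
  then have tend: "(f \<longlongrightarrow> f z) (at z)" by (simp add: isCont_def)
  have ev: "\<forall>\<^sub>F x in at z. f x = max \<alpha> (min \<beta> (f x))"
    using order_tendstoD(1)[OF tend, of \<alpha>] order_tendstoD(2)[OF tend, of \<beta>] True
    by (auto elim: eventually_elim2)
  have "GDERIV (\<lambda>x. max \<alpha> (min \<beta> (f x))) z :> D"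
    unfolding gderiv_def
    by (rule has_derivative_transform_eventually[OF D[unfolded gderiv_def] ev]) (use True in auto)
  then have "D' = D" using D' GDERIV_unique by blast
  then show ?thesis using True G by simp
next
  case False
  have "(\<lambda>h. h \<bullet> D') = (\<lambda>h. 0)"
  proof (rule differential_zero_maxmin[of z UNIV "\<lambda>x. max \<alpha> (min \<beta> (f x))"])
    show "((\<lambda>x. max \<alpha> (min \<beta> (f x))) has_derivative (\<lambda>h. h \<bullet> D')) (at z)"
      using D' by (simp add: gderiv_def)
    show "(\<forall>y\<in>UNIV. max \<alpha> (min \<beta> (f y)) \<le> max \<alpha> (min \<beta> (f z))) \<or>
        (\<forall>y\<in>UNIV. max \<alpha> (min \<beta> (f z)) \<le> max \<alpha> (min \<beta> (f y)))"
      using False \<alpha>\<beta> by (auto simp: max_def min_def)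
  qed auto
  then have "D' \<bullet> D' = 0" by meson
  then show ?thesis using False by simp
qed

lemma lipschitz_clamp:
  fixes f :: "'a::metric_space \<Rightarrow> real"
  assumes f: "L-lipschitz_on UNIV f"
  shows "L-lipschitz_on UNIV (\<lambda>x. max \<alpha> (min \<beta> (f x)))"
proof (rule lipschitz_onI)
  fix x y
  have "dist (max \<alpha> (min \<beta> (f x))) (max \<alpha> (min \<beta> (f y))) \<le> dist (f x) (f y)"
    by (auto simp: dist_real_def max_def min_def)
  also have "\<dots> \<le> L * dist x y" by (rule lipschitz_onD[OF f UNIV_I UNIV_I])
  finally show "dist (max \<alpha> (min \<beta> (f x))) (max \<alpha> (min \<beta> (f y))) \<le> L * dist x y" .
qed (rule lipschitz_on_nonneg[OF f])

text \<open>The median is the infimum of the levels whose sublevel set carries half of the mass; the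
  bound on \<open>f\<close> makes this set of levels nonempty and bounded below. Continuity of the
  measure from above, applied to sublevel sets above \<open>m\<close> and to strict superlevel sets
  below \<open>m\<close>, gives both halves.\<close>

lemma (in finite_measure) median_exists:
  fixes f :: "'a \<Rightarrow> real"
  assumes f[measurable]: "f \<in> borel_measurable M" and bnd: "AE x in M. \<bar>f x\<bar> \<le> C"
  obtains m where "measure M (space M) / 2 \<le> measure M {x\<in>space M. f x \<le> m}"
    and "measure M (space M) / 2 \<le> measure M {x\<in>space M. m \<le> f x}"
proof -
  define W where "W = measure M (space M)"
  define X where "X = {t. W / 2 \<le> measure M {x\<in>space M. f x \<le> t}}"
  have W0: "0 \<le> W" by (simp add: W_def)
  show ?thesis
  proof (cases "W = 0")
    case True
    then show ?thesis using that[of 0] by (simp add: W_def)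
  next
    case False
    then have W: "0 < W" using W0 by simp
    have "measure M {x\<in>space M. f x \<le> C} = W"
      unfolding W_def by (intro finite_measure_eq_AE) (use bnd in auto)
    then have CX: "C \<in> X" using W by (simp add: X_def)
    have lower: "- C \<le> t" if "t \<in> X" for t
    proof (rule ccontr)
      assume "\<not> - C \<le> t"
      then have "measure M {x\<in>space M. f x \<le> t} = measure M {}"
        by (intro finite_measure_eq_AE) (use bnd in auto)
      then show False using that W by (simp add: X_def)
    qed
    have bdd: "bdd_below X" using lower by (rule bdd_belowI)
    define m where "m = Inf X"
    have up: "t \<in> X" if t: "m < t" for t
    proof -
      obtain s where s: "s \<in> X" "s < t" using cInf_lessD[of X t] CX t by (auto simp: m_def)
      have "measure M {x\<in>space M. f x \<le> s} \<le> measure M {x\<in>space M. f x \<le> t}"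
        using s(2) by (intro finite_measure_mono) auto
      then show ?thesis using s(1) by (simp add: X_def)
    qed
    have down: "t \<notin> X" if "t < m" for t
      using cInf_lower[OF _ bdd, of t] that by (auto simp: m_def)
    have lim0: "(\<lambda>k. m + 1 / real (Suc k)) \<longlonglongrightarrow> m" "(\<lambda>k. m - 1 / real (Suc k)) \<longlonglongrightarrow> m"
      using tendsto_add[OF tendsto_const[of m] LIMSEQ_inverse_real_of_nat]
        tendsto_diff[OF tendsto_const[of m] LIMSEQ_inverse_real_of_nat]
      by (simp_all add: inverse_eq_divide)
    show ?thesis
    proof (rule that)
      have "(\<lambda>k. measure M {x\<in>space M. f x \<le> m + 1 / real (Suc k)}) \<longlonglongrightarrow>
          measure M (\<Inter>k. {x\<in>space M. f x \<le> m + 1 / real (Suc k)})"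
        by (intro finite_Lim_measure_decseq decseq_SucI)
          (auto intro: order_trans simp: divide_left_mono)
      also have "(\<Inter>k. {x\<in>space M. f x \<le> m + 1 / real (Suc k)}) = {x\<in>space M. f x \<le> m}"
        using LIMSEQ_le_const[OF lim0(1)] by (auto intro: add_increasing2)
      finally show "measure M (space M) / 2 \<le> measure M {x\<in>space M. f x \<le> m}"
        using up[of "m + 1 / real (Suc _)"] by (intro LIMSEQ_le_const) (auto simp: X_def W_def)
      have "(\<lambda>k. measure M {x\<in>space M. m - 1 / real (Suc k) < f x}) \<longlonglongrightarrow>
          measure M (\<Inter>k. {x\<in>space M. m - 1 / real (Suc k) < f x})"
        by (intro finite_Lim_measure_decseq decseq_SucI)
          (auto intro: le_less_trans[rotated] simp: divide_left_mono)
      also have "(\<Inter>k. {x\<in>space M. m - 1 / real (Suc k) < f x}) = {x\<in>space M. m \<le> f x}"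
      proof (intro set_eqI iffI)
        fix x assume "x \<in> (\<Inter>k. {x\<in>space M. m - 1 / real (Suc k) < f x})"
        then have x: "x \<in> space M" "\<And>k. m - 1 / real (Suc k) < f x" by blast+
        have "m \<le> f x" using LIMSEQ_le_const2[OF lim0(2)] x(2) less_imp_le by blast
        then show "x \<in> {x\<in>space M. m \<le> f x}" using x(1) by blast
      next
        fix x assume x: "x \<in> {x\<in>space M. m \<le> f x}"
        have "m - 1 / real (Suc k) < f x" for k
        proof -
          have "0 < 1 / real (Suc k)" by simp
          moreover have "m \<le> f x" using x by blast
          ultimately show ?thesis by linarith
        qed
        then show "x \<in> (\<Inter>k. {x\<in>space M. m - 1 / real (Suc k) < f x})" using x by blast
      qed
      finally have lim: "(\<lambda>k. measure M {x\<in>space M. m - 1 / real (Suc k) < f x}) \<longlonglongrightarrow>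
          measure M {x\<in>space M. m \<le> f x}" .
      have "W / 2 \<le> measure M {x\<in>space M. m - 1 / real (Suc k) < f x}" for k
      proof -
        have "measure M (space M - {x\<in>space M. f x \<le> m - 1 / real (Suc k)}) = W - measure M {x\<in>space M. f x \<le> m - 1 / real (Suc k)}"
          unfolding W_def by (intro finite_measure_compl) auto
        moreover have "space M - {x\<in>space M. f x \<le> m - 1 / real (Suc k)} = {x\<in>space M. m - 1 / real (Suc k) < f x}"
          by auto
        ultimately show ?thesis using down[of "m - 1 / real (Suc k)"] by (simp add: X_def)
      qed
      then show "measure M (space M) / 2 \<le> measure M {x\<in>space M. m \<le> f x}"
        by (intro LIMSEQ_le_const[OF lim]) (auto simp: W_def)
    qed
  qed
qed

text \<open>A Borel substitute for the norm of the pointwise gradient: limits of coordinate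
  difference quotients along steps \<open>1 / Suc k\<close>, taken with \<open>lim\<close> at every
  point. The minimum with \<open>DIM('a) * L\<close> changes nothing where \<open>f\<close> is
  differentiable and makes the bound hold everywhere.\<close>

lemma borel_gradient:
  fixes f :: "'a::euclidean_space \<Rightarrow> real"
  assumes f: "L-lipschitz_on UNIV f"
  obtains G where "G \<in> borel_measurable borel" "\<And>z. 0 \<le> G z" "\<And>z. G z \<le> real DIM('a) * L"
    "AE z in lborel. \<exists>D. GDERIV f z :> D \<and> norm D = G z"
proof -
  have cf: "continuous_on UNIV f" using f by (rule lipschitz_on_continuous_on)
  have fm[measurable]: "f \<in> borel_measurable borel" using cf by (rule borel_measurable_continuous_onI)
  have L0: "0 \<le> L" using f by (rule lipschitz_on_nonneg)
  define d where "d k i z = (f (z + (1 / real (Suc k)) *\<^sub>R i) - f z) / (1 / real (Suc k))" for k and i z :: 'a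
  have [measurable]: "d k i \<in> borel_measurable borel" for k i unfolding d_def by measurable
  have d_le: "\<bar>d k i z\<bar> \<le> L" if "i \<in> Basis" for k i z
  proof -
    have "dist (f (z + (1 / real (Suc k)) *\<^sub>R i)) (f z) \<le> L * dist (z + (1 / real (Suc k)) *\<^sub>R i) z"
      by (rule lipschitz_onD[OF f UNIV_I UNIV_I])
    then have "\<bar>f (z + (1 / real (Suc k)) *\<^sub>R i) - f z\<bar> \<le> L * (1 / real (Suc k))"
      using that by (simp add: dist_norm del: of_nat_Suc)
    then show ?thesis unfolding d_def abs_divide by (simp add: pos_divide_le_eq pos_le_divide_eq del: of_nat_Suc)
  qed
  define D0 where "D0 z = (\<Sum>i\<in>Basis. lim (\<lambda>k. d k i z) *\<^sub>R i)" for z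
  define G where "G z = min (real DIM('a) * L) (norm (D0 z))" for z
  have "(\<lambda>z. lim (\<lambda>k. d k i z)) \<in> borel_measurable borel" for i
    by (rule borel_measurable_lim_metric) measurable
  then have [measurable]: "D0 \<in> borel_measurable borel" unfolding D0_def[abs_def] by measurable
  show ?thesis
  proof
    show "G \<in> borel_measurable borel" unfolding G_def by measurable
    show "AE z in lborel. \<exists>D. GDERIV f z :> D \<and> norm D = G z"
      using lipschitz_AE_GDERIV[OF f]
    proof eventually_elim
      case (elim z)
      then obtain D where D: "GDERIV f z :> D" by blast
      have lim: "(\<lambda>k. d k i z) \<longlonglongrightarrow> D \<bullet> i" if "i \<in> Basis" for i
      proof -
        have "((\<lambda>t. f (z + t *\<^sub>R i)) has_derivative (\<lambda>t. (t *\<^sub>R i) \<bullet> D)) (at 0)"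
          by (rule has_derivative_compose[of "\<lambda>t. z + t *\<^sub>R i" _ 0 UNIV])
            (use D in \<open>auto simp: gderiv_def intro!: derivative_eq_intros\<close>)
        then have "((\<lambda>t. f (z + t *\<^sub>R i)) has_real_derivative (D \<bullet> i)) (at 0)"
          by (simp add: has_field_derivative_def mult_commute_abs inner_commute)
        then have "((\<lambda>t. (f (z + t *\<^sub>R i) - f z) / t) \<longlongrightarrow> D \<bullet> i) (at 0)"
          by (simp add: DERIV_def)
        moreover have "filterlim (\<lambda>k. 1 / real (Suc k)) (at 0) sequentially"
          using LIMSEQ_inverse_real_of_nat
          by (intro filterlim_atI) (auto simp: inverse_eq_divide)
        ultimately show ?thesis unfolding d_def by (rule filterlim_compose)
      qed
      then have "D0 z = (\<Sum>i\<in>Basis. (D \<bullet> i) *\<^sub>R i)"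
        unfolding D0_def by (intro sum.cong) (auto simp: limI)
      then have D0: "D0 z = D" by (simp add: euclidean_representation)
      have "norm D \<le> (\<Sum>i\<in>Basis. \<bar>D \<bullet> i\<bar>)" by (rule norm_le_l1)
      also have "\<dots> \<le> (\<Sum>i\<in>(Basis::'a set). L)"
      proof (rule sum_mono)
        fix i :: 'a assume i: "i \<in> Basis"
        show "\<bar>D \<bullet> i\<bar> \<le> L"
          using LIMSEQ_le_const2[OF tendsto_rabs[OF lim[OF i]]] d_le[OF i] by auto
      qed
      finally have "norm D = G z" by (simp add: G_def D0)
      then show ?case using D by blast
    qed
  qed (use L0 in \<open>auto simp: G_def\<close>)
qed

section \<open>Sobolev-Poincare inequality for the weight\<close>

text \<open>The clamped function takes the value \<open>\<alpha>\<close> on at least half of the mass and \<open>\<beta>\<close> on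
  \<open>{f \<ge> \<beta>}\<close>; one of the two values is at distance at least \<open>(\<beta> - \<alpha>) / 2\<close> from its mean.\<close>

lemma clamp_weak_type:
  fixes f :: "'a::euclidean_space \<Rightarrow> real" and G w :: "'a \<Rightarrow> real"
  assumes f: "L-lipschitz_on UNIV f"
    and G[measurable]: "G \<in> borel_measurable borel" and G0: "\<And>z. 0 \<le> G z" "\<And>z. G z \<le> B"
    and fG: "AE z in lborel. \<exists>D. GDERIV f z :> D \<and> norm D \<le> G z"
    and Q: "Q = cbox a (a + l *\<^sub>R One)" and l: "0 < l" and n: "2 \<le> DIM('a)"
    and w[measurable]: "w \<in> borel_measurable borel"
    and K: "0 \<le> K" "AE z in lborel. z \<in> Q \<longrightarrow> (\<forall>r\<in>{0<..l}.
        (\<integral>\<^sup>+x\<in>Q. ennreal (w x) * of_bool (infnorm (z - x) \<le> r) \<partial>lborel) \<le> ennreal (K * r ^ DIM('a)) * ennreal (w z))"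
    and q: "(\<integral>\<^sup>+x\<in>Q. ennreal (w x) \<partial>lborel) = ennreal q" "0 < q"
    and M: "M = density lborel (\<lambda>x. ennreal (w x) * indicator Q x)"
    and med: "q / 2 \<le> measure M {x. f x \<le> 0}"
    and \<alpha>\<beta>: "0 < \<alpha>" "\<alpha> < \<beta>"
  shows "(\<beta> - \<alpha>) * measure M {x. \<beta> \<le> f x} powr (1 - 1 / DIM('a)) \<le>
     (8 * sqrt DIM('a) * l * K * q powr (- (1 / DIM('a)))) * (\<integral>x. G x * indicator {x. \<alpha> < f x \<and> f x < \<beta>} x \<partial>M)"
proof -
  define n where "n = DIM('a)"
  have n0: "0 < n" using n by (simp add: n_def)
  have [measurable]: "Q \<in> sets borel" by (simp add: Q)
  have cf: "continuous_on UNIV f" using f by (rule lipschitz_on_continuous_on)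
  have [measurable]: "f \<in> borel_measurable borel" using cf by (rule borel_measurable_continuous_onI)
  have sM[simp, measurable_cong]: "sets M = sets borel" and spM[simp]: "space M = UNIV" by (simp_all add: M)
  have em: "emeasure M E = (\<integral>\<^sup>+x\<in>E \<inter> Q. ennreal (w x) \<partial>lborel)" if [measurable]: "E \<in> sets borel" for E
    unfolding M by (subst emeasure_density) (auto intro!: nn_integral_cong simp: indicator_def)
  have "emeasure M UNIV = ennreal q" using em[of UNIV] q by simp
  then have fin: "finite_measure M" by (intro finite_measureI) simp
  interpret finite_measure M by (rule fin)
  define h where "h x = max \<alpha> (min \<beta> (f x))" for x
  define H where "H x = G x * indicator {x. \<alpha> < f x \<and> f x < \<beta>} x" for x
  have [measurable]: "H \<in> borel_measurable borel" unfolding H_def by measurable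
  have H0: "0 \<le> H x" "H x \<le> B" for x
    using G0[of x] by (auto simp: H_def indicator_def intro: order_trans)
  define I where "I = (\<integral>x. H x \<partial>M)"
  have I0: "0 \<le> I" unfolding I_def by (intro integral_nonneg_AE) (simp add: H0)
  have IM: "(\<integral>\<^sup>+x\<in>Q. ennreal (H x) * ennreal (w x) \<partial>lborel) = ennreal I"
  proof -
    have "(\<integral>\<^sup>+x\<in>Q. ennreal (H x) * ennreal (w x) \<partial>lborel) = (\<integral>\<^sup>+x. ennreal (H x) \<partial>M)"
      unfolding M by (subst nn_integral_density) (auto intro!: nn_integral_cong simp: mult_ac)
    also have "\<dots> = ennreal I"
      unfolding I_def using H0 by (intro nn_integral_eq_integral integrable_const_bound[where B=B]) auto
    finally show ?thesis .
  qed
  have lip: "L-lipschitz_on UNIV h" unfolding h_def using f by (rule lipschitz_clamp)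
  have hH: "AE z in lborel. \<exists>D. GDERIV h z :> D \<and> ennreal (norm D) \<le> ennreal (H z)"
    using lipschitz_AE_GDERIV[OF lip] fG
  proof eventually_elim
    case (elim z)
    then obtain D D' where D: "GDERIV f z :> D" "norm D \<le> G z" and D': "GDERIV h z :> D'" by blast
    have "norm D' \<le> H z"
      unfolding H_def using GDERIV_clamp_norm_le[OF D(1) D'[unfolded h_def] _ D(2)] \<alpha>\<beta> by simp
    then show ?case using D' by (auto intro!: ennreal_leI)
  qed
  \<comment> \<open>The unweighted mean of the clamped function, as in the oscillation estimate. The
    weak bound is needed only for sets on which \<open>h\<close> is far from this one
    number.\<close>
  define c where "c = (LINT y:Q|lborel. h y) / l ^ n"
  define C where "C = 2 * sqrt DIM('a) * l * K"
  have C0: "0 \<le> C" using l K(1) by (simp add: C_def)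
  have weak: "t * measure M E \<le> C * root n (measure M E / q) * I"
    if [measurable]: "E \<in> sets borel" and t: "0 \<le> t" "\<And>x. x \<in> E \<Longrightarrow> t \<le> \<bar>h x - c\<bar>" for E t
  proof (cases "measure M E = 0")
    case False
    then have e: "0 < measure M E" by (simp add: zero_less_measure_iff)
    have "ennreal (t * measure M E) \<le> ennreal (2 * sqrt DIM('a) * l * K * root DIM('a) (measure M E / q)) *
        (\<integral>\<^sup>+x\<in>Q. ennreal (H x) * ennreal (w x) \<partial>lborel)"
    proof (rule weighted_weak_type_bound[OF lip _ hH Q l n _ K q, where E="E \<inter> Q"])
      show "(\<integral>\<^sup>+x\<in>E \<inter> Q. ennreal (w x) \<partial>lborel) = ennreal (measure M E)"
        by (simp add: em[symmetric] emeasure_eq_measure)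
      show "t \<le> \<bar>h x - (LINT y:Q|lborel. h y) / l ^ DIM('a)\<bar>" if "x \<in> E \<inter> Q" for x
        using t(2)[of x] that by (simp add: c_def n_def)
    qed (use e t(1) in auto)
    also have "\<dots> = ennreal (C * root n (measure M E / q) * I)"
      unfolding IM C_def n_def using C0 I0 q(2) l K(1) by (simp flip: ennreal_mult)
    finally show ?thesis using C0 I0 q(2) n0 by (simp add: zero_le_mult_iff)
  qed simp
  define e where "e = measure M {x. \<beta> \<le> f x}"
  define z where "z = measure M {x. f x \<le> \<alpha>}"
  have eq: "e \<le> q" "z \<le> q"
  proof -
    have "measure M UNIV = q" using \<open>emeasure M UNIV = ennreal q\<close> q(2) by (simp add: measure_def)
    then show "e \<le> q" "z \<le> q" unfolding e_def z_def by (metis bounded_measure spM)+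
  qed
  have zq: "q / 2 \<le> z"
  proof -
    have "measure M {x. f x \<le> 0} \<le> z" unfolding z_def using \<alpha>\<beta>(1) by (intro finite_measure_mono) auto
    then show ?thesis using med by simp
  qed
  have e0: "0 \<le> e" by (simp add: e_def)
  have root1: "root n (x / q) \<le> 1" if "x \<le> q" for x using that q(2) n0 by simp
  have root0: "0 \<le> root n (x / q)" if "0 \<le> x" for x using that q(2) n0 by simp
  have main: "(\<beta> - \<alpha>) * e \<le> 4 * C * root n (e / q) * I"
  proof (cases "(\<beta> - \<alpha>) / 2 \<le> \<bar>\<beta> - c\<bar>")
    case True
    have "(\<beta> - \<alpha>) / 2 * e \<le> C * root n (e / q) * I"
      unfolding e_def using True \<alpha>\<beta> by (intro weak) (auto simp: h_def)
    moreover have "0 \<le> C * root n (e / q) * I" using C0 I0 root0[OF e0] by simp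
    ultimately show ?thesis by simp
  next
    case False
    then have "(\<beta> - \<alpha>) / 2 \<le> \<bar>\<alpha> - c\<bar>" using \<alpha>\<beta>(2) abs_triangle_ineq4[of "\<beta> - c" "\<alpha> - c"] by simp
    then have "(\<beta> - \<alpha>) / 2 * z \<le> C * root n (z / q) * I"
      unfolding z_def using \<alpha>\<beta> by (intro weak) (auto simp: h_def)
    also have "\<dots> \<le> C * 1 * I"
      using C0 I0 root1[OF eq(2)] by (intro mult_right_mono mult_left_mono) auto
    finally have 1: "(\<beta> - \<alpha>) * z \<le> 2 * (C * I)" by simp
    \<comment> \<open>The bound just obtained concerns the mass \<open>z\<close>, not
      \<open>e\<close>. Since \<open>e / q \<le> 1\<close> is at most its own root and
      \<open>q \<le> 2 * z\<close>, it carries over to \<open>e\<close>; this is the source of the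
      factor 4 in \<open>main\<close>, and with the 2 in \<open>C\<close> of the 8 in the
      statement.\<close>
    have "e / q \<le> root n (e / q)"
    proof -
      have "root n (e / q) ^ n \<le> root n (e / q) ^ 1"
        using root0[OF e0] root1[OF eq(1)] n0 by (intro power_decreasing) auto
      then show ?thesis using n0 e0 q(2) by (simp add: real_root_pow_pos2)
    qed
    then have "e \<le> q * root n (e / q)" using q(2) by (simp add: pos_divide_le_eq mult.commute)
    also have "\<dots> \<le> 2 * z * root n (e / q)" using zq root0[OF e0] by (intro mult_right_mono) auto
    finally have "(\<beta> - \<alpha>) * e \<le> (\<beta> - \<alpha>) * (2 * z * root n (e / q))"
      using \<alpha>\<beta> by (intro mult_left_mono) auto
    also have "\<dots> = 2 * root n (e / q) * ((\<beta> - \<alpha>) * z)" by simp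
    also have "\<dots> \<le> 2 * root n (e / q) * (2 * (C * I))" using 1 root0[OF e0] by (intro mult_left_mono) auto
    finally show ?thesis by (simp add: mult_ac)
  qed
  show ?thesis
  proof (cases "e = 0")
    case True
    then show ?thesis using C0 I0 \<alpha>\<beta> by (simp add: e_def I_def H_def C_def)
  next
    case False
    then have e: "0 < e" using e0 by simp
    have "root n (e / q) = e powr (1 / n) * q powr (- (1 / n))"
    proof -
      have "root n (e / q) = (e / q) powr (1 / n)" using e q(2) n0 by (simp add: root_powr_inverse)
      also have "\<dots> = e powr (1 / n) * q powr (- (1 / n))"
        using e q(2) by (simp add: powr_divide powr_minus_divide)
      finally show ?thesis .
    qed
    with main have "(\<beta> - \<alpha>) * e \<le> (4 * C * q powr (- (1 / n)) * I) * e powr (1 / n)" by (simp add: mult_ac)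
    then have "(\<beta> - \<alpha>) * e / e powr (1 / n) \<le> 4 * C * q powr (- (1 / n)) * I"
      using e by (simp add: pos_divide_le_eq)
    moreover have "e powr (1 - 1 / n) = e / e powr (1 / n)" using e by (simp add: powr_diff)
    ultimately show ?thesis by (simp add: e_def I_def H_def C_def n_def mult_ac)
  qed
qed

text \<open>Truncation handles the positive parts of \<open>f - m\<close> and \<open>m - f\<close>
  separately, each with at least half of the mass where it vanishes. Replacing the median by the
  weighted mean costs only a constant, because Hoelder bounds the distance of the two by the
  oscillation about \<open>m\<close>.\<close>

lemma weighted_sobolev_poincare:
  fixes f :: "'a::euclidean_space \<Rightarrow> real" and G w :: "'a \<Rightarrow> real"
  assumes f: "L-lipschitz_on UNIV f"
    and G[measurable]: "G \<in> borel_measurable borel" and G0: "\<And>z. 0 \<le> G z" "\<And>z. G z \<le> B"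
    and fG: "AE z in lborel. \<exists>D. GDERIV f z :> D \<and> norm D \<le> G z"
    and Q: "Q = cbox a (a + l *\<^sub>R One)" and l: "0 < l" and n: "2 \<le> DIM('a)"
    and w[measurable]: "w \<in> borel_measurable borel"
    and K: "0 \<le> K" "AE z in lborel. z \<in> Q \<longrightarrow> (\<forall>r\<in>{0<..l}.
        (\<integral>\<^sup>+x\<in>Q. ennreal (w x) * of_bool (infnorm (z - x) \<le> r) \<partial>lborel) \<le> ennreal (K * r ^ DIM('a)) * ennreal (w z))"
    and q: "(\<integral>\<^sup>+x\<in>Q. ennreal (w x) \<partial>lborel) = ennreal q" "0 < q"
    and M: "M = density lborel (\<lambda>x. ennreal (w x) * indicator Q x)"
    and p: "1 \<le> p" "1 / p - 1 / ps = 1 / DIM('a)" and ps: "1 \<le> ps"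
  shows "(1 / q * (\<integral>x. \<bar>f x - 1 / q * (\<integral>x. f x \<partial>M)\<bar> powr ps \<partial>M)) powr (1 / ps) \<le>
     (128 * 2 powr (ps * (1 - 1 / DIM('a))) * sqrt DIM('a)) * K * l * (1 / q * (\<integral>x. G x powr p \<partial>M)) powr (1 / p)"
proof -
  define n where "n = DIM('a)"
  have n0: "2 \<le> n" using n by (simp add: n_def)
  have Qm[measurable]: "Q \<in> sets borel" by (simp add: Q)
  have cf: "continuous_on UNIV f" using f by (rule lipschitz_on_continuous_on)
  have [measurable]: "f \<in> borel_measurable borel" using cf by (rule borel_measurable_continuous_onI)
  have sM[simp, measurable_cong]: "sets M = sets borel" and spM[simp]: "space M = UNIV" by (simp_all add: M)
  have emU: "emeasure M UNIV = ennreal q"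
    unfolding M by (subst emeasure_density) (auto simp: q(1)[symmetric] intro!: nn_integral_cong simp: indicator_def)
  then have fin: "finite_measure M" by (intro finite_measureI) simp
  interpret finite_measure M by (rule fin)
  have mU: "measure M UNIV = q" using emU q(2) by (simp add: measure_def)
  have AEQ: "AE x in M. x \<in> Q"
    unfolding M by (subst AE_density) (auto simp: indicator_def)
  have "compact (f ` Q)" unfolding Q by (intro compact_continuous_image continuous_on_subset[OF cf]) auto
  then obtain C0 where C0: "\<And>x. x \<in> Q \<Longrightarrow> \<bar>f x\<bar> \<le> C0"
    using compact_imp_bounded bounded_iff by (metis imageI real_norm_def)
  obtain m where m: "q / 2 \<le> measure M {x. f x \<le> m}" "q / 2 \<le> measure M {x. m \<le> f x}"
  proof (rule median_exists[of f C0])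
    show "AE x in M. \<bar>f x\<bar> \<le> C0" using AEQ by eventually_elim (rule C0)
  qed (auto simp: mU)
  define \<Lambda> where "\<Lambda> = \<bar>C0\<bar> + \<bar>m\<bar> + 1"
  have \<Lambda>: "0 < \<Lambda>" and fm: "AE x in M. \<bar>f x - m\<bar> \<le> \<Lambda>"
  proof -
    show "0 < \<Lambda>" by (simp add: \<Lambda>_def)
    show "AE x in M. \<bar>f x - m\<bar> \<le> \<Lambda>" using AEQ
    proof eventually_elim
      case (elim x) then show ?case using C0[of x] by (auto simp: \<Lambda>_def)
    qed
  qed
  define A where "A = 8 * sqrt DIM('a) * l * K * q powr (- (1 / DIM('a)))"
  have A0: "0 \<le> A" using l K(1) by (simp add: A_def)
  define R where "R = 2 * 2 powr (ps * (1 - 1 / n)) * A * (\<integral>x. G x powr p \<partial>M) powr (1 / p)"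
  have R0: "0 \<le> R" using A0 by (simp add: R_def)
  have p': "1 / p - 1 / ps = 1 / real n" using p(2) by (simp add: n_def)
  have strong: "(\<integral>x. max (u x) 0 powr ps \<partial>M) \<le> R powr ps"
    if u: "L-lipschitz_on UNIV u" "AE z in lborel. \<exists>D. GDERIV u z :> D \<and> norm D \<le> G z"
      "q / 2 \<le> measure M {x. u x \<le> 0}" "AE x in M. u x \<le> \<Lambda>" for u
  proof -
    have "continuous_on UNIV u" using u(1) by (rule lipschitz_on_continuous_on)
    then have [measurable]: "u \<in> borel_measurable borel" by (rule borel_measurable_continuous_onI)
    show ?thesis
      unfolding R_def
    proof (rule truncation_strong_type[OF _ u(4) \<Lambda> _ G0 p(1) _ p' _ A0])
      fix \<alpha> \<beta> :: real assume \<alpha>\<beta>: "0 < \<alpha>" "\<alpha> < \<beta>"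
      show "(\<beta> - \<alpha>) * measure M {x\<in>space M. \<beta> \<le> u x} powr (1 - 1 / real n) \<le>
          A * (\<integral>x. G x * indicator {x\<in>space M. \<alpha> < u x \<and> u x < \<beta>} x \<partial>M)"
        using clamp_weak_type[OF u(1) G G0 u(2) Q l n w K q M u(3) \<alpha>\<beta>] by (simp add: A_def n_def)
    qed (use ps n0 in auto)
  qed
  have lipm: "L-lipschitz_on UNIV (\<lambda>x. f x - m)" "L-lipschitz_on UNIV (\<lambda>x. m - f x)"
    using f by (auto simp: lipschitz_on_def dist_real_def abs_minus_commute)
  have gm: "AE z in lborel. \<exists>D. GDERIV (\<lambda>x. f x - m) z :> D \<and> norm D \<le> G z"
    "AE z in lborel. \<exists>D. GDERIV (\<lambda>x. m - f x) z :> D \<and> norm D \<le> G z"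
  proof -
    show "AE z in lborel. \<exists>D. GDERIV (\<lambda>x. f x - m) z :> D \<and> norm D \<le> G z" using fG
    proof eventually_elim
      case (elim z)
      then obtain D where "GDERIV f z :> D" "norm D \<le> G z" by blast
      then show ?case using GDERIV_diff[OF _ GDERIV_const, of f z D m] by auto
    qed
    show "AE z in lborel. \<exists>D. GDERIV (\<lambda>x. m - f x) z :> D \<and> norm D \<le> G z" using fG
    proof eventually_elim
      case (elim z)
      then obtain D where "GDERIV f z :> D" "norm D \<le> G z" by blast
      then show ?case using GDERIV_diff[OF GDERIV_const, of f z D m] by (intro exI[of _ "- D"]) auto
    qed
  qed
  have s1: "(\<integral>x. max (f x - m) 0 powr ps \<partial>M) \<le> R powr ps"
    using fm m by (intro strong lipm gm) (auto elim: eventually_mono)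
  have s2: "(\<integral>x. max (m - f x) 0 powr ps \<partial>M) \<le> R powr ps"
    using fm m by (intro strong lipm gm) (auto elim: eventually_mono)
  have bd: "integrable M (\<lambda>x. max (f x - m) 0 powr ps)" "integrable M (\<lambda>x. max (m - f x) 0 powr ps)"
    "integrable M (\<lambda>x. \<bar>f x - m\<bar> powr ps)"
  proof -
    have bnd: "integrable M (\<lambda>x. u x powr ps)"
      if [measurable]: "u \<in> borel_measurable borel" and u: "AE x in M. 0 \<le> u x \<and> u x \<le> \<Lambda>" for u
    proof (rule integrable_const_bound)
      show "AE x in M. norm (u x powr ps) \<le> \<Lambda> powr ps"
        using u by eventually_elim (use ps in \<open>auto intro!: powr_mono2\<close>)
    qed measurable
    show "integrable M (\<lambda>x. max (f x - m) 0 powr ps)"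
      by (rule bnd, measurable) (rule eventually_mono[OF fm], use \<Lambda> in auto)
    show "integrable M (\<lambda>x. max (m - f x) 0 powr ps)"
      by (rule bnd, measurable) (rule eventually_mono[OF fm], use \<Lambda> in auto)
    show "integrable M (\<lambda>x. \<bar>f x - m\<bar> powr ps)"
      by (rule bnd, measurable) (rule eventually_mono[OF fm], use \<Lambda> in auto)
  qed
  define J where "J = (\<integral>x. \<bar>f x - m\<bar> powr ps \<partial>M)"
  have J0: "0 \<le> J" unfolding J_def by (intro integral_nonneg_AE) auto
  have "J \<le> (\<integral>x. max (f x - m) 0 powr ps + max (m - f x) 0 powr ps \<partial>M)"
    unfolding J_def using bd by (intro integral_mono) (auto simp: max_def)
  then have JR: "J \<le> 2 * R powr ps" using s1 s2 bd by simp
  define c where "c = 1 / q * (\<integral>x. f x \<partial>M)"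
  have fint: "integrable M f" "integrable M (\<lambda>x. \<bar>f x - m\<bar>)"
  proof -
    show "integrable M f"
      by (rule integrable_const_bound[where B=C0], rule eventually_mono[OF AEQ]) (use C0 in auto)
    show "integrable M (\<lambda>x. \<bar>f x - m\<bar>)"
      by (rule integrable_const_bound[where B=\<Lambda>], rule eventually_mono[OF fm]) auto
  qed
  have cm: "q * \<bar>m - c\<bar> powr ps \<le> J"
  proof -
    \<comment> \<open>Cut off at \<Lambda> because \<open>integral_le_Holder\<close> demands a bound
      at every point, whereas \<open>fm\<close> gives one only almost everywhere.\<close>
    define v where "v x = min \<Lambda> \<bar>f x - m\<bar>" for x
    have [measurable]: "v \<in> borel_measurable borel" unfolding v_def by measurable
    have vf: "AE x in M. v x = \<bar>f x - m\<bar>" using fm by eventually_elim (simp add: v_def)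
    have "(\<integral>x. f x - m \<partial>M) = q * (c - m)"
      using fint q(2) by (simp add: c_def mU right_diff_distrib)
    then have "q * \<bar>m - c\<bar> = \<bar>\<integral>x. f x - m \<partial>M\<bar>"
      using q(2) by (simp add: abs_mult abs_minus_commute)
    also have "\<dots> \<le> (\<integral>x. \<bar>f x - m\<bar> \<partial>M)" by (rule integral_abs_bound)
    also have "\<dots> = (\<integral>x. v x * indicator UNIV x \<partial>M)"
      using vf by (intro integral_cong_AE) auto
    also have "\<dots> \<le> (\<integral>x. v x powr ps * indicator UNIV x \<partial>M) powr (1 / ps) * measure M UNIV powr (1 - 1 / ps)"
      using \<Lambda> ps by (intro integral_le_Holder[where B=\<Lambda>]) (auto simp: v_def)
    also have "(\<integral>x. v x powr ps * indicator UNIV x \<partial>M) = J"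
      unfolding J_def by (intro integral_cong_AE) (use vf in \<open>auto elim: eventually_mono\<close>)
    finally have "(q * \<bar>m - c\<bar>) powr ps \<le> (J powr (1 / ps) * q powr (1 - 1 / ps)) powr ps"
      using q(2) ps by (intro powr_mono2) (auto simp: mU)
    also have "\<dots> = J * q powr (ps - 1)"
    proof -
      have "(1 - 1 / ps) * ps = ps - 1" using ps by (simp add: left_diff_distrib)
      then show ?thesis using q(2) ps J0 by (simp add: powr_mult powr_powr)
    qed
    also have "q powr (ps - 1) = q powr ps / q" using q(2) by (simp add: powr_diff)
    finally have "q powr ps * \<bar>m - c\<bar> powr ps \<le> J * (q powr ps / q)" using q(2) by (simp add: powr_mult)
    then show ?thesis using q(2) by (simp add: field_simps)
  qed
  \<comment> \<open>The two errors add up to at most \<open>4 * R powr ps\<close>, and the triangle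
    inequality costs \<open>2 powr ps\<close>, giving the factor 8. The 128 in the statement is this
    8 times the 2 in \<open>R\<close> times the 8 in \<open>A\<close>.\<close>
  have "(\<integral>x. \<bar>f x - c\<bar> powr ps \<partial>M) \<le> (\<integral>x. 2 powr ps * (\<bar>f x - m\<bar> powr ps + \<bar>m - c\<bar> powr ps) \<partial>M)"
  proof (rule integral_mono')
    fix x
    have "\<bar>f x - c\<bar> \<le> 2 * max \<bar>f x - m\<bar> \<bar>m - c\<bar>"
      using abs_triangle_ineq[of "f x - m" "m - c"] by (simp add: max_def)
    then have "\<bar>f x - c\<bar> powr ps \<le> (2 * max \<bar>f x - m\<bar> \<bar>m - c\<bar>) powr ps"
      using ps by (intro powr_mono2) auto
    also have "\<dots> = 2 powr ps * max \<bar>f x - m\<bar> \<bar>m - c\<bar> powr ps" by (simp add: powr_mult)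
    also have "\<dots> \<le> 2 powr ps * (\<bar>f x - m\<bar> powr ps + \<bar>m - c\<bar> powr ps)"
      by (intro mult_left_mono) (auto simp: max_def)
    finally show "\<bar>f x - c\<bar> powr ps \<le> 2 powr ps * (\<bar>f x - m\<bar> powr ps + \<bar>m - c\<bar> powr ps)" .
  qed (use bd in auto)
  also have "\<dots> = 2 powr ps * (J + q * \<bar>m - c\<bar> powr ps)"
    using bd by (simp add: J_def mU)
  also have "\<dots> \<le> 2 powr ps * (4 * R powr ps)" using cm JR by (intro mult_left_mono) auto
  also have "\<dots> \<le> 2 powr ps * (4 powr ps * R powr ps)"
    using ps powr_mono[of 1 ps 4] by (intro mult_left_mono mult_right_mono) auto
  also have "\<dots> = (8 * R) powr ps" using R0 by (simp add: powr_mult[symmetric])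
  finally have fin: "(\<integral>x. \<bar>f x - c\<bar> powr ps \<partial>M) \<le> (8 * R) powr ps" .
  have "(1 / q * (\<integral>x. \<bar>f x - c\<bar> powr ps \<partial>M)) powr (1 / ps) \<le> (1 / q * (8 * R) powr ps) powr (1 / ps)"
    using q(2) ps fin by (intro powr_mono2 mult_left_mono mult_nonneg_nonneg integral_nonneg_AE) auto
  also have "\<dots> = 8 * R * q powr (- (1 / ps))"
    using q(2) ps R0 by (simp add: powr_mult powr_powr powr_minus_divide powr_divide)
  also have "\<dots> = 128 * 2 powr (ps * (1 - 1 / n)) * sqrt DIM('a) * K * l *
      (q powr (- (1 / n)) * q powr (- (1 / ps)) * (\<integral>x. G x powr p \<partial>M) powr (1 / p))"
    by (simp add: R_def A_def n_def)
  \<comment> \<open>Scale invariance: the powers of the mass from the weak estimate and from the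
    left average combine into precisely the normalisation of the right average.\<close>
  also have "q powr (- (1 / n)) * q powr (- (1 / ps)) = q powr (- (1 / p))"
  proof -
    have "- (1 / real n) + - (1 / ps) = - (1 / p)" using p' by simp
    then show ?thesis by (simp flip: powr_add)
  qed
  also have "q powr (- (1 / p)) * (\<integral>x. G x powr p \<partial>M) powr (1 / p) = (1 / q * (\<integral>x. G x powr p \<partial>M)) powr (1 / p)"
    using q(2) by (simp add: powr_mult powr_minus_divide powr_divide integral_nonneg_AE)
  finally show ?thesis by (simp add: c_def n_def mult_ac)
qed

section \<open>Weights in \<open>A\<^sub>1\<close>\<close>

lemma cube_eq_cbox_One:
  fixes a :: "real ^ 'n"
  shows "cube a l = cbox a (a + l *\<^sub>R One)"
proof -
  have "(One :: real ^ 'n) $ i = 1" for i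
    by (simp add: cart_eq_inner_axis axis_in_Basis_iff inner_sum_left_Basis)
  then show ?thesis by (simp add: cube_def vec_eq_iff plus_vec_def)
qed

lemma mem_cube_iff: "x \<in> cube a l \<longleftrightarrow> (\<forall>i. a $ i \<le> x $ i \<and> x $ i \<le> a $ i + l)"
  by (simp add: cube_def mem_box_cart)

lemma sets_cube [measurable]: "cube a l \<in> sets borel"
  by (simp add: cube_def)

lemma measure_cube:
  fixes a :: "real ^ 'n"
  assumes "0 \<le> l"
  shows "measure lborel (cube a l) = l ^ CARD('n)"
proof -
  have "a \<in> cube a l" using assms by (simp add: mem_cube_iff)
  then have "measure lborel (cube a l) = (\<Prod>i\<in>(UNIV::'n set). l)"
    unfolding cube_def by (subst content_cbox_cart) auto
  then show ?thesis by simp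
qed

lemma weight_borel_measurable:
  fixes w :: "real ^ 'n \<Rightarrow> real"
  assumes w: "weight w"
  shows "w \<in> borel_measurable lebesgue"
proof (rule borel_measurable_LIMSEQ_real)
  fix k :: nat
  show "(\<lambda>x. indicator (cball 0 (real k)) x *\<^sub>R w x) \<in> borel_measurable lebesgue"
    using w unfolding weight_def set_integrable_def by (intro borel_measurable_integrable) simp
next
  fix x :: "real ^ 'n"
  obtain N where N: "norm x \<le> real N" using real_arch_simple by blast
  have "\<forall>\<^sub>F k in sequentially. indicator (cball 0 (real k)) x *\<^sub>R w x = w x"
    using eventually_ge_at_top[of N] by eventually_elim (use N in \<open>auto simp: indicator_def\<close>)
  then show "(\<lambda>k. indicator (cball 0 (real k)) x *\<^sub>R w x) \<longlonglongrightarrow> w x" by (rule tendsto_eventually)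
qed

text \<open>Weights are only Lebesgue measurable, while the Fubini arguments run over
  \<open>lborel\<close>; a Borel representative that is nonnegative everywhere bridges the
  two.\<close>

lemma weight_borel_version:
  fixes w :: "real ^ 'n \<Rightarrow> real"
  assumes w: "weight w"
  obtains w' where "w' \<in> borel_measurable borel" "\<And>x. 0 \<le> w' x" "AE x in lborel. w x = w' x"
proof -
  obtain v where v: "v \<in> borel_measurable lborel" "AE x in lborel. w x = v x"
    using completion_ex_borel_measurable_real[OF weight_borel_measurable[OF w]] by blast
  show ?thesis
  proof
    show "(\<lambda>x. max 0 (v x)) \<in> borel_measurable borel" using v(1) by simp
    show "AE x in lborel. w x = max 0 (v x)"
      using v(2)
    proof eventually_elim
      case (elim x)
      have "0 \<le> w x" using w by (simp add: weight_def)
      then show ?case using elim by simp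
    qed
  qed simp
qed

lemma nn_integral_weight_cube:
  assumes w: "weight w" and w': "w' \<in> borel_measurable borel" "\<And>x. 0 \<le> w' x" "AE x in lborel. w x = w' x"
  shows "(\<integral>\<^sup>+x\<in>cube a l. ennreal (w' x) \<partial>lborel) = ennreal (wmass w (cube a l))"
proof -
  have "(\<integral>\<^sup>+x\<in>cube a l. ennreal (w' x) \<partial>lborel) = (\<integral>\<^sup>+x. ennreal (indicator (cube a l) x *\<^sub>R w x) \<partial>lborel)"
    by (rule nn_integral_cong_AE, use w'(3) in eventually_elim) (simp add: indicator_def)
  also have "\<dots> = (\<integral>\<^sup>+x. ennreal (indicator (cube a l) x *\<^sub>R w x) \<partial>lebesgue)"
    by (simp add: nn_integral_completion)
  also have "\<dots> = ennreal (LINT x|lebesgue. indicator (cube a l) x *\<^sub>R w x)"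
  proof (rule nn_integral_eq_integral)
    show "integrable lebesgue (\<lambda>x. indicator (cube a l) x *\<^sub>R w x)"
      using w unfolding weight_def set_integrable_def by (simp add: cube_def)
    show "AE x in lebesgue. 0 \<le> indicator (cube a l) x *\<^sub>R w x"
      using w by (auto simp: weight_def)
  qed
  finally show ?thesis by (simp add: wmass_def set_lebesgue_integral_def)
qed

lemma wmass_nonneg: "weight w \<Longrightarrow> 0 \<le> wmass w X"
  unfolding wmass_def set_lebesgue_integral_def by (intro integral_nonneg_AE) (auto simp: weight_def)

text \<open>The usual pointwise form of the condition, obtained by unfolding the essential supremum
  of the reciprocal; the null set still depends on the cube.\<close>

lemma A1_AE_cube:
  fixes w :: "real ^ 'n \<Rightarrow> real"
  assumes w: "w \<in> A1" and l: "0 < l"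
  shows "AE x in lborel. x \<in> cube a l \<longrightarrow> wmass w (cube a l) \<le> enn2real (A1_const w) * l ^ CARD('n) * w x"
proof -
  define A where "A = enn2real (A1_const w)"
  have Aeq: "A1_const w = ennreal A" using w by (simp add: A1_def A_def less_top)
  have A0: "0 \<le> A" by (simp add: A_def)
  have wt: "weight w" using w by (simp add: A1_def)
  define m where "m = wmass w (cube a l)"
  have m0: "0 \<le> m" unfolding m_def using wt by (rule wmass_nonneg)
  define v where "v = l ^ CARD('n)"
  have v: "0 < v" using l by (simp add: v_def)
  define es where "es = esssup (lebesgue_on (cube a l)) (\<lambda>x. inverse (ennreal (w x)))"
  have le: "ennreal (1 / v * m) * es \<le> ennreal A"
    unfolding Aeq[symmetric] A1_const_def es_def m_def v_def
    using l by (intro SUP_upper2[of "(a, l)"]) (auto simp: measure_cube)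
  have "AE x in lebesgue_on (cube a l). inverse (ennreal (w x)) \<le> es"
    unfolding es_def by (rule esssup_AE)
  then have "AE x in lebesgue. x \<in> cube a l \<longrightarrow> inverse (ennreal (w x)) \<le> es"
    by (subst (asm) AE_restrict_space_iff) auto
  then have "AE x in lborel. x \<in> cube a l \<longrightarrow> inverse (ennreal (w x)) \<le> es"
    by (simp add: AE_completion_iff)
  then show ?thesis
  proof (eventually_elim, intro impI)
    fix x assume "x \<in> cube a l \<longrightarrow> inverse (ennreal (w x)) \<le> es" "x \<in> cube a l"
    then have "ennreal (1 / v * m) * inverse (ennreal (w x)) \<le> ennreal (1 / v * m) * es"
      by (intro mult_left_mono) auto
    then have *: "ennreal (1 / v * m) * inverse (ennreal (w x)) \<le> ennreal A" using le by (rule order_trans)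
    have "m \<le> A * v * w x"
    proof (cases "w x = 0")
      \<comment> \<open>Here the reciprocal is infinite, so a finite product forces the mass of the
        cube to be 0.\<close>
      case True
      then have "ennreal (1 / v * m) * \<infinity> \<le> ennreal A" using * by simp
      have "m = 0"
      proof (rule ccontr)
        assume "m \<noteq> 0"
        then have "0 < 1 / v * m" using m0 v by simp
        then have "ennreal (1 / v * m) * \<infinity> = \<infinity>" by (auto simp: ennreal_mult_top)
        then show False using \<open>ennreal (1 / v * m) * \<infinity> \<le> ennreal A\<close> by (simp add: top_unique)
      qed
      then show ?thesis using v True by simp
    next
      case False
      then have wx: "0 < w x" using wt by (simp add: weight_def less_le)
      then have "ennreal (1 / v * m * inverse (w x)) \<le> ennreal A"
        using * m0 v by (simp add: inverse_ennreal flip: ennreal_mult)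
      then have "1 / v * m * inverse (w x) \<le> A" using A0 by simp
      then show ?thesis using wx v by (simp add: field_simps)
    qed
    then show "wmass w (cube a l) \<le> enn2real (A1_const w) * l ^ CARD('n) * w x"
      by (simp add: m_def A_def v_def)
  qed
qed

text \<open>The exceptional null set must not depend on the cube, so cubes are enlarged to cubes with
  rational data; this costs the factor \<open>3\<^sup>n\<close>.\<close>

lemma A1_AE_all_neighbourhoods:
  fixes w :: "real ^ 'n \<Rightarrow> real"
  assumes w: "w \<in> A1" and w': "w' \<in> borel_measurable borel" "\<And>x. 0 \<le> w' x" "AE x in lborel. w x = w' x"
  shows "AE z in lborel. z \<in> Q \<longrightarrow> (\<forall>r\<in>{0<..l}.
      (\<integral>\<^sup>+x\<in>Q. ennreal (w' x) * of_bool (infnorm (z - x) \<le> r) \<partial>lborel)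
        \<le> ennreal (3 ^ CARD('n) * enn2real (A1_const w) * r ^ DIM(real ^ 'n)) * ennreal (w' z))"
proof -
  have wt: "weight w" using w by (simp add: A1_def)
  define A where "A = enn2real (A1_const w)"
  have A0: "0 \<le> A" by (simp add: A_def)
  define b where "b c = (\<chi> i. real_of_rat (c i)) " for c :: "'n \<Rightarrow> rat"
  have "AE z in lborel. \<forall>c. \<forall>s::rat. 0 < s \<longrightarrow> z \<in> cube (b c) (of_rat s) \<longrightarrow>
      wmass w (cube (b c) (of_rat s)) \<le> A * of_rat s ^ CARD('n) * w z"
    unfolding AE_all_countable A_def using A1_AE_cube[OF w] by (auto intro: AE_I2)
  then show ?thesis
    using w'(3)
  proof (eventually_elim, intro impI ballI)
    fix z r
    assume all: "\<forall>c. \<forall>s::rat. 0 < s \<longrightarrow> z \<in> cube (b c) (of_rat s) \<longrightarrow>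
      wmass w (cube (b c) (of_rat s)) \<le> A * of_rat s ^ CARD('n) * w z"
      and wz: "w z = w' z" and r: "r \<in> {0<..l}"
    have r0: "0 < r" using r by simp
    \<comment> \<open>Corner in \<open>(z - 3r/2, z - r)\<close> and side in
      \<open>(5r/2, 3r)\<close>: the upper face lies beyond \<open>z + r\<close>, so the rational
      cube contains the sup-norm ball of radius \<open>r\<close>, and its side is below
      \<open>3 * r\<close>.\<close>
    have "\<exists>c::rat. z $ i - 3 / 2 * r < of_rat c \<and> of_rat c < z $ i - r" for i
      using of_rat_dense[of "z $ i - 3 / 2 * r" "z $ i - r"] r0 by auto
    then obtain c :: "'n \<Rightarrow> rat" where c: "\<And>i. z $ i - 3 / 2 * r < of_rat (c i)" "\<And>i. of_rat (c i) < z $ i - r"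
      by metis
    obtain s :: rat where s: "5 / 2 * r < of_rat s" "of_rat s < 3 * r"
      using of_rat_dense[of "5 / 2 * r" "3 * r"] r0 by auto
    have s0: "0 < s" using s(1) r0 by (metis of_rat_less_0_iff of_rat_0 less_trans zero_less_mult_iff
        zero_less_divide_iff zero_less_numeral zero_less_of_rat_iff)
    have sub: "x \<in> cube (b c) (of_rat s)" if "infnorm (z - x) \<le> r" for x
      unfolding mem_cube_iff
    proof
      fix i
      have "\<bar>z $ i - x $ i\<bar> \<le> r" using component_le_infnorm_cart[of "z - x" i] that by simp
      then show "b c $ i \<le> x $ i \<and> x $ i \<le> b c $ i + of_rat s"
        using c(1)[of i] c(2)[of i] s(1) by (auto simp: b_def)
    qed
    have "(\<integral>\<^sup>+x\<in>Q. ennreal (w' x) * of_bool (infnorm (z - x) \<le> r) \<partial>lborel)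
        \<le> (\<integral>\<^sup>+x\<in>cube (b c) (of_rat s). ennreal (w' x) \<partial>lborel)"
      using sub by (intro nn_integral_mono) (auto simp: indicator_def)
    also have "\<dots> = ennreal (wmass w (cube (b c) (of_rat s)))"
      by (rule nn_integral_weight_cube[OF wt w'])
    also have "\<dots> \<le> ennreal (A * of_rat s ^ CARD('n) * w z)"
      using all s0 sub[of z] r0 by (intro ennreal_leI) (auto simp: infnorm_0)
    also have "\<dots> \<le> ennreal (A * (3 * r) ^ CARD('n) * w z)"
      using s s0 A0 wt by (intro ennreal_leI mult_right_mono mult_left_mono power_mono) (auto simp: weight_def)
    also have "\<dots> = ennreal (3 ^ CARD('n) * A * r ^ DIM(real ^ 'n)) * ennreal (w' z)"
      using A0 r0 w'(2) by (simp add: wz power_mult_distrib mult_ac flip: ennreal_mult)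
    finally show "(\<integral>\<^sup>+x\<in>Q. ennreal (w' x) * of_bool (infnorm (z - x) \<le> r) \<partial>lborel)
        \<le> ennreal (3 ^ CARD('n) * enn2real (A1_const w) * r ^ DIM(real ^ 'n)) * ennreal (w' z)"
      by (simp add: A_def)
  qed
qed

text \<open>If \<open>w\<close> vanishes on one cube, the pointwise condition on any larger cube,
  read at a point of the small one, forces the mass of the larger cube to be 0. Exhausting space
  gives \<open>w = 0\<close> almost everywhere, which \<open>A1\<close> excludes.\<close>

lemma A1_wmass_pos:
  fixes w :: "real ^ 'n \<Rightarrow> real"
  assumes w: "w \<in> A1" and l: "0 < l"
  shows "0 < wmass w (cube a l)"
proof (rule ccontr)
  assume "\<not> 0 < wmass w (cube a l)"
  have wt: "weight w" using w by (simp add: A1_def)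
  then have "wmass w (cube a l) = 0" using wmass_nonneg[of w "cube a l"] \<open>\<not> 0 < _\<close> by simp
  obtain w' where w': "w' \<in> borel_measurable borel" "\<And>x. 0 \<le> w' x" "AE x in lborel. w x = w' x"
    using weight_borel_version[OF wt] by blast
  have zero: "AE x in lborel. x \<in> cube b r \<longrightarrow> w x = 0" if "wmass w (cube b r) = 0" for b r
  proof -
    have "(\<integral>\<^sup>+x. ennreal (w' x) * indicator (cube b r) x \<partial>lborel) = 0"
      using nn_integral_weight_cube[OF wt w'] that by simp
    then have "AE x in lborel. ennreal (w' x) * indicator (cube b r) x = 0"
      using w'(1) by (subst (asm) nn_integral_0_iff_AE) auto
    then show ?thesis using w'(3)
      by eventually_elim (use w'(2) in \<open>auto simp: indicator_def order_antisym split: if_splits\<close>)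
  qed
  have "wmass w (cube (a - (\<chi> i. real k)) (l + 2 * real k)) = 0" for k
  proof (rule ccontr)
    let ?C = "cube (a - (\<chi> i. real k)) (l + 2 * real k)"
    assume ne: "wmass w ?C \<noteq> 0"
    have lk: "0 < l + 2 * real k" using l by simp
    have "AE x in lborel. x \<notin> cube a l"
      using zero[OF \<open>wmass w (cube a l) = 0\<close>] A1_AE_cube[OF w lk, of "a - (\<chi> i. real k)"]
    proof eventually_elim
      case (elim x)
      show ?case
      proof
        assume x: "x \<in> cube a l"
        then have "x \<in> ?C" by (auto simp: mem_cube_iff intro: order_trans add_increasing2) (smt (verit) of_nat_0_le_iff)+
        then show False using elim x ne wmass_nonneg[OF wt, of ?C] l by auto
      qed
    qed
    then have "cube a l \<in> null_sets lborel" by (subst AE_iff_null_sets) auto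
    then have "measure lborel (cube a l) = 0" by (simp add: null_sets_def measure_def)
    then show False using l by (simp add: measure_cube)
  qed
  then have "AE x in lborel. \<forall>k::nat. x \<in> cube (a - (\<chi> i. real k)) (l + 2 * real k) \<longrightarrow> w x = 0"
    unfolding AE_all_countable using zero by blast
  then have "AE x in lborel. w x = 0"
  proof eventually_elim
    case (elim x)
    obtain k :: nat where k: "norm (x - a) \<le> real k" using real_arch_simple by blast
    have "x \<in> cube (a - (\<chi> i. real k)) (l + 2 * real k)"
      unfolding mem_cube_iff
    proof
      fix i
      have "\<bar>x $ i - a $ i\<bar> \<le> real k" using component_le_norm_cart[of "x - a" i] k by simp
      then show "(a - (\<chi> i. real k)) $ i \<le> x $ i \<and> x $ i \<le> (a - (\<chi> i. real k)) $ i + (l + 2 * real k)"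
        using l by auto
    qed
    then show ?case using elim by blast
  qed
  then have "AE x in lebesgue. w x = 0" by (simp add: AE_completion_iff)
  then show False using w by (simp add: A1_def)
qed

text \<open>Translates averages of functions known only up to null sets, such as the norm of
  \<open>gradient f\<close>, into integrals of Borel functions against the finite measure used in
  the estimates.\<close>

lemma wavg_eq_density_integral:
  fixes w :: "real ^ 'n \<Rightarrow> real"
  assumes wt: "weight w" and w': "w' \<in> borel_measurable borel" "\<And>x. 0 \<le> w' x" "AE x in lborel. w x = w' x"
    and F: "F' \<in> borel_measurable borel" "AE x in lborel. F x = F' x"
  shows "wavg w (cube a l) F = 1 / wmass w (cube a l) *
    (\<integral>x. F' x \<partial>density lborel (\<lambda>x. ennreal (w' x) * indicator (cube a l) x))"
proof -
  have [measurable]: "F' \<in> borel_measurable borel" "w' \<in> borel_measurable borel" by fact+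
  have eq: "AE x in lebesgue. indicator (cube a l) x *\<^sub>R (F' x * w' x) = indicator (cube a l) x *\<^sub>R (F x * w x)"
    unfolding AE_completion_iff using w'(3) F(2) by eventually_elim simp
  have meas': "(\<lambda>x. indicator (cube a l) x *\<^sub>R (F' x * w' x)) \<in> borel_measurable lebesgue"
    by (rule measurable_completion) measurable
  have "(LINT x:cube a l|lebesgue. F x * w x) = (LINT x|lebesgue. indicator (cube a l) x *\<^sub>R (F' x * w' x))"
    unfolding set_lebesgue_integral_def
    by (rule integral_cong_AE[OF borel_measurable_AE[OF meas' eq] meas'])
      (use eq in \<open>auto elim: eventually_mono\<close>)
  also have "\<dots> = (LINT x|lborel. indicator (cube a l) x *\<^sub>R (F' x * w' x))"
    by (rule integral_completion) measurable
  also have "\<dots> = (LINT x|lborel. (w' x * indicator (cube a l) x) *\<^sub>R F' x)"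
    by (simp add: mult_ac)
  also have "\<dots> = (\<integral>x. F' x \<partial>density lborel (\<lambda>x. ennreal (w' x * indicator (cube a l) x)))"
    by (rule integral_density[symmetric]) (auto simp: w'(2))
  also have "(\<lambda>x. ennreal (w' x * indicator (cube a l) x)) = (\<lambda>x. ennreal (w' x) * indicator (cube a l) x)"
    by (auto simp: indicator_def)
  finally show ?thesis by (simp add: wavg_def)
qed

text \<open>The general inequality with \<open>K\<close> equal to \<open>3 ^ CARD('n)\<close> times
  the \<open>A1\<close> constant. The numerical factor involves only \<open>ps\<close> and the
  dimension, which gives the uniformity over weights, functions and cubes.\<close>

lemma A1_sobolev_poincare:
  fixes w f :: "real ^ 'n \<Rightarrow> real"
  assumes n: "2 \<le> CARD('n)" and p: "1 \<le> p" "p < real CARD('n)" "1 / p - 1 / ps = 1 / real CARD('n)"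
    and w: "w \<in> A1" and f: "L-lipschitz_on UNIV f" and l: "0 < l"
  shows "wavg w (cube a l) (\<lambda>x. \<bar>f x - wavg w (cube a l) f\<bar> powr ps) powr (1 / ps)
    \<le> (128 * 2 powr (ps * (1 - 1 / CARD('n))) * sqrt CARD('n) * 3 ^ CARD('n)) * enn2real (A1_const w) * l *
      wavg w (cube a l) (\<lambda>x. norm (gradient f x) powr p) powr (1 / p)"
proof -
  have wt: "weight w" using w by (simp add: A1_def)
  obtain w' where w': "w' \<in> borel_measurable borel" "\<And>x. 0 \<le> w' x" "AE x in lborel. w x = w' x"
    using weight_borel_version[OF wt] by blast
  obtain G where G: "G \<in> borel_measurable borel" "\<And>z. 0 \<le> G z" "\<And>z. G z \<le> real DIM(real ^ 'n) * L"
    "AE z in lborel. \<exists>D. GDERIV f z :> D \<and> norm D = G z"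
    using borel_gradient[OF f] by blast
  have cf: "continuous_on UNIV f" using f by (rule lipschitz_on_continuous_on)
  have [measurable]: "f \<in> borel_measurable borel" using cf by (rule borel_measurable_continuous_onI)
  have [measurable]: "G \<in> borel_measurable borel" by fact
  define M where "M = density lborel (\<lambda>x. ennreal (w' x) * indicator (cube a l) x)"
  define q where "q = wmass w (cube a l)"
  have q: "0 < q" unfolding q_def using w l by (rule A1_wmass_pos)
  \<comment> \<open>Strictness of \<open>p < n\<close> makes \<open>1 / ps\<close> positive; this
    also rules out \<open>ps = 0\<close>, for which \<open>1 / ps = 0\<close> by convention.\<close>
  have ps: "1 \<le> ps"
  proof -
    have "1 / ps = 1 / p - 1 / real CARD('n)" using p(3) by simp
    moreover have "1 / real CARD('n) < 1 / p" using p by (intro divide_strict_left_mono) auto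
    moreover have "1 / p \<le> 1" "0 \<le> 1 / real CARD('n)" using p by auto
    ultimately have "0 < 1 / ps" "1 / ps \<le> 1" by linarith+
    then show ?thesis by (simp add: zero_less_divide_iff)
  qed
  have avg: "wavg w (cube a l) f = 1 / q * (\<integral>x. f x \<partial>M)"
    unfolding q_def M_def by (rule wavg_eq_density_integral[OF wt w']) auto
  have left: "wavg w (cube a l) (\<lambda>x. \<bar>f x - wavg w (cube a l) f\<bar> powr ps) =
      1 / q * (\<integral>x. \<bar>f x - 1 / q * (\<integral>x. f x \<partial>M)\<bar> powr ps \<partial>M)"
    unfolding avg unfolding q_def M_def by (rule wavg_eq_density_integral[OF wt w']) auto
  have right: "wavg w (cube a l) (\<lambda>x. norm (gradient f x) powr p) = 1 / q * (\<integral>x. G x powr p \<partial>M)"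
    unfolding q_def M_def
  proof (rule wavg_eq_density_integral[OF wt w'])
    show "AE x in lborel. norm (gradient f x) powr p = G x powr p"
      using G(4) by eventually_elim (auto simp: gradient_eq)
  qed measurable
  show ?thesis
    unfolding left right
  proof (rule order_trans[OF weighted_sobolev_poincare[OF f G(1-3) _ cube_eq_cbox_One[of a l] l _ w'(1) _
          A1_AE_all_neighbourhoods[OF w w', of "cube a l" l] _ q M_def p(1) _ ps]])
    show "AE z in lborel. \<exists>D. GDERIV f z :> D \<and> norm D \<le> G z"
      using G(4) by eventually_elim auto
    show "(\<integral>\<^sup>+x\<in>cube a l. ennreal (w' x) \<partial>lborel) = ennreal q"
      unfolding q_def by (rule nn_integral_weight_cube[OF wt w'])
  qed (use n p(3) in \<open>simp_all add: mult_ac\<close>)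
qed

section \<open>Sharpness\<close>

text \<open>The extremal example: mass concentrated on both sides of a slab of weight \<open>\<epsilon>\<close>, and a
  function that changes only inside the slab.\<close>

definition slab_weight :: "'n \<Rightarrow> real \<Rightarrow> real ^ 'n \<Rightarrow> real" where
  "slab_weight k \<epsilon> x = (if \<bar>x $ k\<bar> < 1 / 2 then \<epsilon> else 1)"

definition slab_ramp :: "'n \<Rightarrow> real ^ 'n \<Rightarrow> real" where
  "slab_ramp k x = max (- 1 / 2) (min (1 / 2) (x $ k))"

lemma borel_measurable_slab [measurable]:
  "slab_weight k \<epsilon> \<in> borel_measurable borel" "slab_ramp k \<in> borel_measurable borel"
  unfolding slab_weight_def[abs_def] slab_ramp_def[abs_def] by measurable

lemma set_integrable_cube_bounded:
  fixes h :: "real ^ 'n \<Rightarrow> real"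
  assumes [measurable]: "h \<in> borel_measurable borel" and h: "\<And>x. x \<in> K \<Longrightarrow> \<bar>h x\<bar> \<le> B" and K: "compact K"
  shows "set_integrable lebesgue K h"
proof -
  have [measurable]: "K \<in> sets borel" using K by (simp add: borel_compact)
  have "set_integrable lborel K h"
    unfolding set_integrable_def
  proof (rule integrableI_bounded_set_indicator[where B=B])
    show "emeasure lborel K < \<infinity>" using emeasure_bounded_finite[OF compact_imp_bounded[OF K]] by simp
  qed (use h in auto)
  then show ?thesis unfolding set_integrable_def by (simp add: integrable_completion)
qed

lemma wmass_slab_le:
  fixes a :: "real ^ 'n"
  assumes \<epsilon>: "0 < \<epsilon>" "\<epsilon> \<le> 1" and l: "0 < l"
  shows "wmass (slab_weight k \<epsilon>) (cube a l) \<le> l ^ CARD('n)"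
proof -
  have "wmass (slab_weight k \<epsilon>) (cube a l) \<le> (LINT x:cube a l|lebesgue. 1)"
    unfolding wmass_def
    by (rule set_integral_mono) (use \<epsilon> in \<open>auto intro!: set_integrable_cube_bounded[where B=1] simp: slab_weight_def cube_def\<close>)
  also have "\<dots> = l ^ CARD('n)"
    using measure_cube[of l a] l by (simp add: set_lebesgue_integral_def cube_def)
  finally show ?thesis .
qed

lemma weight_slab: "0 < \<epsilon> \<Longrightarrow> \<epsilon> \<le> 1 \<Longrightarrow> weight (slab_weight k \<epsilon>)"
  unfolding weight_def by (auto intro!: set_integrable_cube_bounded[where B=1] simp: slab_weight_def)

lemma A1_const_slab_le:
  assumes \<epsilon>: "0 < \<epsilon>" "\<epsilon> \<le> 1"
  shows "A1_const (slab_weight k \<epsilon>) \<le> ennreal (1 / \<epsilon>)"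
  unfolding A1_const_def
proof (rule SUP_least, clarify)
  fix a :: "real ^ 'a" and l :: real assume l: "0 < l"
  have "1 / measure lebesgue (cube a l) * wmass (slab_weight k \<epsilon>) (cube a l) \<le> 1"
    using wmass_slab_le[OF \<epsilon> l, of k a] measure_cube[of l a] l by (simp add: divide_le_eq)
  then have "ennreal (1 / measure lebesgue (cube a l) * wmass (slab_weight k \<epsilon>) (cube a l)) \<le> 1"
    by (simp add: ennreal_le_1)
  moreover have "esssup (lebesgue_on (cube a l)) (\<lambda>x. inverse (ennreal (slab_weight k \<epsilon> x))) \<le> ennreal (1 / \<epsilon>)"
  proof (rule esssup_I)
    show "(\<lambda>x. inverse (ennreal (slab_weight k \<epsilon> x))) \<in> borel_measurable (lebesgue_on (cube a l))"
      by (intro measurable_restrict_space1 measurable_completion) measurable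
    have "inverse (ennreal (slab_weight k \<epsilon> x)) \<le> ennreal (1 / \<epsilon>)" for x
    proof -
      have "\<epsilon> \<le> slab_weight k \<epsilon> x" using \<epsilon> by (simp add: slab_weight_def)
      then have "inverse (slab_weight k \<epsilon> x) \<le> 1 / \<epsilon>" "0 < slab_weight k \<epsilon> x"
        using \<epsilon> by (auto simp: divide_inverse le_imp_inverse_le)
      then show ?thesis by (simp add: inverse_ennreal ennreal_leI)
    qed
    then show "AE x in lebesgue_on (cube a l). inverse (ennreal (slab_weight k \<epsilon> x)) \<le> ennreal (1 / \<epsilon>)" by simp
  qed
  ultimately have "ennreal (1 / measure lebesgue (cube a l) * wmass (slab_weight k \<epsilon>) (cube a l)) *
      esssup (lebesgue_on (cube a l)) (\<lambda>x. inverse (ennreal (slab_weight k \<epsilon> x))) \<le> 1 * ennreal (1 / \<epsilon>)"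
    by (rule mult_mono) auto
  then show "ennreal (1 / measure lebesgue (cube a l) * wmass (slab_weight k \<epsilon>) (cube a l)) *
      esssup (lebesgue_on (cube a l)) (\<lambda>x. inverse (ennreal (slab_weight k \<epsilon> x))) \<le> ennreal (1 / \<epsilon>)" by simp
qed

lemma slab_in_A1:
  assumes \<epsilon>: "0 < \<epsilon>" "\<epsilon> \<le> 1"
  shows "slab_weight k \<epsilon> \<in> A1"
proof -
  have "\<not> (AE x in lebesgue. slab_weight k \<epsilon> x = 0)"
  proof
    assume "AE x in lebesgue. slab_weight k \<epsilon> x = 0"
    then have "AE x in lborel. slab_weight k \<epsilon> x = 0" by (simp add: AE_completion_iff)
    then have "AE x in (lborel :: (real ^ 'a) measure). False"
      by eventually_elim (use \<epsilon> in \<open>auto simp: slab_weight_def split: if_splits\<close>)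
    then show False
      using AE_iff_measurable[of UNIV "lborel :: (real ^ 'a) measure" "\<lambda>x. False"] by simp
  qed
  moreover have "A1_const (slab_weight k \<epsilon>) < \<infinity>"
    using A1_const_slab_le[OF \<epsilon>, of k] by (simp add: le_less_trans)
  ultimately show ?thesis using weight_slab[OF \<epsilon>] by (simp add: A1_def)
qed

text \<open>Each box has thickness 1/2 out of 2 in direction \<open>k\<close>. The values -1 and 1/2
  of \<open>t\<close> give the two outer parts of weight 1, and -1/4 gives a box inside the
  slab.\<close>

lemma measure_slab_box:
  fixes k :: "'n::finite"
  assumes "t \<in> {-1, -1/4, 1/2}"
  shows "measure lborel (cbox (\<chi> i. if i = k then t else - 1) (\<chi> i. if i = k then t + 1 / 2 else 1) :: (real ^ 'n) set)
    = 2 ^ CARD('n) / 4"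
proof -
  have "(\<chi> i. if i = k then t else - 1) \<in> cbox (\<chi> i. if i = k then t else - 1) (\<chi> i. if i = k then t + 1 / 2 else 1)"
    by (auto simp: mem_box_cart)
  then have "measure lborel (cbox (\<chi> i. if i = k then t else - 1) (\<chi> i. if i = k then t + 1 / 2 else 1) :: (real ^ 'n) set)
      = (\<Prod>i\<in>UNIV. (if i = k then t + 1 / 2 else 1) - (if i = k then t else - 1))"
    by (subst content_cbox_cart) auto
  also have "\<dots> = (\<Prod>i\<in>(UNIV::'n set). 2 * (if i = k then 1 / 4 else 1))"
    by (intro prod.cong) auto
  also have "\<dots> = 2 ^ CARD('n) / 4" by (simp add: prod.distrib prod.delta)
  finally show ?thesis .
qed

text \<open>The ramp is a clamped coordinate function, whose gradient is a unit vector, so the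
  clamping estimate applies. At points without derivative the default value 0 is harmless, hence the
  bound holds at every point.\<close>

lemma slab_norm_gradient_le:
  fixes k :: "'n::finite"
  shows "norm (gradient (slab_ramp k) x) \<le> indicator {x. \<bar>x $ k\<bar> < 1 / 2} x"
proof (cases "\<exists>D. GDERIV (slab_ramp k) x :> D")
  case True
  then obtain D where D: "GDERIV (slab_ramp k) x :> D" by blast
  have "GDERIV (\<lambda>x. x $ k) x :> axis k 1"
    unfolding gderiv_def by (simp add: inner_axis) (intro bounded_linear_imp_has_derivative bounded_linear_vec_nth)
  from GDERIV_clamp_norm_le[OF this D[unfolded slab_ramp_def], of 1]
  have "norm D \<le> indicator {x. - 1 / 2 < x $ k \<and> x $ k < 1 / 2} x" by simp
  also have "{x :: real ^ 'n. - 1 / 2 < x $ k \<and> x $ k < 1 / 2} = {x. \<bar>x $ k\<bar> < 1 / 2}" by auto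
  finally show ?thesis using gradient_eq[OF D] by simp
qed (simp add: gradient_def)

lemma slab_lipschitz: "1-lipschitz_on UNIV (slab_ramp k)"
  unfolding slab_ramp_def
proof (rule lipschitz_clamp)
  show "1-lipschitz_on UNIV (\<lambda>x. x $ k)"
    by (rule lipschitz_onI) (auto simp: dist_vec_nth_le)
qed

text \<open>The ramp equals -1/2 and 1/2 on the two outer boxes, each a quarter of the cube with
  weight 1, so every constant \<open>c\<close> is at distance at least 1/2 from one of these values.
  The gradient lives only where the weight is \<epsilon>, while the mass of the cube is at least a
  quarter of its volume.\<close>

lemma slab_lower_bound:
  fixes k :: "'n::finite"
  assumes \<epsilon>: "0 < \<epsilon>" "\<epsilon> \<le> 1" and Q: "Q = cube (\<chi> i. - 1) 2" and s: "1 \<le> s" and w: "w = slab_weight k \<epsilon>"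
    and f: "f = slab_ramp k"
  shows "1 / (4 * \<epsilon>) \<le> enn2real (A1_const w)"
    and "1 / 8 \<le> wavg w Q (\<lambda>x. \<bar>f x - c\<bar> powr s) powr (1 / s)"
    and "wavg w Q (\<lambda>x. norm (gradient f x)) \<le> 4 * \<epsilon>"
proof -
  define V where "V = (2::real) ^ CARD('n)"
  have V: "0 < V" by (simp add: V_def)
  define P where "P t = (cbox (\<chi> i. if i = k then t else - 1) (\<chi> i. if i = k then t + 1 / 2 else 1) :: (real ^ 'n) set)" for t
  have [measurable]: "P t \<in> sets borel" "Q \<in> sets borel" for t by (simp_all add: P_def Q)
  have PQ: "P t \<subseteq> Q" if "t \<in> {-1, -1/4, 1/2}" for t
  proof
    fix x assume x: "x \<in> P t"
    show "x \<in> Q" unfolding Q mem_cube_iff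
    proof
      fix i
      have "(if i = k then t else - 1) \<le> x $ i" "x $ i \<le> (if i = k then t + 1 / 2 else 1)"
        using x by (simp_all add: P_def mem_box_cart)
      then show "(\<chi> i. - 1) $ i \<le> x $ i \<and> x $ i \<le> (\<chi> i. - 1) $ i + 2" using that by (auto split: if_splits)
    qed
  qed
  have Pk: "t \<le> x $ k \<and> x $ k \<le> t + 1 / 2" if "x \<in> P t" for x t
    using that unfolding P_def mem_box_cart by (auto dest!: spec[of _ k])
  have mP: "measure lborel (P t) = V / 4" if "t \<in> {-1, -1/4, 1/2}" for t
    using measure_slab_box[OF that, of k] by (simp add: P_def V_def)
  have mQ: "measure lborel Q = V" using measure_cube[of 2 "\<chi> i. - 1 :: real ^ 'n"] by (simp add: Q V_def)
  have cQ: "compact Q" by (simp add: Q cube_def)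
  have w01: "0 < w x" "w x \<le> 1" for x using \<epsilon> by (auto simp: w slab_weight_def)
  have [measurable]: "w \<in> borel_measurable borel" "f \<in> borel_measurable borel" by (simp_all add: w f)
  have intP: "integrable lebesgue (\<lambda>x. indicator (P t) x * r)" for t r :: real
    by (intro integrable_mult_left integrable_real_indicator) (use emeasure_bounded_finite[OF bounded_cbox] in \<open>auto simp: P_def\<close>)
  have lint: "y * (V / 4) \<le> (LINT x:Q|lebesgue. h x * w x)"
    if [measurable]: "h \<in> borel_measurable borel" and h: "\<And>x. 0 \<le> h x" "\<And>x. h x \<le> B" and t: "t \<in> {-1, 1/2}"
      and y: "0 \<le> y" "\<And>x. x \<in> P t \<Longrightarrow> y \<le> h x" for h :: "real ^ 'n \<Rightarrow> real" and B t y
  proof -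
    have "y * (V / 4) = (LINT x|lebesgue. indicator (P t) x * y)"
      using mP[of t] t by auto
    also have "\<dots> \<le> (LINT x:Q|lebesgue. h x * w x)"
      unfolding set_lebesgue_integral_def
    proof (rule integral_mono[OF intP])
      have "set_integrable lebesgue Q (\<lambda>x. h x * w x)"
      proof (rule set_integrable_cube_bounded[where B=B])
        show "\<bar>h x * w x\<bar> \<le> B" for x
          using h[of x] w01[of x] mult_mono[of "h x" B "w x" 1] by (simp add: abs_mult)
      qed (use cQ in auto)
      then show "integrable lebesgue (\<lambda>x. indicator Q x *\<^sub>R (h x * w x))" by (simp add: set_integrable_def)
      fix x
      show "indicator (P t) x * y \<le> indicator Q x *\<^sub>R (h x * w x)"
      proof (cases "x \<in> P t")
        case True
        then have "w x = 1" using Pk[OF True] t by (auto simp: w slab_weight_def)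
        moreover have "x \<in> Q" using True PQ[of t] t by blast
          ultimately show ?thesis using True y(2)[OF True] by simp
      next
        case False
        then show ?thesis using h(1)[of x] w01[of x] by simp
      qed
    qed
    finally show ?thesis .
  qed
  have mass_ge: "V / 4 \<le> wmass w Q"
    using lint[of "\<lambda>_. 1" 1 "1/2" 1] by (simp add: wmass_def)
  have mass_le: "wmass w Q \<le> V"
    using wmass_slab_le[OF \<epsilon>, of 2 k "\<chi> i. - 1"] by (simp add: w Q V_def)
  have mass0: "0 < wmass w Q" using mass_ge V by simp
  show "1 / (4 * \<epsilon>) \<le> enn2real (A1_const w)"
  proof -
    define es where "es = esssup (lebesgue_on Q) (\<lambda>x. inverse (ennreal (w x)))"
    have "AE x in lebesgue_on Q. inverse (ennreal (w x)) \<le> es" unfolding es_def by (rule esssup_AE)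
    then have "AE x in lebesgue. x \<in> Q \<longrightarrow> inverse (ennreal (w x)) \<le> es"
      by (subst (asm) AE_restrict_space_iff) auto
    then have ae: "AE x in lborel. x \<in> Q \<longrightarrow> inverse (ennreal (w x)) \<le> es"
      by (simp add: AE_completion_iff)
    \<comment> \<open>The middle box has positive measure and weight \<epsilon>, so an essential
      supremum cannot ignore it.\<close>
    have "ennreal (1 / \<epsilon>) \<le> es"
    proof (rule ccontr)
      assume not: "\<not> ennreal (1 / \<epsilon>) \<le> es"
      have "AE x in lborel. x \<notin> P (- 1/4)"
        using ae
      proof eventually_elim
        case (elim x)
        show ?case
        proof
          assume x: "x \<in> P (- 1/4)"
          then have "w x = \<epsilon>" using Pk[OF x] by (auto simp: w slab_weight_def)
          moreover have "x \<in> Q" using x PQ[of "- 1/4"] by auto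
          ultimately show False using elim not \<epsilon> by (simp add: inverse_ennreal divide_inverse)
        qed
      qed
      then have "P (- 1/4) \<in> null_sets lborel" by (subst AE_iff_null_sets) auto
      then have "measure lborel (P (- 1/4)) = 0" by (simp add: null_sets_def measure_def)
      then show False using mP[of "- 1/4"] V by simp
    qed
    then have "ennreal (1 / 4) * ennreal (1 / \<epsilon>) \<le> ennreal (1 / measure lebesgue Q * wmass w Q) * es"
      using mass_ge V mQ by (intro mult_mono ennreal_leI) (auto simp: field_simps)
    also have "\<dots> \<le> A1_const w"
      unfolding A1_const_def es_def Q by (intro SUP_upper2[of "(\<chi> i. - 1, 2)"]) auto
    finally have "ennreal (1 / (4 * \<epsilon>)) \<le> A1_const w" using \<epsilon> by (simp flip: ennreal_mult)
    moreover have "A1_const w < \<infinity>" using slab_in_A1[OF \<epsilon>, of k] by (simp add: A1_def w)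
    ultimately show ?thesis using \<epsilon> by (metis enn2real_ennreal enn2real_mono infinity_ennreal_def
      divide_nonneg_nonneg less_imp_le zero_le_one mult_pos_pos zero_less_numeral)
  qed
  show "1 / 8 \<le> wavg w Q (\<lambda>x. \<bar>f x - c\<bar> powr s) powr (1 / s)"
  proof -
    have fb: "\<bar>f x\<bar> \<le> 1 / 2" for x by (auto simp: f slab_ramp_def max_def min_def)
    obtain t where t: "t \<in> {-1, 1/2}" "\<And>x. x \<in> P t \<Longrightarrow> 1 / 2 \<le> \<bar>f x - c\<bar>"
    proof (cases "0 \<le> c")
      case True
      show ?thesis
      proof (rule that[of "- 1"])
        fix x assume "x \<in> P (- 1)"
        then have "f x = - 1 / 2" using Pk[of x "- 1"] by (auto simp: f slab_ramp_def)
        then show "1 / 2 \<le> \<bar>f x - c\<bar>" using True by simp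
      qed simp
    next
      case False
      show ?thesis
      proof (rule that[of "1 / 2"])
        fix x assume "x \<in> P (1 / 2)"
        then have "f x = 1 / 2" using Pk[of x "1 / 2"] by (auto simp: f slab_ramp_def)
        then show "1 / 2 \<le> \<bar>f x - c\<bar>" using False by simp
      qed simp
    qed
    have "(1 / 2) powr s * (V / 4) \<le> (LINT x:Q|lebesgue. \<bar>f x - c\<bar> powr s * w x)"
    proof (rule lint[where B="(1 / 2 + \<bar>c\<bar>) powr s", OF _ _ _ t(1)])
      show "\<bar>f x - c\<bar> powr s \<le> (1 / 2 + \<bar>c\<bar>) powr s" for x
        using fb[of x] s by (intro powr_mono2) (auto simp: abs_le_iff abs_if split: if_splits)
      show "(1 / 2) powr s \<le> \<bar>f x - c\<bar> powr s" if "x \<in> P t" for x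
        using t(2)[OF that] s by (intro powr_mono2) auto
    qed auto
    moreover from this have "0 \<le> (LINT x:Q|lebesgue. \<bar>f x - c\<bar> powr s * w x)"
      by (rule order_trans[rotated]) (use V in simp)
    ultimately have I: "(1 / 2) powr s * (V / 4) / V \<le> (LINT x:Q|lebesgue. \<bar>f x - c\<bar> powr s * w x) / wmass w Q"
      using mass0 mass_le V by (intro frac_le) auto
    \<comment> \<open>As \<open>s \<ge> 1\<close>, the volume fraction 1/4 is at least its own
      \<open>s\<close>-th power, so the \<open>s\<close>-th root leaves
      \<open>1/2 * 1/4 = 1/8\<close> for every such \<open>s\<close>.\<close>
    have "(1 / 2 :: real) powr s * (1 / 4) powr s \<le> (1 / 2) powr s * (1 / 4)"
      using powr_mono'[of 1 s "1 / 4 :: real"] s by (intro mult_left_mono) auto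
    also have "\<dots> = (1 / 2) powr s * (V / 4) / V" using V by simp
    also have "\<dots> \<le> wavg w Q (\<lambda>x. \<bar>f x - c\<bar> powr s)" using I by (simp add: wavg_def)
    finally have "((1 / 8) powr s) powr (1 / s) \<le> wavg w Q (\<lambda>x. \<bar>f x - c\<bar> powr s) powr (1 / s)"
      using s by (intro powr_mono2) (auto simp flip: powr_mult)
    then show ?thesis using s by (simp add: powr_powr)
  qed
  show "wavg w Q (\<lambda>x. norm (gradient f x)) \<le> 4 * \<epsilon>"
  proof -
    have "(LINT x:Q|lebesgue. norm (gradient f x) * w x) \<le> (LINT x|lebesgue. indicator Q x * \<epsilon>)"
      unfolding set_lebesgue_integral_def
    proof (rule integral_mono')
      show "integrable lebesgue (\<lambda>x. indicator Q x * \<epsilon>)"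
        using cQ by (intro integrable_mult_left integrable_real_indicator) (use emeasure_bounded_finite[OF compact_imp_bounded[OF cQ]] in auto)
      fix x
      have "norm (gradient f x) * w x \<le> \<epsilon>"
      proof (cases "\<bar>x $ k\<bar> < 1 / 2")
        case True
        then have "norm (gradient f x) \<le> 1" "w x = \<epsilon>"
          using slab_norm_gradient_le[of k x] by (auto simp: f w slab_weight_def)
        then show ?thesis using \<epsilon> mult_right_mono[of "norm (gradient f x)" 1 \<epsilon>] by simp
      next
        case False
        then show ?thesis using slab_norm_gradient_le[of k x] \<epsilon> by (simp add: f)
      qed
      then show "indicator Q x *\<^sub>R (norm (gradient f x) * w x) \<le> indicator Q x * \<epsilon>"
        by (simp add: mult_left_mono)
      show "0 \<le> indicator Q x * \<epsilon>" using \<epsilon> by simp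
    qed
    also have "\<dots> = V * \<epsilon>" using mQ by simp
    finally have "(LINT x:Q|lebesgue. norm (gradient f x) * w x) \<le> V * \<epsilon>" .
    then have "(LINT x:Q|lebesgue. norm (gradient f x) * w x) / wmass w Q \<le> V * \<epsilon> / (V / 4)"
      using mass_ge V \<epsilon> by (intro frac_le) auto
    then show ?thesis using V by (simp add: wavg_def)
  qed
qed

text \<open>On the slab example the right-hand side is at most a multiple of
  \<open>\<psi> (A \<epsilon>) * \<epsilon>\<close>, hence of
  \<open>\<psi> (A \<epsilon>) / A \<epsilon>\<close>, which becomes arbitrarily small, while the
  left-hand side stays at least 1/8.\<close>

lemma A1_sobolev_poincare_sharp:
  fixes \<psi> :: "real \<Rightarrow> real"
  assumes n: "2 \<le> CARD('n::finite)" and \<psi>: "\<forall>t\<ge>1. 0 < \<psi> t" "\<psi> \<in> o[at_top](\<lambda>t. t)"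
    and bound: "\<And>w (f :: real ^ 'n \<Rightarrow> real) a l. w \<in> A1 \<Longrightarrow> \<exists>L. L-lipschitz_on UNIV f \<Longrightarrow> 0 < l \<Longrightarrow>
      wavg w (cube a l) (\<lambda>x. \<bar>f x - wavg w (cube a l) f\<bar> powr (real CARD('n) / (real CARD('n) - 1)))
        powr ((real CARD('n) - 1) / real CARD('n))
      \<le> c * \<psi> (enn2real (A1_const w)) * l * wavg w (cube a l) (\<lambda>x. norm (gradient f x))"
  shows False
proof -
  define s where "s = real CARD('n) / (real CARD('n) - 1)"
  have s: "1 \<le> s" "1 / s = (real CARD('n) - 1) / real CARD('n)" using n by (auto simp: s_def)
  define k where "k = (undefined :: 'n)"
  define f where "f = slab_ramp k"
  define Q where "Q = cube (\<chi> i. - 1 :: real ^ 'n) 2"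
  define A where "A \<epsilon> = enn2real (A1_const (slab_weight k \<epsilon>))" for \<epsilon>
  \<comment> \<open>With side length 2 and gradient average at most \<open>4 * \<epsilon>\<close>,
    the right-hand side is at most \<open>8 * \<bar>c\<bar> * d\<close>. This \<open>d\<close> makes
    it at most 1/16, and the added 1 covers \<open>c = 0\<close>.\<close>
  define d where "d = 1 / (128 * (\<bar>c\<bar> + 1))"
  have d: "0 < d" by (simp add: d_def)
  have "\<forall>\<^sub>F t in at_top. norm (\<psi> t) \<le> d * norm t" using landau_o.smallD[OF \<psi>(2) d] by simp
  then obtain T where T: "\<And>t. T \<le> t \<Longrightarrow> \<bar>\<psi> t\<bar> \<le> d * \<bar>t\<bar>" by (auto simp: eventually_at_top_linorder)
  \<comment> \<open>The lower bound \<open>1 / (4 * \<epsilon>)\<close> for the \<open>A1\<close>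
    constant is then \<open>max 1 T\<close>: past the threshold of the little-o condition and in the
    range where \<psi> is positive.\<close>
  define \<epsilon> where "\<epsilon> = 1 / (4 * max 1 T)"
  have \<epsilon>: "0 < \<epsilon>" "\<epsilon> \<le> 1" by (auto simp: \<epsilon>_def max_def divide_le_eq)
  have A1: "max 1 T \<le> A \<epsilon>"
    using slab_lower_bound(1)[OF \<epsilon> Q_def s(1) refl f_def] by (simp add: A_def \<epsilon>_def)
  have A2: "A \<epsilon> \<le> 1 / \<epsilon>"
    unfolding A_def using A1_const_slab_le[OF \<epsilon>, of k] \<epsilon> by (intro enn2real_leI) auto
  have psi: "0 < \<psi> (A \<epsilon>)" "\<psi> (A \<epsilon>) \<le> d * A \<epsilon>"
    using \<psi>(1) A1 T[of "A \<epsilon>"] by auto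
  have "1 / 8 \<le> wavg (slab_weight k \<epsilon>) Q (\<lambda>x. \<bar>f x - wavg (slab_weight k \<epsilon>) Q f\<bar> powr s) powr (1 / s)"
    by (rule slab_lower_bound(2)[OF \<epsilon> Q_def s(1) refl f_def])
  also have "\<dots> \<le> c * \<psi> (A \<epsilon>) * 2 * wavg (slab_weight k \<epsilon>) Q (\<lambda>x. norm (gradient f x))"
    unfolding A_def Q_def s(2) unfolding s_def f_def
    using slab_lipschitz by (intro bound slab_in_A1 \<epsilon>) auto
  also have "\<dots> \<le> \<bar>c\<bar> * (d * A \<epsilon>) * 2 * (4 * \<epsilon>)"
  proof -
    have "0 \<le> wavg (slab_weight k \<epsilon>) Q (\<lambda>x. norm (gradient f x))"
      unfolding wavg_def using wmass_nonneg[OF weight_slab[OF \<epsilon>]] \<epsilon>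
      by (intro mult_nonneg_nonneg) (auto simp: set_lebesgue_integral_def slab_weight_def intro!: integral_nonneg_AE)
    moreover have "c * \<psi> (A \<epsilon>) \<le> \<bar>c\<bar> * (d * A \<epsilon>)"
      using psi by (intro mult_mono) auto
    moreover have "0 \<le> \<bar>c\<bar> * (d * A \<epsilon>)" using psi by simp
    ultimately show ?thesis
      using slab_lower_bound(3)[OF \<epsilon> Q_def s(1) refl f_def] by (intro mult_mono[OF mult_right_mono]) auto
  qed
  also have "\<dots> = 8 * \<bar>c\<bar> * d * (A \<epsilon> * \<epsilon>)" by simp
  also have "\<dots> \<le> 8 * \<bar>c\<bar> * d * 1"
    using A2 \<epsilon> d by (intro mult_left_mono) (auto simp: pos_le_divide_eq)
  also have "\<dots> \<le> 1 / 16"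
    by (simp add: d_def divide_le_eq)
  finally show False by simp
qed

theorem corollary1p22:
  assumes "CARD('n::finite) \<ge> 2"
  shows "(\<forall>p pstar :: real.
            1 \<le> p \<and> p < real CARD('n) \<and> 1 / p - 1 / pstar = 1 / real CARD('n) \<longrightarrow>
            (\<exists>c :: real. \<forall>w \<in> A1. \<forall>f :: real ^ 'n \<Rightarrow> real. \<forall>a l.
               (\<exists>L. L-lipschitz_on UNIV f) \<and> 0 < l \<longrightarrow>
               wavg w (cube a l) (\<lambda>x. \<bar>f x - wavg w (cube a l) f\<bar> powr pstar) powr (1 / pstar)
               \<le> c * enn2real (A1_const w) * l *
                 wavg w (cube a l) (\<lambda>x. norm (gradient f x) powr p) powr (1 / p)))
       \<and> (\<forall>\<psi> :: real \<Rightarrow> real.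
            (\<forall>t \<ge> 1. 0 < \<psi> t) \<and> \<psi> \<in> o[at_top](\<lambda>t. t) \<longrightarrow>
            \<not> (\<exists>c :: real. \<forall>w \<in> A1. \<forall>f :: real ^ 'n \<Rightarrow> real. \<forall>a l.
               (\<exists>L. L-lipschitz_on UNIV f) \<and> 0 < l \<longrightarrow>
               wavg w (cube a l)
                   (\<lambda>x. \<bar>f x - wavg w (cube a l) f\<bar> powr (real CARD('n) / (real CARD('n) - 1)))
                 powr ((real CARD('n) - 1) / real CARD('n))
               \<le> c * \<psi> (enn2real (A1_const w)) * l *
                 wavg w (cube a l) (\<lambda>x. norm (gradient f x))))"
proof (intro conjI allI impI notI)
  fix p pstar :: real
  assume "1 \<le> p \<and> p < real CARD('n) \<and> 1 / p - 1 / pstar = 1 / real CARD('n)"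
  then show "\<exists>c :: real. \<forall>w \<in> A1. \<forall>f :: real ^ 'n \<Rightarrow> real. \<forall>a l.
       (\<exists>L. L-lipschitz_on UNIV f) \<and> 0 < l \<longrightarrow>
       wavg w (cube a l) (\<lambda>x. \<bar>f x - wavg w (cube a l) f\<bar> powr pstar) powr (1 / pstar)
       \<le> c * enn2real (A1_const w) * l *
         wavg w (cube a l) (\<lambda>x. norm (gradient f x) powr p) powr (1 / p)"
    using A1_sobolev_poincare[OF assms, of p pstar] by blast
next
  fix \<psi> :: "real \<Rightarrow> real"
  assume "(\<forall>t \<ge> 1. 0 < \<psi> t) \<and> \<psi> \<in> o[at_top](\<lambda>t. t)"
    and "\<exists>c :: real. \<forall>w \<in> A1. \<forall>f :: real ^ 'n \<Rightarrow> real. \<forall>a l.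
       (\<exists>L. L-lipschitz_on UNIV f) \<and> 0 < l \<longrightarrow>
       wavg w (cube a l)
           (\<lambda>x. \<bar>f x - wavg w (cube a l) f\<bar> powr (real CARD('n) / (real CARD('n) - 1)))
         powr ((real CARD('n) - 1) / real CARD('n))
       \<le> c * \<psi> (enn2real (A1_const w)) * l *
         wavg w (cube a l) (\<lambda>x. norm (gradient f x))"
  then show False using A1_sobolev_poincare_sharp[OF assms, of \<psi>] by blast
qed

end
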